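(* For $n\in\{2,3,4\}$ the spectrum of the Neumann Laplacian on the Vicsek set $\mathcal{VS}_n$ has a ratio gap containing $\sqrt{\rho_n}$, where $\rho_n=(4n-3)(2n-1)$; that is, there exist real numbers $a<\sqrt{\rho_n}<b$ such that for all nonzero eigenvalues $\lambda,\mu$ of the Neumann Laplacian on $\mathcal{VS}_n$ one has $\lambda/\mu\notin(a,b)$.
   Context: Vicsek set. For $n\ge2$, $\mathcal{VS}_n$ is the self-similar set in the unit square generated by the $4n-3$ orientation-preserving homotheties $F_i$ of ratio $1/(2n-1)$ that map the unit square onto the $4n-3$ subsquares lying along the two diagonals of the $(2n-1)\times(2n-1)$ grid of subsquares. $V_0$ is the set of the four corners, $\Gamma_0$ the complete graph on $V_0$; $V_m=\bigcup_iF_i(V_{m-1})$, and $\Gamma_m$ is the graph on $V_m$ in which two vertices are adjacent iff both are corners of a common $m$-cell. The graph Laplacian is $\Delta_mu(x)=\frac1{\deg x}\sum_{y\sim x}(u(y)-u(x))$ for all $x\in V_m$ (Neumann boundary conditions), and the Neumann Laplacian on $\mathcal{VS}_n$ is $\Delta u=\lim_{m}\rho_n^m\Delta_mu$; eigenvalues are those of $-\Delta$. Spectral decimation (known description of the spectrum). Let $U_k$ be the Chebyshev polynomials of the second kind, $g_n(\lambda)=U_{n-1}(3\lambda-1)-U_{n-2}(3\lambda-1)$, $h_n(\lambda)=U_{n-1}(3\lambda-1)-3U_{n-2}(3\lambda-1)$ and $R(\lambda)=\lambda g_n(\lambda)h_n(\lambda)$. Let $\phi_1<\cdots<\phi_{2n-1}$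 be the inverse branches of $R$ on $[0,4/3]$. The eigenvalues are exactly the numbers of the forms: (a) ($0$-series) $\lim_{m\to\infty}\rho_n^m\phi_{w_m}\circ\cdots\circ\phi_{w_1}(0)$, where all but finitely many $w_j$ equal $1$, and the first $w_j\ne1$ (if any) is odd; (b) ($4/3$-series, born on level $k\ge0$) $\lim_{m\to\infty}\rho_n^{m+k}\phi_{w_m}\circ\cdots\circ\phi_{w_1}(4/3)$, where all but finitely many $w_j$ equal $1$, $w_1$ is odd and $w_1\ne2n-1$. *)

theory Defs
  imports "HOL-Analysis.Analysis"
begin

text \<open>
  The grid of \<open>(2n-1) \<times> (2n-1)\<close> subsquares of the unit square is addressed by the integer
  coordinates (column, row) of a subsquare; the two diagonals share the central subsquare, so
  there are \<open>4n-3\<close> addresses.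
\<close>

definition diag_cells :: "nat \<Rightarrow> (nat \<times> nat) set" where
  "diag_cells n = {(k, k) | k. k < 2 * n - 1} \<union> {(k, 2 * n - 2 - k) | k. k < 2 * n - 1}"

definition vs_map :: "nat \<Rightarrow> nat \<times> nat \<Rightarrow> real \<times> real \<Rightarrow> real \<times> real" where
  "vs_map n d p = (1 / (2 * real n - 1)) *\<^sub>R ((real (fst d), real (snd d)) + p)"

definition vicsek_set :: "nat \<Rightarrow> (real \<times> real) set" where
  "vicsek_set n =
    (THE K. compact K \<and> K \<noteq> {} \<and> K = (\<Union>d\<in>diag_cells n. vs_map n d ` K))"

definition corners :: "(real \<times> real) set" where
  "corners = {(0, 0), (1, 0), (0, 1), (1, 1)}"

fun vs_vertices :: "nat \<Rightarrow> nat \<Rightarrow> (real \<times> real) set" where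
  "vs_vertices n 0 = corners"
| "vs_vertices n (Suc m) = (\<Union>d\<in>diag_cells n. vs_map n d ` vs_vertices n m)"

text \<open>
  An \<open>m\<close>-cell is the image of the Vicsek set under a composition of \<open>m\<close> of the maps, and its
  corners are the images of the four corners of the unit square.
\<close>

definition word_map :: "nat \<Rightarrow> (nat \<times> nat) list \<Rightarrow> real \<times> real \<Rightarrow> real \<times> real" where
  "word_map n w = foldr (\<lambda>d g. vs_map n d \<circ> g) w id"

definition vs_adj :: "nat \<Rightarrow> nat \<Rightarrow> real \<times> real \<Rightarrow> real \<times> real \<Rightarrow> bool" where
  "vs_adj n m x y \<longleftrightarrow> x \<noteq> y \<and>
    (\<exists>w. length w = m \<and> set w \<subseteq> diag_cells n \<and>
         x \<in> word_map n w ` corners \<and> y \<in> word_map n w ` corners)"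

definition graph_laplacian ::
  "nat \<Rightarrow> nat \<Rightarrow> (real \<times> real \<Rightarrow> real) \<Rightarrow> real \<times> real \<Rightarrow> real" where
  "graph_laplacian n m u x =
    (\<Sum>y | vs_adj n m x y. u y - u x) / real (card {y. vs_adj n m x y})"

definition rho :: "nat \<Rightarrow> real" where
  "rho n = (4 * real n - 3) * (2 * real n - 1)"

text \<open>
  \<open>u\<close> is in the domain of the Neumann Laplacian and \<open>f\<close> is its image: both are continuous and the
  renormalized graph Laplacians converge uniformly to \<open>f\<close>.  Uniformity is measured over the
  vertex set of the current level, where the graph Laplacian of that level is defined; the four
  boundary corners are included, which is what imposes the Neumann condition.
\<close>

definition has_neumann_laplacian ::
  "nat \<Rightarrow> (real \<times> real \<Rightarrow> real) \<Rightarrow> (real \<times> real \<Rightarrow> real) \<Rightarrow> bool" where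
  "has_neumann_laplacian n u f \<longleftrightarrow>
    continuous_on (vicsek_set n) u \<and> continuous_on (vicsek_set n) f \<and>
    (\<forall>e>0. \<exists>M. \<forall>m\<ge>M. \<forall>x\<in>vs_vertices n m.
       \<bar>rho n ^ m * graph_laplacian n m u x - f x\<bar> < e)"

definition neumann_eigenvalue :: "nat \<Rightarrow> real \<Rightarrow> bool" where
  "neumann_eigenvalue n l \<longleftrightarrow>
    (\<exists>u. (\<exists>x\<in>vicsek_set n. u x \<noteq> 0) \<and> has_neumann_laplacian n u (\<lambda>x. - l * u x))"

end

(*
  The restriction of a Neumann eigenfunction to the vertices of level m is an approximate eigenvector
  of the graph Laplacian, which is symmetric for the degree weights; hence an eigenvalue l is a limit
  of rho^m x_m with x_m an eigenvalue of the negative graph Laplacian of level m.  Eliminating the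
  vertices inside each cell along its four arms shows that such an x_m is 4/3, or is mapped by the
  decimation polynomial R to 0, to 4/3 or to an eigenvalue of level m - 1.  Only this inclusion is
  needed: every x_m lies in the backward orbit of {0, 4/3} under R, also if some branches of that
  orbit carry no eigenvalue.

  Near 0 the polynomial R is multiplication by rho up to second order, so that ratios of small points
  of the backward orbit are, up to powers of rho, ratios of linearised coordinates of points outside
  the lowest band.  The gaps of the backward orbit confine these coordinates to a few intervals, and
  the interval endpoints are computed precisely enough to see that no ratio is close to the square
  root of rho.  The margin is small: for n = 4 it is about 0.05 percent.
*)
theory Submission
  imports Defs
begin

section \<open>Cells and their corners\<close>

text \<open>Two eigenvalues are compared on one common level, so the power of \<open>rho n\<close>
  cancels and only ratios of tree points close to 0 count. The tree is Cantor-like; it is covered by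
  finitely many intervals, and a band is cut further where otherwise \<open>sqrt (rho n)\<close>
  would be a quotient of two intervals. The linearised intervals lie within a factor
  \<open>rho n\<close> of each other, so only two neighbouring powers of \<open>rho n\<close> can
  bring a ratio near the square root. The involution r -> rho / r fixes that root, and therefore one
  table of pairs excludes both powers. If -c is the quadratic coefficient of R, the linearising
  coordinate begins with x + c / (rho^2 - rho) * x^2; the constants \<open>d\<close> are this
  coefficient rounded up, which pays for the higher terms. The value 4/3 is exceptional throughout:
  the equations inside a cell degenerate there, and R sends it above 4/3. It is therefore a seed of
  the tree and an isolated piece of every cover.\<close>

definition words :: "nat \<Rightarrow> nat \<Rightarrow> (nat \<times> nat) list set" where
  "words n m = {w. set w \<subseteq> diag_cells n \<and> length w = m}"

text \<open>A vertex shared by two cells is represented by two pairs.\<close>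

definition ends :: "nat \<Rightarrow> nat \<Rightarrow> ((nat \<times> nat) list \<times> (real \<times> real)) set" where
  "ends n m = words n m \<times> corners"

definition pt :: "nat \<Rightarrow> (nat \<times> nat) list \<times> (real \<times> real) \<Rightarrow> real \<times> real" where
  "pt n i = word_map n (fst i) (snd i)"

definition cell_sum :: "nat \<Rightarrow> (real \<times> real \<Rightarrow> real) \<Rightarrow> (nat \<times> nat) list \<Rightarrow> real" where
  "cell_sum n u w = (\<Sum>k\<in>corners. u (word_map n w k))"

text \<open>
  A vertex of degree \<open>d\<close> lies in \<open>d/3\<close> cells, so \<open>d\<close> times the eigenvalue equation for the negative
  graph Laplacian says that the residuals at the vertex, one for each of these cells, cancel.
\<close>

definition residual ::
  "nat \<Rightarrow> real \<Rightarrow> (real \<times> real \<Rightarrow> real) \<Rightarrow> (nat \<times> nat) list \<times> (real \<times> real) \<Rightarrow> real" where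
  "residual n l u i = cell_sum n u (fst i) - (4 - 3 * l) * u (pt n i)"

definition is_eig :: "nat \<Rightarrow> nat \<Rightarrow> real \<Rightarrow> (real \<times> real \<Rightarrow> real) \<Rightarrow> bool" where
  "is_eig n m l u \<longleftrightarrow>
    (\<forall>x. (\<Sum>i | i \<in> ends n m \<and> pt n i = x. residual n l u i) = 0) \<and>
    (\<exists>i\<in>ends n m. u (pt n i) \<noteq> 0)"

definition unit_square :: "(real \<times> real) set" where
  "unit_square = {0..1} \<times> {0..1}"

definition opp :: "real \<times> real \<Rightarrow> real \<times> real" where
  "opp c = (1 - fst c, 1 - snd c)"

text \<open>The \<open>i\<close>-th cell on the way from the corner \<open>c\<close> to the central cell, which has index \<open>n - 1\<close>.\<close>

definition arm_cell :: "nat \<Rightarrow> real \<times> real \<Rightarrow> nat \<Rightarrow> nat \<times> nat" where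
  "arm_cell n c i = (if fst c = 0 then i else 2 * n - 2 - i, if snd c = 0 then i else 2 * n - 2 - i)"

section \<open>Geometry of the maps and of the points where cells meet\<close>

lemma word_map_Nil [simp]: "word_map n [] = id"
  by (simp add: word_map_def)

lemma word_map_Cons [simp]: "word_map n (d # w) = vs_map n d \<circ> word_map n w"
  by (simp add: word_map_def)

lemma word_map_append: "word_map n (v @ w) = word_map n v \<circ> word_map n w"
  by (induction v) (simp_all add: comp_assoc)

lemma finite_corners [simp]: "finite corners"
  by (simp add: corners_def)

lemma sum_corners: "(\<Sum>k\<in>corners. f k) = f (0,0) + f (1,0) + f (0,1) + (f (1,1) :: real)"
  by (simp add: corners_def)

lemma card_corners [simp]: "card corners = 4"
  by (simp add: corners_def)

lemma corners_subset: "corners \<subseteq> unit_square"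
  by (auto simp: corners_def unit_square_def)

lemma finite_diag_cells [simp]: "finite (diag_cells n)"
proof -
  have "diag_cells n = (\<lambda>k. (k, k)) ` {..<2*n-1} \<union> (\<lambda>k. (k, 2*n-2-k)) ` {..<2*n-1}"
    by (auto simp: diag_cells_def)
  then show ?thesis by simp
qed

lemma vs_map_inj:
  assumes "n > 0" "vs_map n d p = vs_map n d q"
  shows "p = q"
  using assms by (auto simp: vs_map_def prod_eq_iff)

lemma vs_map_eq_iff:
  assumes "n > 0"
  shows "vs_map n d p = vs_map n e q \<longleftrightarrow>
    real (fst d) + fst p = real (fst e) + fst q \<and> real (snd d) + snd p = real (snd e) + snd q"
  using assms by (auto simp: vs_map_def prod_eq_iff)

lemma word_map_inj: "n > 0 \<Longrightarrow> word_map n w p = word_map n w q \<Longrightarrow> p = q"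
  by (induction w) (auto dest: vs_map_inj)

lemma diag_cells_le: "d \<in> diag_cells n \<Longrightarrow> fst d \<le> 2 * n - 2 \<and> snd d \<le> 2 * n - 2"
  by (auto simp: diag_cells_def)

lemma vs_map_unit_square:
  assumes "n > 0" "d \<in> diag_cells n" "p \<in> unit_square"
  shows "vs_map n d p \<in> unit_square"
proof -
  have "fst d \<le> 2 * n - 2" "snd d \<le> 2 * n - 2" using diag_cells_le assms by blast+
  then have "real (fst d) \<le> 2 * real n - 2" "real (snd d) \<le> 2 * real n - 2"
    using assms(1) by (simp_all flip: of_nat_le_iff add: of_nat_diff)
  then show ?thesis using assms
    by (auto simp: vs_map_def unit_square_def mem_Times_iff divide_simps split: if_splits)
qed

lemma word_map_unit_square:
  "n > 0 \<Longrightarrow> set w \<subseteq> diag_cells n \<Longrightarrow> p \<in> unit_square \<Longrightarrow> word_map n w p \<in> unit_square"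
  by (induction w) (auto intro: vs_map_unit_square)

text \<open>A grid index between 0 and 2n-2 plus an offset in [0,1] can equal 0 or 2n-1 only if the
  offset is 0 or 1.\<close>

lemma vs_map_corner_imp:
  assumes n: "n > 0" and d: "d \<in> diag_cells n" and p: "p \<in> unit_square"
    and c: "vs_map n d p \<in> corners"
  shows "p \<in> corners"
proof -
  have *: "t = 0 \<or> t = 1" if "k \<le> 2 * n - 2" "0 \<le> t" "t \<le> 1"
    "(real k + t) / (2 * real n - 1) = 0 \<or> (real k + t) / (2 * real n - 1) = 1" for k t
  proof -
    have "real k \<le> 2 * real n - 2" using that(1) n
      by (simp flip: of_nat_le_iff add: of_nat_diff)
    then show ?thesis using that n by (auto simp: field_simps)
  qed
  have p01: "0 \<le> fst p" "fst p \<le> 1" "0 \<le> snd p" "snd p \<le> 1"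
    using p by (auto simp: unit_square_def)
  have "(real (fst d) + fst p) / (2 * real n - 1) = 0 \<or> (real (fst d) + fst p) / (2 * real n - 1) = 1"
    "(real (snd d) + snd p) / (2 * real n - 1) = 0 \<or> (real (snd d) + snd p) / (2 * real n - 1) = 1"
    using c by (auto simp: corners_def vs_map_def prod_eq_iff)
  then have "fst p = 0 \<or> fst p = 1" "snd p = 0 \<or> snd p = 1"
    using *[OF conjunct1[OF diag_cells_le[OF d]] p01(1,2)]
      *[OF conjunct2[OF diag_cells_le[OF d]] p01(3,4)] by blast+
  then show ?thesis by (cases p) (auto simp: corners_def)
qed

lemma word_map_corner_imp:
  "n > 0 \<Longrightarrow> set w \<subseteq> diag_cells n \<Longrightarrow> p \<in> unit_square \<Longrightarrow> word_map n w p \<in> corners \<Longrightarrow> p \<in> corners"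
  by (induction w) (auto intro: vs_map_corner_imp word_map_unit_square)

text \<open>Two different cells on the diagonals never share a side: two indices differing by one
  would have to add up to the even number 2(n-1). So they touch diagonally in one point, which
  determines their displacement.\<close>

lemma cells_meet:
  assumes n: "n > 0" and d: "d \<in> diag_cells n" and e: "e \<in> diag_cells n" and "d \<noteq> e"
    and p: "p \<in> unit_square" and q: "q \<in> unit_square" and eq: "vs_map n d p = vs_map n e q"
  shows "p \<in> corners" "q = opp p" "real (fst e) = real (fst d) + 2 * fst p - 1"
    "real (snd e) = real (snd d) + 2 * snd p - 1"
proof -
  obtain p1 p2 q1 q2 d1 d2 e1 e2 where
    [simp]: "p = (p1, p2)" "q = (q1, q2)" "d = (d1, d2)" "e = (e1, e2)"
    by (metis surj_pair)
  have eqs: "real d1 + p1 = real e1 + q1" "real d2 + p2 = real e2 + q2"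
    using eq vs_map_eq_iff[OF n] by auto
  have bds: "0 \<le> p1" "p1 \<le> 1" "0 \<le> p2" "p2 \<le> 1" "0 \<le> q1" "q1 \<le> 1" "0 \<le> q2" "q2 \<le> 1"
    using p q by (auto simp: unit_square_def)
  have near: "d1 \<le> e1 + 1" "e1 \<le> d1 + 1" "d2 \<le> e2 + 1" "e2 \<le> d2 + 1"
    using eqs bds by linarith+
  have diag: "d1 = d2 \<or> d2 + d1 = 2 * (n - 1)" "e1 = e2 \<or> e2 + e1 = 2 * (n - 1)"
    using d e by (auto simp: diag_cells_def)
  have "d1 \<noteq> e1"
  proof
    assume "d1 = e1"
    then have "d2 = e2 + 1 \<or> e2 = d2 + 1" "d2 + e2 = 2 * (n - 1)"
      using near diag \<open>d \<noteq> e\<close> by auto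
    then show False by (elim disjE) presburger+
  qed
  moreover have "d2 \<noteq> e2"
  proof
    assume "d2 = e2"
    then have "d1 = e1 + 1 \<or> e1 = d1 + 1" "d1 + e1 = 2 * (n - 1)"
      using near diag \<open>d \<noteq> e\<close> by auto
    then show False by (elim disjE) presburger+
  qed
  ultimately have "(d1 = e1 + 1 \<or> e1 = d1 + 1) \<and> (d2 = e2 + 1 \<or> e2 = d2 + 1)"
    using near by auto
  then have *: "p1 = 1 \<and> q1 = 0 \<and> e1 = d1 + 1 \<or> p1 = 0 \<and> q1 = 1 \<and> d1 = e1 + 1"
    "p2 = 1 \<and> q2 = 0 \<and> e2 = d2 + 1 \<or> p2 = 0 \<and> q2 = 1 \<and> d2 = e2 + 1"
    using eqs bds by auto
  then show "p \<in> corners" by (auto simp: corners_def)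
  from * show "q = opp p" "real (fst e) = real (fst d) + 2 * fst p - 1"
    "real (snd e) = real (snd d) + 2 * snd p - 1"
    by (auto simp: opp_def)
qed

lemma opp_corner: "c \<in> corners \<Longrightarrow> opp c \<in> corners"
  by (auto simp: corners_def opp_def)

text \<open>At the first letter where the words differ, \<open>cells_meet\<close> makes the images
  under the remaining letters corners of the square; \<open>word_map_corner_imp\<close> carries this
  back to \<open>p\<close> and \<open>q\<close>.\<close>

lemma word_cells_meet_in_corners:
  "length v = length w \<Longrightarrow> n > 0 \<Longrightarrow> v \<noteq> w \<Longrightarrow> set v \<subseteq> diag_cells n \<Longrightarrow> set w \<subseteq> diag_cells n \<Longrightarrow>
   p \<in> unit_square \<Longrightarrow> q \<in> unit_square \<Longrightarrow> word_map n v p = word_map n w q \<Longrightarrow>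
   p \<in> corners \<and> q \<in> corners"
proof (induction v w rule: list_induct2)
  case Nil
  then show ?case by simp
next
  case (Cons d v e w)
  show ?case
  proof (cases "d = e")
    case True
    then have "word_map n v p = word_map n w q"
      using vs_map_inj[OF Cons.prems(1)] Cons.prems(7) by simp
    with True show ?thesis using Cons.IH Cons.prems by simp
  next
    case False
    have sq: "word_map n v p \<in> unit_square" "word_map n w q \<in> unit_square"
      using Cons.prems word_map_unit_square by auto
    have "word_map n v p \<in> corners \<and> word_map n w q \<in> corners"
      using cells_meet(1,2)[OF Cons.prems(1) _ _ False sq] opp_corner Cons.prems by auto
    with word_map_corner_imp[OF Cons.prems(1)] show ?thesis using Cons.prems by (simp; blast)
  qed
qed

lemma arm_cell_diag: "i \<le> n - 1 \<Longrightarrow> n > 0 \<Longrightarrow> arm_cell n c i \<in> diag_cells n"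
  by (auto simp: arm_cell_def diag_cells_def intro!: exI)

lemma arm_cell_center: "n > 0 \<Longrightarrow> arm_cell n c (n - 1) = (n - 1, n - 1)"
  by (auto simp: arm_cell_def)

lemma arm_junction:
  assumes "c \<in> corners" "i < n - 1"
  shows "vs_map n (arm_cell n c i) (opp c) = vs_map n (arm_cell n c (Suc i)) c"
  using assms by (subst vs_map_eq_iff) (auto simp: corners_def arm_cell_def opp_def of_nat_diff)

text \<open>An arm cell before the centre touches only its successor, at \<open>opp c\<close>, and
  its predecessor, at \<open>c\<close>. The clause \<open>i > 0\<close> is what leaves the corner
  \<open>c\<close> of the outermost cell free. The four values of \<open>c\<close> are the four
  symmetric positions of the arm.\<close>

lemma arm_cell_meet:
  assumes c: "c \<in> corners" and i: "i < n - 1" and p: "p \<in> corners" and e: "e \<in> diag_cells n"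
    and q: "q \<in> corners" and eq: "vs_map n (arm_cell n c i) p = vs_map n e q"
    and ne: "e \<noteq> arm_cell n c i"
  shows "p = opp c \<and> e = arm_cell n c (Suc i) \<and> q = c \<or> p = c \<and> i > 0"
proof -
  obtain e1 e2 where e12: "e = (e1, e2)" by (metis surj_pair)
  obtain N where N: "n = Suc N" "i < N" using i by (cases n) auto
  \<comment> \<open>The mirrored index; with \<open>i + j = 2 * N\<close> linear arithmetic can
    decide all positions of the neighbour.\<close>
  define j where "j = 2 * N - i"
  have j: "i + j = 2 * N" using N by (simp add: j_def)
  have arm: "arm_cell n c i = (if fst c = 0 then i else j, if snd c = 0 then i else j)"
    "arm_cell n c (Suc i) = (if fst c = 0 then Suc i else j - 1, if snd c = 0 then Suc i else j - 1)"
    using N by (auto simp add: arm_cell_def j_def)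
  have n: "n > 0" using N by simp
  have e': "e1 = e2 \<and> e1 \<le> 2 * N \<or> e1 + e2 = 2 * N"
    using e N by (auto simp: diag_cells_def e12)
  have d: "arm_cell n c i \<in> diag_cells n" using i by (intro arm_cell_diag) auto
  note meet = cells_meet[OF n d e ne[symmetric] _ _ eq]
  have q': "q = opp p" and "real e1 = real (fst (arm_cell n c i)) + 2 * fst p - 1"
    "real e2 = real (snd (arm_cell n c i)) + 2 * snd p - 1"
    using meet(2-4) p q corners_subset unfolding e12 by auto
  moreover have pc: "fst p \<in> {0, 1}" "snd p \<in> {0, 1}" "fst c \<in> {0, 1}" "snd c \<in> {0, 1}"
    using p c by (auto simp: corners_def)
  ultimately have h:
    "fst p = 1 \<and> e1 = fst (arm_cell n c i) + 1 \<or> fst p = 0 \<and> fst (arm_cell n c i) = e1 + 1"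
    "snd p = 1 \<and> e2 = snd (arm_cell n c i) + 1 \<or> snd p = 0 \<and> snd (arm_cell n c i) = e2 + 1"
    by auto
  have "p = opp c \<and> e = arm_cell n c (Suc i) \<or> p = c \<and> i > 0"
  proof -
    consider "fst c = 0" "snd c = 0" | "fst c = 0" "snd c = 1" | "fst c = 1" "snd c = 0"
      | "fst c = 1" "snd c = 1" using pc(3,4) by blast
    then show ?thesis
    proof cases
      case 1
      then have a: "arm_cell n c i = (i, i)" "arm_cell n c (Suc i) = (Suc i, Suc i)"
        unfolding arm by simp_all
      have "fst p = 1 \<and> snd p = 1 \<and> e1 = Suc i \<and> e2 = Suc i \<or> fst p = 0 \<and> snd p = 0 \<and> i > 0"
        using h e' j N(2) unfolding a fst_conv snd_conv by (elim disjE conjE;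
            ((rule FalseE; linarith) | (intro disjI1 conjI; linarith) | (intro disjI2 conjI; linarith)))
      then show ?thesis using 1 unfolding a e12 by (auto simp: prod_eq_iff opp_def)
    next
      case 2
      then have a: "arm_cell n c i = (i, j)" "arm_cell n c (Suc i) = (Suc i, j - 1)"
        unfolding arm by simp_all
      have "fst p = 1 \<and> snd p = 0 \<and> e1 = Suc i \<and> e2 = j - 1 \<or> fst p = 0 \<and> snd p = 1 \<and> i > 0"
        using h e' j N(2) unfolding a fst_conv snd_conv by (elim disjE conjE;
            ((rule FalseE; linarith) | (intro disjI1 conjI; linarith) | (intro disjI2 conjI; linarith)))
      then show ?thesis using 2 unfolding a e12 by (auto simp: prod_eq_iff opp_def)
    next
      case 3
      then have a: "arm_cell n c i = (j, i)" "arm_cell n c (Suc i) = (j - 1, Suc i)"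
        unfolding arm by simp_all
      have "fst p = 0 \<and> snd p = 1 \<and> e1 = j - 1 \<and> e2 = Suc i \<or> fst p = 1 \<and> snd p = 0 \<and> i > 0"
        using h e' j N(2) unfolding a fst_conv snd_conv by (elim disjE conjE;
            ((rule FalseE; linarith) | (intro disjI1 conjI; linarith) | (intro disjI2 conjI; linarith)))
      then show ?thesis using 3 unfolding a e12 by (auto simp: prod_eq_iff opp_def)
    next
      case 4
      then have a: "arm_cell n c i = (j, j)" "arm_cell n c (Suc i) = (j - 1, j - 1)"
        unfolding arm by simp_all
      have "fst p = 0 \<and> snd p = 0 \<and> e1 = j - 1 \<and> e2 = j - 1 \<or> fst p = 1 \<and> snd p = 1 \<and> i > 0"
        using h e' j N(2) unfolding a fst_conv snd_conv by (elim disjE conjE;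
            ((rule FalseE; linarith) | (intro disjI1 conjI; linarith) | (intro disjI2 conjI; linarith)))
      then show ?thesis using 4 unfolding a e12 by (auto simp: prod_eq_iff opp_def)
    qed
  qed
  then show ?thesis using q' by (auto simp: opp_def)
qed

lemma vs_map_arm_cell_0: "n > 0 \<Longrightarrow> k \<in> corners \<Longrightarrow> vs_map n (arm_cell n k 0) k = k"
  by (auto simp: corners_def arm_cell_def vs_map_def of_nat_diff)

text \<open>The cell \<open>arm_cell n k 0\<close> fixes \<open>k\<close>, and by
  \<open>arm_cell_meet\<close> with index 0 no other cell touches it there.\<close>

lemma vs_map_corner_iff:
  assumes n: "n \<ge> 2" and d: "d \<in> diag_cells n" and p: "p \<in> corners" and k: "k \<in> corners"
  shows "vs_map n d p = k \<longleftrightarrow> d = arm_cell n k 0 \<and> p = k"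
proof
  have n0: "n > 0" using n by simp
  assume "vs_map n d p = k"
  then have eq: "vs_map n (arm_cell n k 0) k = vs_map n d p"
    using vs_map_arm_cell_0[OF n0 k] by simp
  have "d = arm_cell n k 0"
  proof (rule ccontr)
    assume "d \<noteq> arm_cell n k 0"
    then show False
      using arm_cell_meet[OF k _ k d p eq] n k
      by (auto simp: opp_def corners_def)
  qed
  then show "d = arm_cell n k 0 \<and> p = k" using eq vs_map_inj[OF n0] by metis
qed (use vs_map_arm_cell_0[OF _ k] n in auto)

section \<open>Spectral decimation\<close>

text \<open>
  The state consists of the value at the vertex where an arm enters a cell and the common value at
  the two corners of this cell off the arm.
\<close>

fun chain :: "real \<Rightarrow> nat \<Rightarrow> real \<Rightarrow> real \<Rightarrow> real \<times> real" where
  "chain l 0 a v = (a, v)"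
| "chain l (Suc k) a v =
    (let (a', v') = chain l k a v; a'' = (2 - 3 * l) * v' - a' in (a'', 2 * a'' - v'))"

text \<open>The coefficient in the equation of the central cell after elimination:
  \<open>neck n l\<close> times the normalised sum \<open>s\<close> of that cell equals the sum of
  the four corner values.\<close>

definition neck :: "nat \<Rightarrow> real \<Rightarrow> real" where
  "neck n l = (4 - 3 * l) * snd (chain l (n - 1) 0 1) - 4 * fst (chain l (n - 1) 0 1)"

text \<open>The form 4 - 3R = neck * (gamma + delta) is the one in which the elimination delivers R.
  For n = 2, 3, 4 it is evaluated below to the polynomial R = \<lambda> g_n h_n.\<close>

definition decimation_map :: "nat \<Rightarrow> real \<Rightarrow> real" where
  "decimation_map n l =
    (4 - neck n l * (snd (chain l (n - 1) 1 0) + snd (chain l (n - 1) 0 1))) / 3"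

lemma chain_linear:
  "fst (chain l k a v) = fst (chain l k 1 0) * a + fst (chain l k 0 1) * v \<and>
   snd (chain l k a v) = snd (chain l k 1 0) * a + snd (chain l k 0 1) * v"
  by (induction k) (auto simp: Let_def case_prod_beta algebra_simps)

text \<open>One step acts on the pair of values by a matrix of determinant 1.\<close>

lemma chain_det:
  "fst (chain l k 1 0) * snd (chain l k 0 1) - fst (chain l k 0 1) * snd (chain l k 1 0) = 1"
proof (induction k)
  case (Suc k)
  have "(z * c - a) * (2 * (z * d - b) - d) - (z * d - b) * (2 * (z * c - a) - c) = a * d - b * c"
    for a b c d z :: real
    by (simp add: algebra_simps)
  with Suc show ?case by (simp add: Let_def case_prod_beta)
qed simp

text \<open>Here \<open>p\<close> holds the corner values of a cell, \<open>v\<close> the values off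
  the arms in the outermost arm cells, \<open>s\<close> the normalised sum of the central cell, and
  \<open>k\<close> is 4 - 3l. Summing the four arm equations gives two linear equations for
  \<open>sum p\<close> and \<open>sum v\<close>; the determinant removes the latter.\<close>

lemma decimation_algebra:
  fixes p v :: "real \<times> real \<Rightarrow> real"
  assumes det: "\<alpha> * \<delta> - \<beta> * \<gamma> = 1" and E: "E = k * \<delta> - 4 * \<beta>"
    and s: "\<And>c. c \<in> corners \<Longrightarrow> \<gamma> * p c + \<delta> * v c = s"
    and S: "(\<Sum>c\<in>corners. \<alpha> * p c + \<beta> * v c) = k * s"
  shows "E * s = sum p corners"
    and "c \<in> corners \<Longrightarrow> \<delta> * E * (k * (v c - p c)) = k * (sum p corners - E * (\<gamma> + \<delta>) * p c)"
proof -
  let ?P = "sum p corners" and ?V = "sum v corners"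
  have "(\<Sum>c\<in>corners. \<gamma> * p c + \<delta> * v c) = 4 * s" using s by simp
  then have 1: "\<gamma> * ?P + \<delta> * ?V = 4 * s" by (simp add: sum.distrib sum_distrib_left)
  have 2: "\<alpha> * ?P + \<beta> * ?V = k * s" using S by (simp add: sum.distrib sum_distrib_left)
  have "E * s = (\<alpha> * \<delta> - \<beta> * \<gamma>) * ?P" unfolding E using 1 2 by algebra
  then show Es: "E * s = ?P" using det by simp
  show "\<delta> * E * (k * (v c - p c)) = k * (?P - E * (\<gamma> + \<delta>) * p c)" if "c \<in> corners"
  proof -
    have "k * (E * (\<gamma> * p c + \<delta> * v c) - E * (\<gamma> + \<delta>) * p c) = \<delta> * E * (k * (v c - p c))"
      by (simp add: algebra_simps)
    then have "\<delta> * E * (k * (v c - p c)) = k * (E * s - E * (\<gamma> + \<delta>) * p c)"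
      unfolding s[OF that] by (rule sym)
    then show ?thesis by (simp add: Es)
  qed
qed

lemma arm_cell_eq_0:
  assumes "c \<in> corners" "k \<in> corners" "i < n - 1" "arm_cell n c i = arm_cell n k 0"
  shows "i = 0 \<and> c = k"
  using assms by (auto simp: corners_def arm_cell_def)

lemma opp_neq: "c \<in> corners \<Longrightarrow> opp c \<noteq> c"
  by (auto simp: corners_def opp_def)

lemma diag_cells_arm:
  assumes "d \<in> diag_cells n"
  shows "d = (n - 1, n - 1) \<or> (\<exists>c\<in>corners. \<exists>i<n - 1. d = arm_cell n c i)"
proof -
  obtain k where k: "k < 2 * n - 1" and d: "d = (k, k) \<or> d = (k, 2 * n - 2 - k)"
    using assms by (auto simp: diag_cells_def)
  consider "k = n - 1" | "k < n - 1" | "k > n - 1" by linarith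
  then show ?thesis
  proof cases
    case 1
    then show ?thesis using d by auto
  next
    case 2
    then have "d = arm_cell n (0, 0) k \<or> d = arm_cell n (0, 1) k"
      using d by (auto simp: arm_cell_def)
    moreover have "(0, 0) \<in> corners" "(0, 1) \<in> corners" by (simp_all add: corners_def)
    ultimately show ?thesis using 2 by blast
  next
    case 3
    then have "d = arm_cell n (1, 1) (2 * n - 2 - k) \<or> d = arm_cell n (1, 0) (2 * n - 2 - k)"
      using d k by (auto simp: arm_cell_def)
    moreover have "2 * n - 2 - k < n - 1" using 3 k by linarith
    moreover have "(1, 1) \<in> corners" "(1, 0) \<in> corners" by (simp_all add: corners_def)
    ultimately show ?thesis by blast
  qed
qed

lemma words_snoc: "v \<in> words n (Suc m) \<longleftrightarrow> (\<exists>w\<in>words n m. \<exists>e\<in>diag_cells n. v = w @ [e])"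
proof
  assume "v \<in> words n (Suc m)"
  then show "\<exists>w\<in>words n m. \<exists>e\<in>diag_cells n. v = w @ [e]"
    by (cases v rule: rev_cases) (auto simp: words_def)
qed (auto simp: words_def)

lemma word_map_snoc: "word_map n (w @ [e]) p = word_map n w (vs_map n e p)"
  by (simp add: word_map_append)

lemma finite_words [simp]: "finite (words n m)"
  unfolding words_def by (rule finite_lists_length_eq) simp

lemma finite_ends [simp]: "finite (ends n m)"
  by (simp add: ends_def)

lemma word_maps_meet:
  assumes n: "n > 0" and w: "w \<in> words n m" and v: "v \<in> words n m"
    and "p \<in> unit_square" "q \<in> unit_square" "word_map n w p = word_map n v q"
  shows "w = v \<and> p = q \<or> p \<in> corners \<and> q \<in> corners"
proof (cases "w = v")
  case True
  then show ?thesis using word_map_inj[OF n] assms by auto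
next
  case False
  then show ?thesis using word_cells_meet_in_corners[of w v n p q] assms by (auto simp: words_def)
qed

section \<open>The vertex equations inside one cell of level \<open>m\<close>\<close>

context
  fixes n m :: nat and l :: real and u :: "real \<times> real \<Rightarrow> real"
  assumes n2: "n \<ge> 2" and eig: "is_eig n (Suc m) l u"
begin

private lemma n0: "n > 0" using n2 by simp

private lemma fiber: "(\<Sum>i | i \<in> ends n (Suc m) \<and> pt n i = x. residual n l u i) = 0"
  using eig unfolding is_eig_def by blast

text \<open>Since cells of level \<open>m\<close> meet only in corners, an end of level
  \<open>m + 1\<close> at a point of the cell \<open>w\<close> belongs to \<open>w\<close> unless
  the point is a corner of \<open>w\<close>.\<close>

private lemma fiberE:
  assumes w: "w \<in> words n m" and p: "p \<in> unit_square"
    and i: "i \<in> ends n (Suc m)" "pt n i = word_map n w p"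
  obtains v e q where "i = (v @ [e], q)" "v \<in> words n m" "e \<in> diag_cells n" "q \<in> corners"
    "v = w \<and> p = vs_map n e q \<or> p \<in> corners \<and> vs_map n e q \<in> corners"
proof -
  obtain v e q where vq: "i = (v @ [e], q)" "v \<in> words n m" "e \<in> diag_cells n" "q \<in> corners"
    using i(1) by (auto simp: ends_def words_snoc)
  have "vs_map n e q \<in> unit_square"
    using vs_map_unit_square[OF n0 vq(3)] vq(4) corners_subset by blast
  moreover have "word_map n w p = word_map n v (vs_map n e q)"
    using i(2) vq(1) by (simp add: pt_def word_map_snoc)
  ultimately have "w = v \<and> p = vs_map n e q \<or> p \<in> corners \<and> vs_map n e q \<in> corners"
    using word_maps_meet[OF n0 w vq(2) p] by auto
  then show thesis using that vq by blast
qed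

private lemma arm_sq:
  "c \<in> corners \<Longrightarrow> i \<le> n - 1 \<Longrightarrow> p \<in> corners \<Longrightarrow> vs_map n (arm_cell n c i) p \<in> unit_square"
  using vs_map_unit_square[OF n0 arm_cell_diag] n0 corners_subset by blast

private lemma arm_not_corner:
  assumes "c \<in> corners" "i < n - 1" "p \<in> corners" "p \<noteq> c"
  shows "vs_map n (arm_cell n c i) p \<notin> corners"
proof
  define x where "x = vs_map n (arm_cell n c i) p"
  assume "vs_map n (arm_cell n c i) p \<in> corners"
  then have "arm_cell n c i = arm_cell n x 0 \<and> p = x"
    using vs_map_corner_iff[OF n2 arm_cell_diag[OF less_imp_le_nat[OF assms(2)] n0] assms(3), of x]
    unfolding x_def by blast
  then have "arm_cell n c i = arm_cell n p 0" by simp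
  then show False using arm_cell_eq_0[OF assms(1,3,2)] assms(4) by auto
qed

text \<open>A corner off the arm lies in no other cell of level \<open>m + 1\<close>, so its vertex
  equation has a single term.\<close>

private lemma residual_side:
  assumes w: "w \<in> words n m" and c: "c \<in> corners" and i: "i < n - 1"
    and p: "p \<in> corners" "p \<noteq> c" "p \<noteq> opp c"
  shows "residual n l u (w @ [arm_cell n c i], p) = 0"
proof -
  let ?x = "word_map n w (vs_map n (arm_cell n c i) p)"
  have d: "arm_cell n c i \<in> diag_cells n" using i n0 by (intro arm_cell_diag) auto
  have "{j. j \<in> ends n (Suc m) \<and> pt n j = ?x} = {(w @ [arm_cell n c i], p)}"
  proof (intro equalityI subsetI)
    fix j assume "j \<in> {j. j \<in> ends n (Suc m) \<and> pt n j = ?x}"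
    then have j: "j \<in> ends n (Suc m)" "pt n j = ?x" by auto
    from fiberE[OF w arm_sq[OF c _ p(1), of i] j] i obtain v e q where
      vq: "j = (v @ [e], q)" "e \<in> diag_cells n" "q \<in> corners"
      "v = w" "vs_map n (arm_cell n c i) p = vs_map n e q"
      using arm_not_corner[OF c i p(1,2)] by (metis less_imp_le_nat)
    have "e = arm_cell n c i"
      using arm_cell_meet[OF c i p(1) vq(2,3,5)] p by blast
    moreover from this have "q = p" using vq(5) vs_map_inj[OF n0] by metis
    ultimately show "j \<in> {(w @ [arm_cell n c i], p)}" using vq by simp
  qed (use w d p in \<open>auto simp: ends_def words_snoc pt_def word_map_snoc\<close>)
  then show ?thesis using fiber[of ?x] by simp
qed

private lemma residual_junction:
  assumes w: "w \<in> words n m" and c: "c \<in> corners" and i: "i < n - 1"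
  shows "residual n l u (w @ [arm_cell n c i], opp c) +
    residual n l u (w @ [arm_cell n c (Suc i)], c) = 0"
proof -
  let ?x = "word_map n w (vs_map n (arm_cell n c i) (opp c))"
  have d: "arm_cell n c i \<in> diag_cells n" "arm_cell n c (Suc i) \<in> diag_cells n"
    using i n0 by (auto intro: arm_cell_diag)
  note oc = opp_corner[OF c] opp_neq[OF c]
  have "{j. j \<in> ends n (Suc m) \<and> pt n j = ?x} =
    {(w @ [arm_cell n c i], opp c), (w @ [arm_cell n c (Suc i)], c)}"
  proof (intro equalityI subsetI)
    fix j assume "j \<in> {j. j \<in> ends n (Suc m) \<and> pt n j = ?x}"
    then have j: "j \<in> ends n (Suc m)" "pt n j = ?x" by auto
    from fiberE[OF w arm_sq[OF c _ oc(1), of i] j] i obtain v e q where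
      vq: "j = (v @ [e], q)" "e \<in> diag_cells n" "q \<in> corners"
      "v = w" "vs_map n (arm_cell n c i) (opp c) = vs_map n e q"
      using arm_not_corner[OF c i oc] by (metis less_imp_le_nat)
    have "e = arm_cell n c i \<or> e = arm_cell n c (Suc i) \<and> q = c"
      using arm_cell_meet[OF c i oc(1) vq(2,3,5)] oc by blast
    moreover have "q = opp c" if "e = arm_cell n c i" using that vq(5) vs_map_inj[OF n0] by metis
    ultimately show "j \<in> {(w @ [arm_cell n c i], opp c), (w @ [arm_cell n c (Suc i)], c)}"
      using vq by auto
  qed (use w d c oc arm_junction[OF c i] in \<open>auto simp: ends_def words_snoc pt_def word_map_snoc\<close>)
  then show ?thesis using fiber[of ?x] oc by simp
qed

text \<open>On level \<open>m + 1\<close> a vertex of level \<open>m\<close> lies exactly in the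
  outermost arm cells of the \<open>m\<close>-cells around it. Its new vertex equation is therefore
  indexed by the old ends.\<close>

private lemma residual_corner:
  "(\<Sum>i | i \<in> ends n m \<and> pt n i = x. residual n l u (fst i @ [arm_cell n (snd i) 0], snd i)) = 0"
proof (cases "\<exists>w c. w \<in> words n m \<and> c \<in> corners \<and> x = word_map n w c")
  case False
  then have "{i. i \<in> ends n m \<and> pt n i = x} = {}" by (auto simp: ends_def pt_def)
  then show ?thesis by (simp only: sum.empty)
next
  case True
  then obtain w c where w: "w \<in> words n m" and c: "c \<in> corners" and x: "x = word_map n w c"
    by blast
  let ?f = "\<lambda>i. (fst i @ [arm_cell n (snd i) 0], snd i)"
  have inj: "inj_on ?f A" for A by (auto simp: inj_on_def prod_eq_iff)
  have "{i. i \<in> ends n (Suc m) \<and> pt n i = x} = ?f ` {i. i \<in> ends n m \<and> pt n i = x}"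
  proof (intro equalityI subsetI)
    fix j assume "j \<in> {j. j \<in> ends n (Suc m) \<and> pt n j = x}"
    then have j: "j \<in> ends n (Suc m)" "pt n j = word_map n w c" by (auto simp: x)
    from fiberE[OF w _ j] corners_subset c obtain v e q where
      vq: "j = (v @ [e], q)" "v \<in> words n m" "e \<in> diag_cells n" "q \<in> corners"
      "vs_map n e q \<in> corners" by (metis subsetD)
    have "e = arm_cell n q 0" "vs_map n e q = q"
      using vs_map_corner_iff[OF n2 vq(3,4,5)] vs_map_corner_iff[OF n2 vq(3,4,4)] by auto
    then show "j \<in> ?f ` {i. i \<in> ends n m \<and> pt n i = x}"
      using vq j x by (intro image_eqI[of _ _ "(v, q)"]) (auto simp: ends_def pt_def word_map_snoc)
  next
    fix j assume "j \<in> ?f ` {i. i \<in> ends n m \<and> pt n i = x}"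
    then show "j \<in> {i. i \<in> ends n (Suc m) \<and> pt n i = x}"
      using vs_map_arm_cell_0[OF n0] n0
      by (auto simp: ends_def pt_def word_map_snoc words_snoc intro!: arm_cell_diag)
  qed
  then show ?thesis using fiber[of x] by (simp add: sum.reindex[OF inj] comp_def)
qed

text \<open>The vertex equations are solved along each arm from the corner to the centre. The last
  conjunct serves to show that \<open>u\<close> cannot vanish on level \<open>m\<close> without
  vanishing on level \<open>m + 1\<close>.\<close>

private lemma cell_solution:
  assumes w: "w \<in> words n m" and l: "l \<noteq> 4 / 3"
  shows "\<exists>v s.
    (\<forall>c\<in>corners. chain l (n - 1) (u (word_map n w c)) (v c) =
        (u (word_map n w (vs_map n (n - 1, n - 1) c)), s)) \<and>
    (\<Sum>c\<in>corners. u (word_map n w (vs_map n (n - 1, n - 1) c))) = (4 - 3 * l) * s \<and>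
    (\<forall>c\<in>corners.
       residual n l u (w @ [arm_cell n c 0], c) = (4 - 3 * l) * (v c - u (word_map n w c))) \<and>
    ((\<forall>c\<in>corners. u (word_map n w c) = 0 \<and> v c = 0) \<longrightarrow>
       (\<forall>d\<in>diag_cells n. \<forall>p\<in>corners. u (word_map n w (vs_map n d p)) = 0))"
proof -
  define U where "U c i p = u (word_map n w (vs_map n (arm_cell n c i) p))" for c i p
  define a where "a c i = U c i c" for c i
  \<comment> \<open>One of the two corners off the arm; \<open>side\<close> shows that the other one
    carries the same value.\<close>
  define v where "v c i = U c i (1 - fst c, snd c)" for c i
  \<comment> \<open>Normalised so that the central cell has the residual (4 - 3l)(s - a), the same
    shape as for an arm cell; \<open>s\<close> can then act as the next \<open>v\<close> of the
    chain.\<close>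
  define s where "s = (\<Sum>c\<in>corners. a c (n - 1)) / (4 - 3 * l)"
  have l': "4 - 3 * l \<noteq> 0" using l by auto
  have a0: "a c 0 = u (word_map n w c)" if "c \<in> corners" for c
    using vs_map_arm_cell_0[OF n0 that] by (simp add: a_def U_def)
  have aS: "U c i (opp c) = a c (Suc i)" if "c \<in> corners" "i < n - 1" for c i
    using arm_junction[OF that] by (simp add: a_def U_def)
  have centre: "a c (n - 1) = u (word_map n w (vs_map n (n - 1, n - 1) c))" for c
    unfolding a_def U_def arm_cell_center[OF n0] ..
  have cs: "cell_sum n u (w @ [arm_cell n c i]) =
      U c i c + U c i (opp c) + U c i (1 - fst c, snd c) + U c i (fst c, 1 - snd c)"
    if "c \<in> corners" for c i
    using that unfolding cell_sum_def sum_corners word_map_snoc U_def[symmetric]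
    by (auto simp: corners_def opp_def)
  have res: "residual n l u (w @ [arm_cell n c i], p) =
      cell_sum n u (w @ [arm_cell n c i]) - (4 - 3 * l) * U c i p" for c i p
    by (simp add: residual_def pt_def word_map_snoc U_def)
  have side: "U c i (fst c, 1 - snd c) = v c i \<and> a c i + a c (Suc i) = (2 - 3 * l) * v c i"
    if c: "c \<in> corners" and i: "i < n - 1" for c i
  proof -
    have "(1 - fst c, snd c) \<in> corners" "(1 - fst c, snd c) \<noteq> c" "(1 - fst c, snd c) \<noteq> opp c"
      "(fst c, 1 - snd c) \<in> corners" "(fst c, 1 - snd c) \<noteq> c" "(fst c, 1 - snd c) \<noteq> opp c"
      using c by (auto simp: corners_def opp_def)
    then have e: "a c i + a c (Suc i) + v c i + U c i (fst c, 1 - snd c) = (4 - 3 * l) * v c i"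
      "a c i + a c (Suc i) + v c i + U c i (fst c, 1 - snd c) = (4 - 3 * l) * U c i (fst c, 1 - snd c)"
      using residual_side[OF w c i, of "(1 - fst c, snd c)"]
        residual_side[OF w c i, of "(fst c, 1 - snd c)"] cs[OF c] aS[OF c i]
      unfolding res by (simp_all add: a_def v_def)
    \<comment> \<open>The two off-arm equations have the same cell sum, so their difference isolates
      the two values.\<close>
    then have "(4 - 3 * l) * (v c i - U c i (fst c, 1 - snd c)) = 0" by (simp add: algebra_simps)
    then have "U c i (fst c, 1 - snd c) = v c i" using l' by simp
    with e show ?thesis by (simp add: algebra_simps)
  qed
  have cs': "cell_sum n u (w @ [arm_cell n c i]) = (4 - 3 * l) * v c i"
    if "c \<in> corners" "i < n - 1" for c i
    using side[OF that] cs[OF that(1)] aS[OF that] by (simp add: a_def v_def algebra_simps)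
  have res_in: "residual n l u (w @ [arm_cell n c i], c) = (4 - 3 * l) * (v c i - a c i)"
    and res_out: "residual n l u (w @ [arm_cell n c i], opp c) = (4 - 3 * l) * (v c i - a c (Suc i))"
    if "c \<in> corners" "i < n - 1" for c i
    using cs'[OF that] aS[OF that] by (simp_all add: res a_def algebra_simps)
  have vS: "v c (Suc i) = 2 * a c (Suc i) - v c i" if c: "c \<in> corners" and i: "Suc i < n - 1" for c i
  proof -
    have "(4 - 3 * l) * (v c i - a c (Suc i) + (v c (Suc i) - a c (Suc i))) = 0"
      using residual_junction[OF w c, of i] res_out[OF c, of i] res_in[OF c i] i
      by (simp add: algebra_simps)
    then show ?thesis using l' by simp
  qed
  \<comment> \<open>The recursion \<open>vS\<close> for the junction with the central cell.\<close>
  have last: "2 * a c (Suc i) - v c i = s" if c: "c \<in> corners" and i: "Suc i = n - 1" for c i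
  proof -
    have "cell_sum n u (w @ [arm_cell n c (n - 1)]) = (\<Sum>c\<in>corners. a c (n - 1))"
      unfolding cell_sum_def word_map_snoc arm_cell_center[OF n0] centre ..
    then have "residual n l u (w @ [arm_cell n c (n - 1)], c) = (4 - 3 * l) * (s - a c (n - 1))"
      using l' by (simp add: res s_def right_diff_distrib flip: a_def)
    then have "(4 - 3 * l) * (v c i - a c (Suc i) + (s - a c (Suc i))) = 0"
      using residual_junction[OF w c, of i] res_out[OF c, of i] i by (simp add: algebra_simps)
    then show ?thesis using l' by simp
  qed
  have chain_i: "chain l i (a c 0) (v c 0) = (a c i, v c i)" if c: "c \<in> corners" and "i < n - 1" for c i
    using that(2)
  proof (induction i)
    case (Suc i)
    then show ?case using side[OF c, of i] vS[OF c, of i] by (simp add: algebra_simps)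
  qed simp
  have chain_last: "chain l (n - 1) (a c 0) (v c 0) = (a c (n - 1), s)" if c: "c \<in> corners" for c
  proof -
    have n1: "n - 1 = Suc (n - 2)" using n2 by simp
    show ?thesis unfolding n1
      using side[OF c, of "n - 2"] last[OF c, of "n - 2"] chain_i[OF c, of "n - 2"] n1
      by (simp add: algebra_simps)
  qed
  show ?thesis
  proof (intro exI[of _ "\<lambda>c. v c 0"] exI[of _ s] conjI, goal_cases)
    case 1
    show ?case
    proof
      fix c assume c: "c \<in> corners"
      show "chain l (n - 1) (u (word_map n w c)) (v c 0) =
          (u (word_map n w (vs_map n (n - 1, n - 1) c)), s)"
        using chain_last[OF c] unfolding a0[OF c] centre .
    qed
  next
    case 2
    show ?case unfolding centre[symmetric] s_def using l' by simp
  next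
    case 3
    show ?case using res_in[of _ 0] a0 n2 by simp
  next
    case 4
    have chain0: "chain l i 0 0 = (0, 0)" for i
      using chain_linear[of l i 0 0] by (simp add: prod_eq_iff)
    show ?case
    proof (intro impI ballI)
      fix d p
      assume 40: "\<forall>c\<in>corners. u (word_map n w c) = 0 \<and> v c 0 = 0"
        and d: "d \<in> diag_cells n" and p: "p \<in> corners"
      have z: "a c 0 = 0" "v c 0 = 0" if "c \<in> corners" for c using 40 a0 that by auto
      have zc: "a c (n - 1) = 0" if "c \<in> corners" for c
        using chain_last[OF that] z[OF that] chain0 by simp
      have zi: "a c i = 0" "v c i = 0" if "c \<in> corners" "i < n - 1" for c i
        using chain_i[OF that] z[OF that(1)] chain0 by simp_all
      have za: "a c (Suc i) = 0" if "c \<in> corners" "i < n - 1" for c i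
        using side[OF that] zi[OF that] by simp
      from diag_cells_arm[OF d] show "u (word_map n w (vs_map n d p)) = 0"
      proof
        assume "d = (n - 1, n - 1)"
        then show ?thesis using zc[OF p] unfolding centre by simp
      next
        assume "\<exists>c\<in>corners. \<exists>i<n - 1. d = arm_cell n c i"
        then obtain c i where c: "c \<in> corners" "i < n - 1" and d: "d = arm_cell n c i" by blast
        have "p = c \<or> p = opp c \<or> p = (1 - fst c, snd c) \<or> p = (fst c, 1 - snd c)"
          using c(1) p by (auto simp: corners_def opp_def)
        then have "U c i p = 0"
          using zi[OF c] za[OF c] aS[OF c] side[OF c] by (auto simp: a_def v_def)
        then show ?thesis by (simp add: U_def d)
      qed
    qed
  qed
qed

text \<open>Up to one nonzero factor, the residual of an outermost arm cell for \<open>l\<close> is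
  the residual of the whole \<open>m\<close>-cell for R(l), so the equations carry over through
  \<open>residual_corner\<close>. The corner values determine \<open>s\<close> because the neck is
  nonzero, and \<open>s\<close> determines \<open>v\<close> because delta is nonzero; hence
  \<open>u\<close> survives the restriction to level \<open>m\<close>.\<close>

lemma decimation:
  assumes l: "l \<noteq> 4 / 3" and \<delta>: "snd (chain l (n - 1) 0 1) \<noteq> 0" and E: "neck n l \<noteq> 0"
  shows "is_eig n m (decimation_map n l) u"
proof -
  define \<alpha> \<beta> \<gamma> \<delta> where co: "\<alpha> = fst (chain l (n - 1) 1 0)" "\<beta> = fst (chain l (n - 1) 0 1)"
    "\<gamma> = snd (chain l (n - 1) 1 0)" "\<delta> = snd (chain l (n - 1) 0 1)"
  have det: "\<alpha> * \<delta> - \<beta> * \<gamma> = 1" using chain_det[of l "n - 1"] by (simp add: co)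
  have E': "neck n l = (4 - 3 * l) * \<delta> - 4 * \<beta>" by (simp add: neck_def co)
  have R: "4 - 3 * decimation_map n l = neck n l * (\<gamma> + \<delta>)"
  proof -
    have "4 - 3 * ((4 - x) / 3) = x" for x :: real by (simp add: field_simps)
    then show ?thesis unfolding decimation_map_def co .
  qed
  have div_solve: "x = k / d * y" if "d \<noteq> 0" "d * x = k * y" for d x k y :: real
    using that by (simp add: field_simps)
  have \<delta>0: "\<delta> \<noteq> 0" using \<delta> by (simp add: co)
  have l': "4 - 3 * l \<noteq> 0" using l by auto
  have cell: "(\<forall>c\<in>corners. residual n l u (w @ [arm_cell n c 0], c) =
        (4 - 3 * l) / (\<delta> * neck n l) * residual n (decimation_map n l) u (w, c)) \<and>
      ((\<forall>c\<in>corners. u (word_map n w c) = 0) \<longrightarrow>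
        (\<forall>d\<in>diag_cells n. \<forall>p\<in>corners. u (word_map n w (vs_map n d p)) = 0))"
    if w: "w \<in> words n m" for w
  proof -
    obtain v s where
      ch: "\<forall>c\<in>corners. chain l (n - 1) (u (word_map n w c)) (v c) =
        (u (word_map n w (vs_map n (n - 1, n - 1) c)), s)"
      and S: "(\<Sum>c\<in>corners. u (word_map n w (vs_map n (n - 1, n - 1) c))) = (4 - 3 * l) * s"
      and res: "\<forall>c\<in>corners.
       residual n l u (w @ [arm_cell n c 0], c) = (4 - 3 * l) * (v c - u (word_map n w c))"
      and zero: "(\<forall>c\<in>corners. u (word_map n w c) = 0 \<and> v c = 0) \<longrightarrow>
       (\<forall>d\<in>diag_cells n. \<forall>p\<in>corners. u (word_map n w (vs_map n d p)) = 0)"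
      using cell_solution[OF w l] by (elim exE conjE) (rule that)
    have lin: "u (word_map n w (vs_map n (n - 1, n - 1) c)) = \<alpha> * u (word_map n w c) + \<beta> * v c"
      "\<gamma> * u (word_map n w c) + \<delta> * v c = s" if "c \<in> corners" for c
      using bspec[OF ch that] chain_linear[of l "n - 1" "u (word_map n w c)" "v c"] by (simp_all add: co)
    have S': "(\<Sum>c\<in>corners. \<alpha> * u (word_map n w c) + \<beta> * v c) = (4 - 3 * l) * s"
      using S lin(1) by simp
    have alg1: "neck n l * s = (\<Sum>c\<in>corners. u (word_map n w c))"
      by (rule decimation_algebra(1)[OF det E' _ S']) (rule lin(2))
    have alg2: "\<delta> * neck n l * ((4 - 3 * l) * (v c - u (word_map n w c))) =
        (4 - 3 * l) * ((\<Sum>c\<in>corners. u (word_map n w c)) - neck n l * (\<gamma> + \<delta>) * u (word_map n w c))"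
      if "c \<in> corners" for c
      by (rule decimation_algebra(2)[OF det E' _ S' that]) (rule lin(2))
    have "residual n l u (w @ [arm_cell n c 0], c) =
        (4 - 3 * l) / (\<delta> * neck n l) * residual n (decimation_map n l) u (w, c)" if "c \<in> corners" for c
    proof -
      have "\<delta> * neck n l * residual n l u (w @ [arm_cell n c 0], c) =
          (4 - 3 * l) * residual n (decimation_map n l) u (w, c)"
        using alg2[OF that] unfolding bspec[OF res that]
        by (simp only: residual_def cell_sum_def pt_def R fst_conv snd_conv)
      then show ?thesis by (rule div_solve[rotated]) (use \<delta>0 E in simp)
    qed
    moreover have "\<forall>d\<in>diag_cells n. \<forall>p\<in>corners. u (word_map n w (vs_map n d p)) = 0"
      if z: "\<forall>c\<in>corners. u (word_map n w c) = 0"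
    proof (rule zero[THEN mp], intro ballI)
      fix c assume c: "c \<in> corners"
      have "neck n l * s = 0" using alg1 z c by simp
      then have "s = 0" using E by simp
      then show "u (word_map n w c) = 0 \<and> v c = 0" using lin(2)[OF c] z c \<delta>0 by simp
    qed
    ultimately show ?thesis by blast
  qed
  show ?thesis unfolding is_eig_def
  proof (intro conjI allI)
    fix x
    have "(4 - 3 * l) / (\<delta> * neck n l) *
        (\<Sum>i | i \<in> ends n m \<and> pt n i = x. residual n (decimation_map n l) u i) =
      (\<Sum>i | i \<in> ends n m \<and> pt n i = x. residual n l u (fst i @ [arm_cell n (snd i) 0], snd i))"
      unfolding sum_distrib_left using cell by (intro sum.cong) (auto simp: ends_def)
    then show "(\<Sum>i | i \<in> ends n m \<and> pt n i = x. residual n (decimation_map n l) u i) = 0"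
      using residual_corner[of x] \<delta>0 E l' by simp
  next
    show "\<exists>i\<in>ends n m. u (pt n i) \<noteq> 0"
    proof (rule ccontr)
      assume "\<not> (\<exists>i\<in>ends n m. u (pt n i) \<noteq> 0)"
      then have "u (word_map n w c) = 0" if "w \<in> words n m" "c \<in> corners" for w c
        using that by (auto simp: ends_def pt_def)
      then have "u (pt n j) = 0" if "j \<in> ends n (Suc m)" for j
        using cell that by (auto simp: ends_def pt_def words_snoc word_map_snoc)
      then show False using eig by (auto simp: is_eig_def)
    qed
  qed
qed

text \<open>The exceptional parameters hit the seeds: if delta = 0, the determinant gives beta *
  gamma = -1, so neck * gamma = 4 and R = 0; if the neck is 0, then R = 4/3.\<close>

lemma decimation_cases:
  "l = 4 / 3 \<or> decimation_map n l \<in> {0, 4 / 3} \<or> is_eig n m (decimation_map n l) u"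
proof -
  have "decimation_map n l = 0" if "snd (chain l (n - 1) 0 1) = 0"
    using chain_det[of l "n - 1"] that by (simp add: decimation_map_def neck_def)
  moreover have "decimation_map n l = 4 / 3" if "neck n l = 0"
    using that by (simp add: decimation_map_def)
  ultimately show ?thesis using decimation by auto
qed

end

text \<open>The backward orbit of {0, 4/3}. These two seeds are the eigenvalues on level 0 and also
  the values of R at the exceptional parameters of the elimination.\<close>

inductive_set decimation_tree :: "(real \<Rightarrow> real) \<Rightarrow> real set" for R where
  zero: "0 \<in> decimation_tree R"
| top: "4 / 3 \<in> decimation_tree R"
| step: "R x \<in> decimation_tree R \<Longrightarrow> x \<in> decimation_tree R"

text \<open>On the complete graph the four equations add up to l * sum u = 0; a zero sum forces 4 -
  3l = 0 at a corner where \<open>u\<close> is nonzero.\<close>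

lemma is_eig_0:
  assumes "is_eig n 0 l u"
  shows "l = 0 \<or> l = 4 / 3"
proof -
  have w0: "words n 0 = {[]}" by (auto simp: words_def)
  have *: "sum u corners = (4 - 3 * l) * u c" if "c \<in> corners" for c
  proof -
    have "{i. i \<in> ends n 0 \<and> pt n i = c} = {([], c)}"
      using that by (auto simp: ends_def w0 pt_def)
    moreover have "(\<Sum>i | i \<in> ends n 0 \<and> pt n i = c. residual n l u i) = 0"
      using assms unfolding is_eig_def by blast
    ultimately have "residual n l u ([], c) = 0" by simp
    then show ?thesis by (simp add: residual_def cell_sum_def pt_def)
  qed
  then have "(\<Sum>c\<in>corners. sum u corners) = (\<Sum>c\<in>corners. (4 - 3 * l) * u c)"
    by (intro sum.cong) auto
  then have "4 * sum u corners = (4 - 3 * l) * sum u corners"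
    by (simp add: sum_distrib_left)
  then have s: "3 * l * sum u corners = 0" by (simp add: left_diff_distrib)
  obtain c where "c \<in> corners" "u c \<noteq> 0"
    using assms by (auto simp: is_eig_def ends_def w0 pt_def)
  with *[of c] s show ?thesis by auto
qed

lemma is_eig_in_tree:
  assumes "n \<ge> 2" "is_eig n m l u"
  shows "l \<in> decimation_tree (decimation_map n)"
  using assms(2)
proof (induction m arbitrary: l)
  case 0
  then show ?case using is_eig_0 decimation_tree.zero decimation_tree.top by blast
next
  case (Suc m)
  then show ?case
    using decimation_cases[OF assms(1) Suc.prems] Suc.IH
      decimation_tree.intros[where R = "decimation_map n"] by (metis insertE singletonD)
qed

section \<open>Eigenvalues near approximate eigenvectors\<close>

lemma linear_term_zero:
  fixes b c :: real
  assumes "\<And>t. 0 \<le> t * b + t\<^sup>2 * c"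
  shows "b = 0"
proof (rule ccontr)
  assume b: "b \<noteq> 0"
  \<comment> \<open>With this choice the quadratic expression is at most
    \<open>- b\<^sup>2 / (\<bar>c\<bar> + 1)\<^sup>2\<close>.\<close>
  define t where "t = - b / (\<bar>c\<bar> + 1)"
  have "t * b + t\<^sup>2 * c \<le> t * b + t\<^sup>2 * \<bar>c\<bar>" by (simp add: mult_left_mono)
  also have "\<dots> = - b\<^sup>2 / (\<bar>c\<bar> + 1) + b\<^sup>2 * \<bar>c\<bar> / (\<bar>c\<bar> + 1)\<^sup>2"
    by (simp add: t_def power2_eq_square)
  also have "\<dots> = - b\<^sup>2 / (\<bar>c\<bar> + 1)\<^sup>2"
  proof -
    have "- x / d + x * (d - 1) / d\<^sup>2 = - x / d\<^sup>2" if "d > 0" for x d :: real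
      using that by (simp add: field_simps power2_eq_square)
    from this[of "\<bar>c\<bar> + 1" "b\<^sup>2"] show ?thesis by simp
  qed
  also have "\<dots> < 0" using b by (simp add: divide_neg_pos)
  finally show False using assms[of t] by simp
qed

text \<open>Tychonoff's theorem. Pinning the values outside \<open>V\<close> to 0 makes the full
  function space play the role of the finite-dimensional space of functions on
  \<open>V\<close>.\<close>

lemma compact_supported_box:
  fixes V :: "'a set" and r :: "'a \<Rightarrow> real"
  shows "compact {f. (\<forall>x\<in>V. \<bar>f x\<bar> \<le> r x) \<and> (\<forall>x. x \<notin> V \<longrightarrow> f x = 0)}"
proof -
  have "compactin (product_topology (\<lambda>i. euclidean) UNIV)
      (PiE UNIV (\<lambda>x. if x \<in> V then {- r x..r x} else {0}))"
    unfolding compactin_PiE by (auto simp: compactin_euclidean_iff)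
  moreover have "PiE UNIV (\<lambda>x. if x \<in> V then {- r x..r x} else {0}) =
      {f. (\<forall>x\<in>V. \<bar>f x\<bar> \<le> r x) \<and> (\<forall>x. x \<notin> V \<longrightarrow> f x = 0)}"
    unfolding PiE_UNIV_domain by (fastforce simp: abs_le_iff split: if_splits)
  ultimately show ?thesis by (simp add: euclidean_product_topology compactin_euclidean_iff)
qed

text \<open>
  A minimiser \<open>f\<close> of \<open>\<parallel>(A - \<mu>) f\<parallel>\<close> on the unit sphere satisfies \<open>(A - \<mu>)\<^sup>2 f = \<eta>\<^sup>2 f\<close> with \<open>\<eta>\<close> the
  minimum, so that \<open>f\<close> or \<open>(A - \<mu>) f + \<eta> f\<close> is an eigenvector.
\<close>

lemma eigenvalue_near_quasimode:
  fixes A :: "('a \<Rightarrow> real) \<Rightarrow> 'a \<Rightarrow> real" and N :: "'a \<Rightarrow> real"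
  assumes V: "finite V" and N: "\<And>x. x \<in> V \<Longrightarrow> N x > 0"
    and cont: "\<And>x. continuous_on UNIV (\<lambda>f. A f x)"
    and lin: "\<And>f g t x. A (\<lambda>y. f y + t * g y) x = A f x + t * A g x"
    and loc: "\<And>f g x. (\<And>y. y \<in> V \<Longrightarrow> f y = g y) \<Longrightarrow> x \<in> V \<Longrightarrow> A f x = A g x"
    and sym: "\<And>f g. (\<Sum>x\<in>V. N x * A f x * g x) = (\<Sum>x\<in>V. N x * f x * A g x)"
    and u: "\<exists>x\<in>V. u x \<noteq> 0" and \<epsilon>: "\<epsilon> \<ge> 0"
    and quasi: "(\<Sum>x\<in>V. N x * (A u x - \<mu> * u x)\<^sup>2) \<le> \<epsilon>\<^sup>2 * (\<Sum>x\<in>V. N x * (u x)\<^sup>2)"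
  shows "\<exists>l f. \<bar>l - \<mu>\<bar> \<le> \<epsilon> \<and> (\<exists>x\<in>V. f x \<noteq> 0) \<and> (\<forall>x\<in>V. A f x = l * f x)"
proof -
  define B where "B f x = A f x - \<mu> * f x" for f x
  define ip where "ip f g = (\<Sum>x\<in>V. N x * f x * g x)" for f g :: "'a \<Rightarrow> real"
  have ip_pos: "ip f f > 0" if "\<exists>x\<in>V. f x \<noteq> 0" for f
  proof -
    obtain y where y: "y \<in> V" "f y \<noteq> 0" using \<open>\<exists>x\<in>V. f x \<noteq> 0\<close> by blast
    show ?thesis unfolding ip_def
      using y N[OF y(1)] by (intro sum_pos2[OF V y(1)])
        (auto simp: mult.assoc less_imp_le[OF N] zero_less_mult_iff)
  qed
  have ip_nonneg: "ip f f \<ge> 0" for f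
    unfolding ip_def by (intro sum_nonneg) (simp add: mult.assoc less_imp_le[OF N])
  have ip_comm: "ip f g = ip g f" for f g by (simp add: ip_def mult_ac)
  have ip_cong: "ip f g = ip f' g'" if "\<And>x. x \<in> V \<Longrightarrow> f x = f' x" "\<And>x. x \<in> V \<Longrightarrow> g x = g' x"
    for f g f' g' unfolding ip_def using that by (intro sum.cong) auto
  have ip_lin: "ip (\<lambda>x. f x + t * g x) (\<lambda>x. f' x + t * g' x) =
      ip f f' + t * (ip f g' + ip g f') + t\<^sup>2 * ip g g'" for f g f' g' t
    unfolding ip_def sum_distrib_left sum.distrib[symmetric]
    by (intro sum.cong) (auto simp: algebra_simps power2_eq_square)
  have B_lin: "B (\<lambda>y. f y + t * g y) x = B f x + t * B g x" for f g t x
    by (simp add: B_def lin algebra_simps)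
  have B_loc: "B f x = B g x" if "\<And>y. y \<in> V \<Longrightarrow> f y = g y" "x \<in> V" for f g x
    using loc[OF that] that by (simp add: B_def)
  have B_sym: "ip (B f) g = ip f (B g)" for f g
    using sym[of f g] unfolding ip_def B_def
    by (simp add: algebra_simps sum_subtractf)
  \<comment> \<open>The unit sphere. The norm condition already implies the bounds on
    \<open>V\<close>; the box is there to give compactness.\<close>
  define K where "K = {f. (\<forall>x\<in>V. \<bar>f x\<bar> \<le> 1 / sqrt (N x)) \<and> (\<forall>x. x \<notin> V \<longrightarrow> f x = 0)} \<inter> {f. ip f f = 1}"
  have cont_ip: "continuous_on UNIV (\<lambda>f. ip (B f) (B f))" "continuous_on UNIV (\<lambda>f. ip f f)"
    unfolding ip_def B_def by (intro continuous_intros cont continuous_on_product_coordinates)+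
  have "closed {f. ip f f = 1}"
    using cont_ip(2) by (intro closed_Collect_eq) (auto intro: continuous_intros)
  then have "compact K"
    unfolding K_def by (intro compact_Int_closed compact_supported_box)
  have K_ex: "\<exists>g\<in>K. \<forall>x\<in>V. g x = f x / sqrt (ip f f)" if "\<exists>x\<in>V. f x \<noteq> 0" for f
  proof
    let ?g = "\<lambda>x. if x \<in> V then f x / sqrt (ip f f) else 0"
    have p: "ip f f > 0" using ip_pos that by blast
    have "ip ?g ?g = (\<Sum>x\<in>V. N x * f x * f x / ip f f)"
      unfolding ip_def[of ?g] using p by (intro sum.cong) auto
    also have "\<dots> = 1" using p by (simp add: ip_def flip: sum_divide_distrib)
    finally have 1: "ip ?g ?g = 1" .
    have "\<bar>f x / sqrt (ip f f)\<bar> \<le> 1 / sqrt (N x)" if x: "x \<in> V" for x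
    proof -
      have "N x * f x * f x \<le> ip f f"
        unfolding ip_def by (rule member_le_sum[OF x _ V]) (simp add: mult.assoc less_imp_le[OF N])
      then have "sqrt (N x * (f x)\<^sup>2) \<le> sqrt (ip f f)"
        by (simp add: power2_eq_square mult.assoc)
      then have "sqrt (N x) * \<bar>f x\<bar> \<le> sqrt (ip f f)" by (simp add: real_sqrt_mult)
      then show ?thesis using N[OF x] p by (simp add: field_simps)
    qed
    with 1 show "?g \<in> K" by (simp add: K_def)
  qed simp
  have "K \<noteq> {}" using K_ex[OF u] by blast
  then obtain f where f: "f \<in> K" and f_min: "\<And>g. g \<in> K \<Longrightarrow> ip (B f) (B f) \<le> ip (B g) (B g)"
    using continuous_attains_inf[OF \<open>compact K\<close> _ continuous_on_subset[OF cont_ip(1)]] by blast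
  define m where "m = ip (B f) (B f)"
  have ff: "ip f f = 1" using f by (simp add: K_def)
  \<comment> \<open>Homogeneity extends minimality from the sphere to all functions.\<close>
  have min: "m * ip g g \<le> ip (B g) (B g)" for g
  proof (cases "\<exists>x\<in>V. g x \<noteq> 0")
    case True
    then have p: "ip g g > 0" using ip_pos by blast
    obtain h where h: "h \<in> K" "\<And>x. x \<in> V \<Longrightarrow> h x = 0 + 1 / sqrt (ip g g) * g x"
      using K_ex[OF True] by auto
    have "ip (B h) (B h) = ip (\<lambda>x. B (\<lambda>x. 0) x + 1 / sqrt (ip g g) * B g x)
        (\<lambda>x. B (\<lambda>x. 0) x + 1 / sqrt (ip g g) * B g x)"
      by (intro ip_cong) (simp_all only: B_loc[OF h(2)] B_lin)
    also have "\<dots> = (1 / sqrt (ip g g))\<^sup>2 * ip (B g) (B g)"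
    proof -
      have "B (\<lambda>x. 0) x = 0" for x using lin[of "\<lambda>x. 0" 1 "\<lambda>x. 0" x] by (simp add: B_def)
      then show ?thesis unfolding ip_lin by (simp add: ip_def)
    qed
    also have "\<dots> = ip (B g) (B g) / ip g g" using p by (simp add: power_divide)
    finally have "ip (B h) (B h) = ip (B g) (B g) / ip g g" .
    then have "m \<le> ip (B g) (B g) / ip g g" using f_min[OF h(1)] by (simp add: m_def)
    then show ?thesis using p by (simp add: pos_le_divide_eq)
  next
    case False
    then have "ip g g = 0" by (simp add: ip_def)
    then show ?thesis using ip_nonneg by simp
  qed
  have m0: "m \<ge> 0" unfolding m_def by (rule ip_nonneg)
  define \<eta> where "\<eta> = sqrt m"
  have \<eta>: "\<eta>\<^sup>2 = m" "\<eta> \<ge> 0" using m0 by (simp_all add: \<eta>_def)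
  have "m * ip u u \<le> \<epsilon>\<^sup>2 * ip u u"
    using min[of u] quasi by (simp add: ip_def B_def power2_eq_square mult.assoc)
  then have "\<eta> \<le> \<epsilon>"
    using ip_pos[OF u] \<epsilon> by (simp add: \<eta>_def real_le_lsqrt)
  \<comment> \<open>First variation of the minimum in the direction \<open>g\<close>.\<close>
  have var: "ip (B f) (B g) = m * ip f g" for g
  proof -
    have "0 \<le> t * (2 * (ip (B f) (B g) - m * ip f g)) + t\<^sup>2 * (ip (B g) (B g) - m * ip g g)" for t
    proof -
      have "ip (B (\<lambda>x. f x + t * g x)) (B (\<lambda>x. f x + t * g x)) =
          m + t * (2 * ip (B f) (B g)) + t\<^sup>2 * ip (B g) (B g)"
        unfolding B_lin ip_lin by (simp add: m_def ip_comm)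
      moreover have "ip (\<lambda>x. f x + t * g x) (\<lambda>x. f x + t * g x) = 1 + t * (2 * ip f g) + t\<^sup>2 * ip g g"
        unfolding ip_lin by (simp add: ff ip_comm)
      ultimately show ?thesis using min[of "\<lambda>x. f x + t * g x"] by (simp add: algebra_simps)
    qed
    from linear_term_zero[OF this] show ?thesis by simp
  qed
  have BB: "B (B f) x = m * f x" if x: "x \<in> V" for x
  proof -
    \<comment> \<open>Testing the variational identity with the defect itself shows that the defect
      has norm 0 on \<open>V\<close>.\<close>
    let ?g = "\<lambda>x. B (B f) x + (- m) * f x"
    have "ip (B (B f)) ?g = m * ip f ?g" using var[of ?g] B_sym by simp
    then have "ip ?g ?g = 0"
      unfolding ip_def by (simp add: algebra_simps sum.distrib sum_subtractf sum_distrib_left)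
    then have "\<not> (\<exists>x\<in>V. ?g x \<noteq> 0)" using ip_pos[of ?g] by auto
    then show ?thesis using x by auto
  qed
  show ?thesis
  proof (cases "\<exists>x\<in>V. B f x + \<eta> * f x \<noteq> 0")
    case True
    let ?g = "\<lambda>x. B f x + \<eta> * f x"
    have "A ?g x = (\<mu> + \<eta>) * ?g x" if x: "x \<in> V" for x
    proof -
      have "B ?g x = m * f x + \<eta> * B f x" unfolding B_lin BB[OF x] ..
      also have "\<dots> = \<eta> * ?g x" by (simp add: algebra_simps power2_eq_square flip: \<eta>(1))
      finally show ?thesis by (simp add: B_def algebra_simps)
    qed
    with True \<open>\<eta> \<le> \<epsilon>\<close> \<eta>(2) show ?thesis by (intro exI[of _ "\<mu> + \<eta>"] exI[of _ ?g]) auto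
  next
    case False
    have "A f x = (\<mu> - \<eta>) * f x" if "x \<in> V" for x
      using False that by (auto simp: B_def algebra_simps)
    moreover have "\<exists>x\<in>V. f x \<noteq> 0"
    proof (rule ccontr)
      assume "\<not> ?thesis"
      then show False using ff by (simp add: ip_def)
    qed
    ultimately show ?thesis using \<open>\<eta> \<le> \<epsilon>\<close> \<eta>(2)
      by (intro exI[of _ "\<mu> - \<eta>"] exI[of _ f]) auto
  qed
qed

section \<open>The Vicsek set\<close>

definition cells_image :: "nat \<Rightarrow> (real \<times> real) set \<Rightarrow> (real \<times> real) set" where
  "cells_image n S = (\<Union>d\<in>diag_cells n. vs_map n d ` S)"

lemma cells_image_mono: "S \<subseteq> T \<Longrightarrow> cells_image n S \<subseteq> cells_image n T"
  by (auto simp: cells_image_def)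

lemma compact_cells_image: "compact S \<Longrightarrow> compact (cells_image n S)"
  unfolding cells_image_def vs_map_def
  by (intro compact_UN compact_continuous_image continuous_intros finite_diag_cells) auto

lemma dist_vs_map: "n > 0 \<Longrightarrow> dist (vs_map n d p) (vs_map n d q) = dist p q / (2 * real n - 1)"
proof -
  assume n: "n > 0"
  have "dist (vs_map n d p) (vs_map n d q) = norm ((1 / (2 * real n - 1)) *\<^sub>R (p - q))"
    unfolding dist_norm vs_map_def by (simp add: algebra_simps)
  also have "\<dots> = dist p q / (2 * real n - 1)" using n by (simp add: dist_norm)
  finally show ?thesis .
qed

text \<open>The maps contract by 1/(2n-1), so every point of \<open>K\<close> is within B/(2n-1)^m
  of \<open>L\<close> for all m. The one-sided inclusions let two fixed sets be compared in both
  directions, which gives uniqueness.\<close>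

lemma cells_fixed_subset:
  assumes n: "n \<ge> 2" and K: "bounded K" "K \<subseteq> cells_image n K"
    and L: "compact L" "L \<noteq> {}" "cells_image n L \<subseteq> L"
  shows "K \<subseteq> L"
proof
  fix x assume x: "x \<in> K"
  have "bounded (K \<union> L)" using K(1) L(1) compact_imp_bounded by auto
  then obtain B where B: "\<And>x y. x \<in> K \<union> L \<Longrightarrow> y \<in> K \<union> L \<Longrightarrow> dist x y \<le> B"
    using bounded_two_points by metis
  have step: "\<exists>y\<in>L. dist x y \<le> B / (2 * real n - 1) ^ m" if "x \<in> K" for m x
    using that
  proof (induction m arbitrary: x)
    case 0
    then show ?case using B L(2) by auto
  next
    case (Suc m)
    then obtain d z where d: "d \<in> diag_cells n" "z \<in> K" "x = vs_map n d z"
      using K(2) by (auto simp: cells_image_def)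
    obtain y where y: "y \<in> L" "dist z y \<le> B / (2 * real n - 1) ^ m" using Suc.IH[OF d(2)] by blast
    have "vs_map n d y \<in> L" using L(3) d(1) y(1) by (auto simp: cells_image_def)
    moreover have "dist x (vs_map n d y) \<le> B / (2 * real n - 1) ^ Suc m"
    proof -
      have "dist x (vs_map n d y) = dist z y / (2 * real n - 1)" using n by (simp add: d(3) dist_vs_map)
      also have "\<dots> \<le> B / (2 * real n - 1) ^ m / (2 * real n - 1)"
        using y(2) n by (intro divide_right_mono) auto
      finally show ?thesis by (simp add: mult.commute)
    qed
    ultimately show ?case by blast
  qed
  have "infdist x L \<le> B / (2 * real n - 1) ^ m" for m
    using step[OF x, of m] infdist_le2 by blast
  moreover have "(\<lambda>m. B / (2 * real n - 1) ^ m) \<longlonglongrightarrow> 0"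
    using n by (intro LIMSEQ_divide_realpow_zero) simp
  ultimately have "infdist x L \<le> 0"
    by (intro LIMSEQ_le_const) auto
  then have "infdist x L = 0" using infdist_nonneg[of x L] by simp
  then show "x \<in> L" using in_closed_iff_infdist_zero[OF compact_imp_closed[OF L(1)] L(2)] by simp
qed

text \<open>The definite description needs existence and uniqueness of the attractor: existence
  comes from the decreasing iterates of the unit square, uniqueness from
  \<open>cells_fixed_subset\<close>.\<close>

lemma vicsek_set_eq:
  assumes n: "n \<ge> 2"
  defines "K \<equiv> (\<Inter>m. (cells_image n ^^ m) unit_square)"
  shows "compact K" "cells_image n K = K" "corners \<subseteq> K" "vicsek_set n = K"
proof -
  have n0: "n > 0" using n by simp
  define S where "S m = (cells_image n ^^ m) unit_square" for m
  have S0: "S 0 = unit_square" and SS: "S (Suc m) = cells_image n (S m)" for m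
    by (simp_all add: S_def)
  have K_eq: "K = (\<Inter>m. S m)" by (simp add: K_def S_def)
  have "compact unit_square" unfolding unit_square_def by (intro compact_Times) auto
  then have comp: "compact (S m)" for m
    by (induction m) (simp_all add: S0 SS compact_cells_image)
  have sq: "cells_image n unit_square \<subseteq> unit_square"
    unfolding cells_image_def using vs_map_unit_square[OF n0] by blast
  have dec1: "S (Suc m) \<subseteq> S m" for m
  proof (induction m)
    case (Suc m)
    from cells_image_mono[OF this] show ?case unfolding SS .
  qed (use sq in \<open>simp add: S0 SS\<close>)
  have dec: "S j \<subseteq> S i" if "i \<le> j" for i j
    using that by (induction rule: dec_induct) (use dec1 in blast)+
  show K: "compact K" unfolding K_eq
    by (intro compact_Inter) (use comp in auto)
  show crn: "corners \<subseteq> K"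
  proof
    fix c assume c: "c \<in> corners"
    have "c \<in> S m" for m
    proof (induction m)
      case 0
      then show ?case using c corners_subset unfolding S0 by blast
    next
      case (Suc m)
      have "arm_cell n c 0 \<in> diag_cells n" using n0 by (intro arm_cell_diag) auto
      then have "vs_map n (arm_cell n c 0) c \<in> S (Suc m)"
        using Suc unfolding SS cells_image_def by blast
      then show ?case using vs_map_arm_cell_0[OF n0 c] by simp
    qed
    then show "c \<in> K" unfolding K_eq by blast
  qed
  show fixed: "cells_image n K = K"
  proof (intro equalityI subsetI)
    fix x assume x: "x \<in> cells_image n K"
    have "x \<in> S m" for m
    proof -
      have "K \<subseteq> S m" unfolding K_eq by blast
      with x have "x \<in> cells_image n (S m)" using cells_image_mono by blast
      then have "x \<in> S (Suc m)" unfolding SS .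
      then show ?thesis using dec1[of m] by blast
    qed
    then show "x \<in> K" unfolding K_eq by blast
  next
    fix x assume x: "x \<in> K"
    have "\<forall>m. \<exists>d\<in>diag_cells n. \<exists>y\<in>S m. x = vs_map n d y"
    proof
      fix m
      have "x \<in> S (Suc m)" using x unfolding K_eq by blast
      then have "x \<in> cells_image n (S m)" unfolding SS .
      then show "\<exists>d\<in>diag_cells n. \<exists>y\<in>S m. x = vs_map n d y"
        unfolding cells_image_def by blast
    qed
    then obtain d where d: "\<And>m. d m \<in> diag_cells n" "\<And>m. \<exists>y\<in>S m. x = vs_map n (d m) y"
      by metis
    \<comment> \<open>The first letter may change with m, but one letter occurs infinitely often; by
      injectivity it always yields the same preimage, which then lies in every iterate.\<close>
    have "\<exists>e\<in>diag_cells n. infinite {m. d m = e}"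
    proof (rule ccontr)
      assume "\<not> ?thesis"
      then have "finite (\<Union>e\<in>diag_cells n. {m. d m = e})" by (intro finite_UN_I) auto
      moreover have "(\<Union>e\<in>diag_cells n. {m. d m = e}) = UNIV" using d(1) by auto
      ultimately show False by simp
    qed
    then obtain e where e: "e \<in> diag_cells n" "infinite {m. d m = e}" by blast
    have often: "\<exists>j\<ge>i. d j = e" for i
      using e(2) unfolding infinite_nat_iff_unbounded_le by simp
    then obtain m0 where "d m0 = e" by blast
    then obtain y where y: "x = vs_map n e y" using d(2)[of m0] by blast
    have "y \<in> S m" for m
    proof -
      obtain j where j: "j \<ge> m" "d j = e" using often by blast
      obtain z where z: "z \<in> S j" "x = vs_map n e z" using d(2)[of j] unfolding j(2) ..
      have "y = z" by (rule vs_map_inj[OF n0]) (rule trans[OF y[symmetric] z(2)])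
      then have "y \<in> S j" using z(1) by simp
      then show ?thesis using dec[OF j(1)] by blast
    qed
    then have "y \<in> K" unfolding K_eq by blast
    with e(1) y show "x \<in> cells_image n K"
      unfolding cells_image_def by (intro UN_I[of e] image_eqI[of _ _ y])
  qed
  have ne: "K \<noteq> {}" using crn by (auto simp: corners_def)
  show "vicsek_set n = K" unfolding vicsek_set_def cells_image_def[symmetric]
  proof (rule the_equality)
    show "compact K \<and> K \<noteq> {} \<and> K = cells_image n K" using K ne fixed by simp
  next
    fix L assume L: "compact L \<and> L \<noteq> {} \<and> L = cells_image n L"
    show "L = K"
    proof (rule equalityI)
      note L' = conjunct1[OF L] conjunct1[OF conjunct2[OF L]] conjunct2[OF conjunct2[OF L]]
      show "L \<subseteq> K"
        by (rule cells_fixed_subset[OF n compact_imp_bounded[OF L'(1)] equalityD1[OF L'(3)] K ne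
            equalityD1[OF fixed]])
      show "K \<subseteq> L"
        by (rule cells_fixed_subset[OF n compact_imp_bounded[OF K] equalityD2[OF fixed] L'(1,2)
            equalityD2[OF L'(3)]])
    qed
  qed
qed

lemma vicsek_set_props:
  assumes n: "n \<ge> 2"
  shows "compact (vicsek_set n)" "cells_image n (vicsek_set n) = vicsek_set n"
    "corners \<subseteq> vicsek_set n" "vicsek_set n \<subseteq> unit_square"
proof -
  note eq = vicsek_set_eq[OF n, folded vicsek_set_eq(4)[OF n]]
  show "compact (vicsek_set n)" "cells_image n (vicsek_set n) = vicsek_set n"
    "corners \<subseteq> vicsek_set n"
    by (fact eq)+
  have "(\<Inter>m. (cells_image n ^^ m) unit_square) \<subseteq> (cells_image n ^^ 0) unit_square" by blast
  then show "vicsek_set n \<subseteq> unit_square" unfolding vicsek_set_eq(4)[OF n] by simp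
qed

lemma word_map_vicsek_set:
  assumes n: "n \<ge> 2" and "set w \<subseteq> diag_cells n" "x \<in> vicsek_set n"
  shows "word_map n w x \<in> vicsek_set n"
  using assms(2)
proof (induction w)
  case (Cons d w)
  then have "vs_map n d (word_map n w x) \<in> cells_image n (vicsek_set n)"
    by (auto simp: cells_image_def)
  then show ?case using vicsek_set_props(2)[OF n] by simp
qed (use assms in simp)

lemma vicsek_set_in_cell:
  assumes n: "n \<ge> 2" and "x \<in> vicsek_set n"
  shows "\<exists>w\<in>words n k. \<exists>z\<in>vicsek_set n. x = word_map n w z"
  using assms(2)
proof (induction k arbitrary: x)
  case 0
  then show ?case by (auto simp: words_def)
next
  case (Suc k)
  then obtain d y where d: "d \<in> diag_cells n" "y \<in> vicsek_set n" "x = vs_map n d y"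
    using vicsek_set_props(2)[OF n] unfolding cells_image_def by blast
  obtain w z where w: "w \<in> words n k" "z \<in> vicsek_set n" "y = word_map n w z"
    using Suc.IH[OF d(2)] by blast
  have "d # w \<in> words n (Suc k)" "x = word_map n (d # w) z" using d w by (auto simp: words_def)
  then show ?case using w(2) by blast
qed

lemma dist_word_map:
  assumes n: "n \<ge> 2"
  shows "dist (word_map n w p) (word_map n w q) = dist p q / (2 * real n - 1) ^ length w"
  using n by (induction w) (simp_all add: dist_vs_map)

lemma vs_vertices_eq: "vs_vertices n m = pt n ` ends n m"
proof (induction m)
  case 0
  have "words n 0 = {[]}" by (auto simp: words_def)
  then show ?case by (auto simp: ends_def pt_def image_def)
next
  case (Suc m)
  have "vs_map n d ` vs_vertices n m \<subseteq> pt n ` ends n (Suc m)" if "d \<in> diag_cells n" for d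
  proof
    fix x assume "x \<in> vs_map n d ` vs_vertices n m"
    then obtain w c where "w \<in> words n m" "c \<in> corners" "x = vs_map n d (word_map n w c)"
      by (auto simp: Suc ends_def pt_def)
    then show "x \<in> pt n ` ends n (Suc m)"
      using that by (intro image_eqI[of _ _ "(d # w, c)"]) (auto simp: ends_def pt_def words_def)
  qed
  moreover have "pt n i \<in> (\<Union>d\<in>diag_cells n. vs_map n d ` vs_vertices n m)"
    if "i \<in> ends n (Suc m)" for i
  proof -
    have i: "fst i \<in> words n (Suc m)" using that by (auto simp: ends_def)
    then obtain d w where dw: "fst i = d # w" by (auto simp: words_def length_Suc_conv)
    with i have w: "fst i = d # w" "d \<in> diag_cells n" "w \<in> words n m" by (auto simp: words_def)
    then have "(w, snd i) \<in> ends n m" using that by (auto simp: ends_def)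
    then have "word_map n w (snd i) \<in> vs_vertices n m" unfolding Suc by (force simp: pt_def)
    then show ?thesis using w by (auto simp: pt_def)
  qed
  ultimately show ?case by (simp only: vs_vertices.simps) blast
qed

section \<open>Neumann eigenvalues as limits of graph eigenvalues\<close>

text \<open>One element for each \<open>m\<close>-cell containing \<open>x\<close>, so at a vertex
  the cardinality is a third of the degree.\<close>

definition fiber :: "nat \<Rightarrow> nat \<Rightarrow> real \<times> real \<Rightarrow> ((nat \<times> nat) list \<times> (real \<times> real)) set" where
  "fiber n m x = {i. i \<in> ends n m \<and> pt n i = x}"

text \<open>The negative graph Laplacian written over cells. At a point that is no vertex the empty
  sum divided by 0 gives 0.\<close>

definition vertex_operator ::
  "nat \<Rightarrow> nat \<Rightarrow> (real \<times> real \<Rightarrow> real) \<Rightarrow> real \<times> real \<Rightarrow> real" where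
  "vertex_operator n m f x =
    - (\<Sum>i\<in>fiber n m x. cell_sum n f (fst i) - 4 * f x) / (3 * real (card (fiber n m x)))"

lemma finite_fiber [simp]: "finite (fiber n m x)"
  by (simp add: fiber_def)

text \<open>Where the words first differ, the displacement of the two cells fixes the common point.
  Hence a neighbour of a vertex belongs to only one of the cells around it.\<close>

lemma word_cells_meet_once:
  "length v = length w \<Longrightarrow> n > 0 \<Longrightarrow> v \<noteq> w \<Longrightarrow> set v \<subseteq> diag_cells n \<Longrightarrow> set w \<subseteq> diag_cells n \<Longrightarrow>
   {p, p', q, q'} \<subseteq> unit_square \<Longrightarrow> word_map n v p = word_map n w q \<Longrightarrow>
   word_map n v p' = word_map n w q' \<Longrightarrow> p = p'"
proof (induction v w rule: list_induct2)
  case Nil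
  then show ?case by simp
next
  case (Cons d v e w)
  show ?case
  proof (cases "d = e")
    case True
    then have "word_map n v p = word_map n w q" "word_map n v p' = word_map n w q'"
      using vs_map_inj[OF Cons.prems(1)] Cons.prems(6,7) by simp_all
    with True show ?thesis using Cons.IH Cons.prems by simp
  next
    case False
    have sq: "word_map n v p \<in> unit_square" "word_map n v p' \<in> unit_square"
      "word_map n w q \<in> unit_square" "word_map n w q' \<in> unit_square"
      using Cons.prems word_map_unit_square by auto
    have d: "d \<in> diag_cells n" "e \<in> diag_cells n" using Cons.prems by auto
    have "word_map n v p = word_map n v p'"
      using cells_meet(3,4)[OF Cons.prems(1) d False sq(1,3)]
        cells_meet(3,4)[OF Cons.prems(1) d False sq(2,4)] Cons.prems(6,7)
      by (simp add: prod_eq_iff)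
    then show ?thesis using word_map_inj[OF Cons.prems(1)] by blast
  qed
qed

lemma vs_adj_iff:
  "{y. vs_adj n m x y} = (\<Union>i\<in>fiber n m x. word_map n (fst i) ` corners - {x})"
proof -
  have "vs_adj n m x y \<longleftrightarrow> (\<exists>i\<in>fiber n m x. y \<in> word_map n (fst i) ` corners - {x})" for y
  proof
    assume "vs_adj n m x y"
    then obtain w c where w: "x \<noteq> y" "length w = m" "set w \<subseteq> diag_cells n" "c \<in> corners"
      "x = word_map n w c" "y \<in> word_map n w ` corners"
      by (auto simp: vs_adj_def)
    then have "(w, c) \<in> fiber n m x" by (simp add: fiber_def ends_def words_def pt_def)
    then show "\<exists>i\<in>fiber n m x. y \<in> word_map n (fst i) ` corners - {x}"
      using w by (intro bexI[of _ "(w, c)"]) auto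
  next
    assume "\<exists>i\<in>fiber n m x. y \<in> word_map n (fst i) ` corners - {x}"
    then obtain w c where "(w, c) \<in> fiber n m x" "y \<in> word_map n w ` corners" "y \<noteq> x" by auto
    then show "vs_adj n m x y"
      unfolding vs_adj_def fiber_def ends_def words_def pt_def by auto
  qed
  then show ?thesis by blast
qed

text \<open>Each cell at \<open>x\<close> contributes three neighbours, and by
  \<open>word_cells_meet_once\<close> none of them is counted twice.\<close>

lemma graph_laplacian_eq:
  assumes n: "n \<ge> 2"
  shows "graph_laplacian n m f x = - vertex_operator n m f x"
proof -
  have n0: "n > 0" using n by simp
  let ?N = "\<lambda>i. word_map n (fst i) ` corners - {x}"
  have inj: "inj_on (word_map n w) corners" for w using word_map_inj[OF n0] by (auto simp: inj_on_def)
  have xin: "x \<in> word_map n (fst i) ` corners" if "i \<in> fiber n m x" for i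
    using that by (auto simp: fiber_def ends_def pt_def)
  have disj: "?N i \<inter> ?N j = {}" if ij: "i \<in> fiber n m x" "j \<in> fiber n m x" "i \<noteq> j" for i j
  proof (rule ccontr)
    assume "?N i \<inter> ?N j \<noteq> {}"
    then obtain y where "y \<noteq> x" "y \<in> word_map n (fst i) ` corners" "y \<in> word_map n (fst j) ` corners"
      by blast
    then obtain c c' where c: "c \<in> corners" "c' \<in> corners" "word_map n (fst i) c \<noteq> x"
      "word_map n (fst i) c = word_map n (fst j) c'" by (elim imageE) simp
    have i: "fst i \<in> words n m" "snd i \<in> corners" "word_map n (fst i) (snd i) = x"
      and j: "fst j \<in> words n m" "snd j \<in> corners" "word_map n (fst j) (snd j) = x"
      using ij by (auto simp: fiber_def ends_def pt_def)
    have "fst i \<noteq> fst j"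
      using ij(3) i(3) j(3) word_map_inj[OF n0] by (metis prod_eqI)
    then have "c = snd i"
      using word_cells_meet_once[of "fst i" "fst j" n c "snd i" c' "snd j"] i j c n0 corners_subset
      by (auto simp: words_def)
    then show False using c(3) i(3) by simp
  qed
  have "card (?N i) = 3" if "i \<in> fiber n m x" for i
    using xin[OF that] by (simp add: card_image[OF inj])
  then have "card {y. vs_adj n m x y} = 3 * card (fiber n m x)"
    unfolding vs_adj_iff using disj by (subst card_UN_disjoint) auto
  moreover have "(\<Sum>y | vs_adj n m x y. f y - f x) =
      (\<Sum>i\<in>fiber n m x. cell_sum n f (fst i) - 4 * f x)"
  proof -
    have "(\<Sum>y\<in>?N i. f y - f x) = cell_sum n f (fst i) - 4 * f x" if "i \<in> fiber n m x" for i
    proof -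
      have "(\<Sum>y\<in>?N i. f y - f x) = (\<Sum>y\<in>word_map n (fst i) ` corners. f y - f x)"
        by (rule sum.mono_neutral_left) auto
      also have "\<dots> = (\<Sum>c\<in>corners. f (word_map n (fst i) c) - f x)"
        by (simp add: sum.reindex[OF inj])
      also have "\<dots> = cell_sum n f (fst i) - 4 * f x"
        by (simp add: sum_subtractf cell_sum_def)
      finally show ?thesis .
    qed
    then show ?thesis
      unfolding vs_adj_iff using disj by (subst sum.UNION_disjoint) auto
  qed
  ultimately show ?thesis by (simp add: graph_laplacian_def vertex_operator_def)
qed

lemma sum_fibers:
  "(\<Sum>x\<in>pt n ` ends n m. \<Sum>i\<in>fiber n m x. h i) = (\<Sum>i\<in>ends n m. h i :: real)"
  unfolding fiber_def by (rule sum.group) auto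

text \<open>Weights proportional to the degree turn sums over vertices into unweighted sums over
  ends.\<close>

lemma sum_vertices:
  "(\<Sum>x\<in>pt n ` ends n m. real (card (fiber n m x)) * h x) = (\<Sum>i\<in>ends n m. h (pt n i))"
proof -
  have "real (card (fiber n m x)) * h x = (\<Sum>i\<in>fiber n m x. h (pt n i))" for x
    by (simp add: fiber_def)
  then show ?thesis using sum_fibers[where h = "\<lambda>i. h (pt n i)"] by simp
qed

lemma card_fiber_pos: "x \<in> pt n ` ends n m \<Longrightarrow> card (fiber n m x) > 0"
  by (auto simp: card_gt_0_iff fiber_def)

text \<open>Regrouped by cells, the bilinear form is a combination of products of cell sums and
  products of values, which is visibly symmetric.\<close>

lemma vertex_operator_sym:
  "(\<Sum>x\<in>pt n ` ends n m. real (card (fiber n m x)) * vertex_operator n m f x * g x) =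
   (\<Sum>x\<in>pt n ` ends n m. real (card (fiber n m x)) * f x * vertex_operator n m g x)"
proof -
  define Q where "Q f g = (\<Sum>x\<in>pt n ` ends n m. real (card (fiber n m x)) * vertex_operator n m f x * g x)"
    for f g
  have Q: "Q f g = - (1 / 3) * ((\<Sum>w\<in>words n m. cell_sum n f w * cell_sum n g w) -
      4 * (\<Sum>i\<in>ends n m. f (pt n i) * g (pt n i)))" for f g
  proof -
    have "Q f g = (\<Sum>x\<in>pt n ` ends n m. \<Sum>i\<in>fiber n m x.
        - (1 / 3) * ((cell_sum n f (fst i) - 4 * f (pt n i)) * g (pt n i)))"
      unfolding Q_def
    proof (rule sum.cong[OF refl])
      fix x assume "x \<in> pt n ` ends n m"
      then have "real (card (fiber n m x)) * vertex_operator n m f x * g x =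
          - (1 / 3) * (\<Sum>i\<in>fiber n m x. cell_sum n f (fst i) - 4 * f x) * g x"
        using card_fiber_pos[of x n m] by (simp add: vertex_operator_def)
      also have "\<dots> = (\<Sum>i\<in>fiber n m x. - (1 / 3) * ((cell_sum n f (fst i) - 4 * f (pt n i)) * g (pt n i)))"
        unfolding sum_distrib_left sum_distrib_right by (intro sum.cong) (auto simp: fiber_def)
      finally show "real (card (fiber n m x)) * vertex_operator n m f x * g x = \<dots>" .
    qed
    also have "\<dots> = - (1 / 3) * ((\<Sum>i\<in>ends n m. cell_sum n f (fst i) * g (pt n i)) -
        4 * (\<Sum>i\<in>ends n m. f (pt n i) * g (pt n i)))"
      unfolding sum_fibers sum_distrib_left[symmetric]
      by (simp add: left_diff_distrib sum_subtractf sum_distrib_left mult.assoc)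
    also have "(\<Sum>i\<in>ends n m. cell_sum n f (fst i) * g (pt n i)) =
        (\<Sum>w\<in>words n m. cell_sum n f w * cell_sum n g w)"
      unfolding ends_def by (subst sum.cartesian_product')
        (simp add: pt_def cell_sum_def sum_distrib_left)
    finally show ?thesis .
  qed
  have "Q f g = Q g f" unfolding Q by (simp add: mult.commute)
  then show ?thesis by (simp add: Q_def mult_ac)
qed

lemma is_eig_of_vertex_operator:
  assumes f: "\<exists>x\<in>pt n ` ends n m. f x \<noteq> 0"
    and A: "\<And>x. x \<in> pt n ` ends n m \<Longrightarrow> vertex_operator n m f x = l * f x"
  shows "is_eig n m l f"
  unfolding is_eig_def
proof (intro conjI allI)
  fix x
  show "(\<Sum>i | i \<in> ends n m \<and> pt n i = x. residual n l f i) = 0"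
  proof (cases "x \<in> pt n ` ends n m")
    case True
    have "(\<Sum>i\<in>fiber n m x. residual n l f i) =
        (\<Sum>i\<in>fiber n m x. (cell_sum n f (fst i) - 4 * f x) + 3 * l * f x)"
      by (intro sum.cong) (auto simp: residual_def fiber_def algebra_simps)
    also have "\<dots> = (\<Sum>i\<in>fiber n m x. cell_sum n f (fst i) - 4 * f x) +
        3 * real (card (fiber n m x)) * (l * f x)"
      by (simp add: sum.distrib)
    also have "\<dots> = 0"
      using card_fiber_pos[OF True] by (simp add: A[OF True, symmetric] vertex_operator_def)
    finally show ?thesis by (simp add: fiber_def)
  next
    case False
    then have "{i. i \<in> ends n m \<and> pt n i = x} = {}" by auto
    then show ?thesis by (simp only: sum.empty)
  qed
qed (use f in auto)

lemma card_words: "card (words n m) = card (diag_cells n) ^ m"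
  unfolding words_def by (rule card_lists_length_eq) simp

lemma card_ends: "card (ends n m) = 4 * card (diag_cells n) ^ m"
  by (simp add: ends_def card_cartesian_product card_words)

text \<open>On level m the eigenfunction satisfies the graph equation up to a small multiple of
  rho^-m, uniformly over the vertices. Its mean square over the ends stays bounded below, because it
  is bounded away from 0 on one fixed cell. So it is a quasimode with error small against
  rho^-m.\<close>

lemma neumann_eigenvalue_approx:
  assumes n: "n \<ge> 2" and ev: "neumann_eigenvalue n l" and e: "e > 0"
  shows "\<exists>M. \<forall>m\<ge>M. \<exists>\<kappa> v. is_eig n m \<kappa> v \<and> \<bar>rho n ^ m * \<kappa> - l\<bar> < e"
proof -
  have n0: "n > 0" using n by simp
  obtain u x0 where x0: "x0 \<in> vicsek_set n" "u x0 \<noteq> 0"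
    and cont: "continuous_on (vicsek_set n) u"
    and lap: "\<And>e. e > 0 \<Longrightarrow> \<exists>M. \<forall>m\<ge>M. \<forall>x\<in>vs_vertices n m.
       \<bar>rho n ^ m * graph_laplacian n m u x - - l * u x\<bar> < e"
    using ev unfolding neumann_eigenvalue_def has_neumann_laplacian_def by blast
  define \<delta> where "\<delta> = \<bar>u x0\<bar> / 2"
  have \<delta>: "\<delta> > 0" using x0 by (simp add: \<delta>_def)
  obtain r where r: "r > 0" "\<And>y. y \<in> vicsek_set n \<Longrightarrow> dist y x0 < r \<Longrightarrow> \<delta> \<le> \<bar>u y\<bar>"
  proof -
    obtain r where r: "r > 0" "\<And>y. y \<in> vicsek_set n \<Longrightarrow> dist y x0 < r \<Longrightarrow> dist (u y) (u x0) < \<delta>"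
      using cont[unfolded continuous_on_iff] x0(1) \<delta> by metis
    show thesis
    proof (rule that[OF r(1)])
      fix y assume "y \<in> vicsek_set n" "dist y x0 < r"
      from r(2)[OF this] have "\<bar>u x0 - u y\<bar> < \<delta>" by (simp add: dist_real_def abs_minus_commute)
      then show "\<delta> \<le> \<bar>u y\<bar>" using abs_triangle_ineq2[of "u x0" "u y"] by (simp add: \<delta>_def)
    qed
  qed
  have diam: "dist p q \<le> 2" if "p \<in> unit_square" "q \<in> unit_square" for p q :: "real \<times> real"
  proof -
    have "dist p q \<le> dist (fst p) (fst q) + dist (snd p) (snd q)"
      unfolding dist_prod_def by (rule real_sqrt_le_iff'[THEN iffD2]) (auto simp: power2_sum)
    also have "\<dots> \<le> 1 + 1"
      using that by (intro add_mono) (auto simp: unit_square_def dist_real_def)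
    finally show ?thesis by simp
  qed
  obtain k where k: "2 / (2 * real n - 1) ^ k < r"
  proof -
    obtain k where "2 / r < (2 * real n - 1) ^ k"
      using real_arch_pow[of "2 * real n - 1" "2 / r"] n by auto
    then show thesis using that[of k] r(1) n by (simp add: field_simps)
  qed
  obtain w0 z where w0: "w0 \<in> words n k" "z \<in> vicsek_set n" "x0 = word_map n w0 z"
    using vicsek_set_in_cell[OF n x0(1)] by blast
  have big: "\<delta> \<le> \<bar>u (word_map n w0 y)\<bar>" if "y \<in> vicsek_set n" for y
  proof (rule r(2))
    show "word_map n w0 y \<in> vicsek_set n"
      using word_map_vicsek_set[OF n _ that] w0(1) by (auto simp: words_def)
    have "dist (word_map n w0 y) x0 = dist y z / (2 * real n - 1) ^ k"
      using w0 by (simp add: dist_word_map[OF n] words_def)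
    also have "\<dots> \<le> 2 / (2 * real n - 1) ^ k"
    proof (rule divide_right_mono)
      show "dist y z \<le> 2" using vicsek_set_props(4)[OF n] that w0(2) by (intro diam) blast+
    qed (use n in simp)
    also have "\<dots> < r" by (rule k)
    finally show "dist (word_map n w0 y) x0 < r" .
  qed
  define P where "P = real (card (diag_cells n))"
  have P: "P > 0" 
  proof -
    have "arm_cell n (0, 0) 0 \<in> diag_cells n" by (rule arm_cell_diag) (use n0 in auto)
    then show ?thesis unfolding P_def by (simp only: of_nat_0_less_iff card_gt_0_iff finite_diag_cells) blast
  qed

  \<comment> \<open>The cell \<open>w0\<close> of level k carries the fraction 1/P^k of all ends, so
    the mean square of \<open>u\<close> is at least
    \<open>\<delta>\<^sup>2 / P ^ k = 1 / C\<^sup>2\<close>.\<close>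
  define C where "C = sqrt (P ^ k) / \<delta>"
  have C: "C > 0" using P \<delta> by (simp add: C_def)
  have mass: "real (card (ends n m)) \<le> C\<^sup>2 * (\<Sum>i\<in>ends n m. (u (pt n i))\<^sup>2)" if km: "m \<ge> k" for m
  proof -
    obtain j where m: "m = k + j" using le_Suc_ex[OF km] ..
    let ?f = "\<lambda>i. (w0 @ fst i, snd i)"
    have inj: "inj_on ?f (ends n j)" by (auto simp: inj_on_def prod_eq_iff)
    have "real (card (ends n j)) * \<delta>\<^sup>2 = (\<Sum>i\<in>ends n j. \<delta>\<^sup>2)" by simp
    also have "\<dots> \<le> (\<Sum>i\<in>ends n j. (u (pt n (?f i)))\<^sup>2)"
    proof (rule sum_mono)
      fix i assume i: "i \<in> ends n j"
      have "word_map n (fst i) (snd i) \<in> vicsek_set n"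
        using i vicsek_set_props(3)[OF n]
        by (intro word_map_vicsek_set[OF n]) (auto simp: ends_def words_def)
      from big[OF this] have "\<delta> \<le> \<bar>u (pt n (?f i))\<bar>" by (simp add: pt_def word_map_append)
      then show "\<delta>\<^sup>2 \<le> (u (pt n (?f i)))\<^sup>2" using \<delta> by (simp add: abs_le_square_iff[symmetric])
    qed
    also have "\<dots> = (\<Sum>i\<in>?f ` ends n j. (u (pt n i))\<^sup>2)" by (simp add: sum.reindex[OF inj])
    also have "\<dots> \<le> (\<Sum>i\<in>ends n m. (u (pt n i))\<^sup>2)"
    proof (rule sum_mono2[OF finite_ends])
      show "?f ` ends n j \<subseteq> ends n m" using w0(1) by (auto simp: ends_def words_def m)
    qed simp
    finally have "real (card (ends n j)) * \<delta>\<^sup>2 \<le> (\<Sum>i\<in>ends n m. (u (pt n i))\<^sup>2)" .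
    moreover have "real (card (ends n m)) = real (card (ends n j)) * P ^ k"
      by (simp add: card_ends P_def m power_add)
    moreover have "C\<^sup>2 * \<delta>\<^sup>2 = P ^ k" using \<delta> P by (simp add: C_def power_divide)
    moreover have "C\<^sup>2 * (real (card (ends n j)) * \<delta>\<^sup>2) \<le> C\<^sup>2 * (\<Sum>i\<in>ends n m. (u (pt n i))\<^sup>2)"
      using calculation(1) by (rule mult_left_mono) simp
    ultimately show ?thesis by (simp add: mult_ac)
  qed
  \<comment> \<open>Leaves the final error \<open>e' * C = e / 2\<close>.\<close>
  define e' where "e' = e / (2 * C)"
  have e': "e' > 0" using e C by (simp add: e'_def)
  obtain M where M: "\<And>m x. m \<ge> M \<Longrightarrow> x \<in> vs_vertices n m \<Longrightarrow>
      \<bar>rho n ^ m * graph_laplacian n m u x - - l * u x\<bar> < e'"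
    using lap[OF e'] by blast
  have rho: "rho n > 0" using n by (simp add: rho_def)
  show ?thesis
  proof (intro exI[of _ "max M k"] allI impI)
    fix m assume m: "m \<ge> max M k"
    let ?V = "pt n ` ends n m" and ?\<mu> = "l / rho n ^ m" and ?\<epsilon> = "e' * C / rho n ^ m"
    have cardpos: "real (card (ends n m)) > 0"
      using P by (simp add: card_ends P_def)
    have "(\<Sum>x\<in>?V. real (card (fiber n m x)) * (vertex_operator n m u x - ?\<mu> * u x)\<^sup>2) =
        (\<Sum>i\<in>ends n m. (vertex_operator n m u (pt n i) - ?\<mu> * u (pt n i))\<^sup>2)"
      by (rule sum_vertices)
    also have "\<dots> \<le> (\<Sum>i\<in>ends n m. (e' / rho n ^ m)\<^sup>2)"
    proof (rule sum_mono)
      fix i assume "i \<in> ends n m"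
      then have "\<bar>rho n ^ m * - vertex_operator n m u (pt n i) - - l * u (pt n i)\<bar> < e'"
        using M[of m "pt n i"] m by (simp add: vs_vertices_eq graph_laplacian_eq[OF n])
      moreover have "rho n ^ m * - vertex_operator n m u (pt n i) - - l * u (pt n i) =
          - (rho n ^ m * (vertex_operator n m u (pt n i) - ?\<mu> * u (pt n i)))"
        using rho by (simp add: field_simps)
      ultimately have "rho n ^ m * \<bar>vertex_operator n m u (pt n i) - ?\<mu> * u (pt n i)\<bar> < e'"
        using rho by (simp only: abs_mult abs_minus_cancel power_abs[symmetric]) simp
      then have "\<bar>vertex_operator n m u (pt n i) - ?\<mu> * u (pt n i)\<bar> \<le> e' / rho n ^ m"
        using rho by (simp add: pos_le_divide_eq mult.commute)
      then show "(vertex_operator n m u (pt n i) - ?\<mu> * u (pt n i))\<^sup>2 \<le> (e' / rho n ^ m)\<^sup>2"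
        by (rule abs_le_square_iff[THEN iffD1, OF order_trans[OF _ abs_ge_self]])
    qed
    also have "\<dots> = (e' / rho n ^ m)\<^sup>2 * real (card (ends n m))" by simp
    also have "\<dots> \<le> (e' / rho n ^ m)\<^sup>2 * (C\<^sup>2 * (\<Sum>i\<in>ends n m. (u (pt n i))\<^sup>2))"
      using mass[of m] m by (intro mult_left_mono) auto
    also have "\<dots> = ?\<epsilon>\<^sup>2 * (\<Sum>x\<in>?V. real (card (fiber n m x)) * (u x)\<^sup>2)"
      unfolding sum_vertices[where h = "\<lambda>x. (u x)\<^sup>2"] by (simp add: power_mult_distrib power_divide)
    finally have quasi: "(\<Sum>x\<in>?V. real (card (fiber n m x)) * (vertex_operator n m u x - ?\<mu> * u x)\<^sup>2)
        \<le> ?\<epsilon>\<^sup>2 * (\<Sum>x\<in>?V. real (card (fiber n m x)) * (u x)\<^sup>2)" .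
    have nz: "\<exists>x\<in>?V. u x \<noteq> 0"
    proof (rule ccontr)
      assume "\<not> ?thesis"
      then have "(\<Sum>i\<in>ends n m. (u (pt n i))\<^sup>2) = 0" by simp
      then show False using mass[of m] m cardpos by simp
    qed
    have "\<exists>\<kappa> f. \<bar>\<kappa> - ?\<mu>\<bar> \<le> ?\<epsilon> \<and> (\<exists>x\<in>?V. f x \<noteq> 0) \<and> (\<forall>x\<in>?V. vertex_operator n m f x = \<kappa> * f x)"
    proof (rule eigenvalue_near_quasimode[OF _ _ _ _ _ vertex_operator_sym nz _ quasi])
      show "continuous_on UNIV (\<lambda>f. vertex_operator n m f x)" for x
        unfolding vertex_operator_def cell_sum_def divide_inverse
        by (intro continuous_intros continuous_on_product_coordinates)
      show "vertex_operator n m (\<lambda>y. f y + t * g y) x = vertex_operator n m f x + t * vertex_operator n m g x"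
        for f g t x
        unfolding vertex_operator_def cell_sum_def
        by (simp add: sum.distrib sum_subtractf sum_distrib_left[symmetric] algebra_simps
            add_divide_distrib diff_divide_distrib)
      show "vertex_operator n m f x = vertex_operator n m g x"
        if fg: "\<And>y. y \<in> ?V \<Longrightarrow> f y = g y" and x: "x \<in> ?V" for f g x
      proof -
        have "cell_sum n f (fst i) = cell_sum n g (fst i)" if "i \<in> fiber n m x" for i
          unfolding cell_sum_def
        proof (rule sum.cong[OF refl])
          fix c assume "c \<in> corners"
          then have "(fst i, c) \<in> ends n m" using that by (auto simp: fiber_def ends_def)
          then have "pt n (fst i, c) \<in> ?V" by blast
          from fg[OF this] show "f (word_map n (fst i) c) = g (word_map n (fst i) c)"
            by (simp add: pt_def)
        qed
        then show ?thesis using fg[OF x] by (simp add: vertex_operator_def)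
      qed
      show "0 < real (card (fiber n m x))" if "x \<in> ?V" for x using card_fiber_pos[OF that] by simp
      show "0 \<le> ?\<epsilon>" using e' C rho by simp
    qed simp
    then obtain \<kappa> f where f: "\<bar>\<kappa> - ?\<mu>\<bar> \<le> ?\<epsilon>" "\<exists>x\<in>?V. f x \<noteq> 0"
      "\<And>x. x \<in> ?V \<Longrightarrow> vertex_operator n m f x = \<kappa> * f x" by blast
    have "rho n ^ m * \<bar>\<kappa> - ?\<mu>\<bar> \<le> rho n ^ m * ?\<epsilon>" using f(1) rho by (intro mult_left_mono) auto
    then have "\<bar>rho n ^ m * (\<kappa> - ?\<mu>)\<bar> \<le> e' * C" using rho by (simp add: abs_mult)
    moreover have "rho n ^ m * (\<kappa> - ?\<mu>) = rho n ^ m * \<kappa> - l" using rho by (simp add: right_diff_distrib)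
    moreover have "e' * C < e" using e C by (simp add: e'_def)
    ultimately have "\<bar>rho n ^ m * \<kappa> - l\<bar> < e" by simp
    with is_eig_of_vertex_operator[OF f(2,3)]
    show "\<exists>\<kappa> v. is_eig n m \<kappa> v \<and> \<bar>rho n ^ m * \<kappa> - l\<bar> < e" by blast
  qed
qed

section \<open>Ratios of small points of the decimation tree\<close>

text \<open>The arguments are the upper end of what lies below the gap and the lower end of what
  lies above it. Raising \<open>u\<close> or lowering \<open>l\<close> preserves the property, which
  allows rounded ends.\<close>

definition gap :: "real set \<Rightarrow> real \<Rightarrow> real \<Rightarrow> bool" where
  "gap T u l \<longleftrightarrow> (\<forall>x\<in>T. x \<le> u \<or> l \<le> x)"

lemma gapD: "gap T u l \<Longrightarrow> x \<in> T \<Longrightarrow> x \<le> u \<or> l \<le> x"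
  by (simp add: gap_def)

text \<open>Made for a gap around a critical point: the two flanks are pulled back along monotone
  branches, and the middle is excluded by the values of R there.\<close>

lemma gap_join:
  assumes "gap T u t" "\<And>x. t \<le> x \<Longrightarrow> x \<le> s \<Longrightarrow> x \<notin> T" "gap T s l"
  shows "gap T u l"
  using assms unfolding gap_def by blast

text \<open>Apart from 4/3, a point of the tree is the fixed point 0 or entered by
  \<open>step\<close>.\<close>

lemma decimation_tree_step:
  assumes "R 0 = 0" "x \<in> decimation_tree R" "x \<noteq> 4 / 3"
  shows "R x \<in> decimation_tree R"
  using assms(2,3,1) by (cases rule: decimation_tree.cases) (auto intro: decimation_tree.zero)

lemma gap_increasing:
  assumes R0: "R 0 = 0" and inc: "\<And>x y. s \<le> x \<Longrightarrow> x < y \<Longrightarrow> y \<le> t \<Longrightarrow> R x < R y"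
    and g: "gap (decimation_tree R) c d" and "c \<le> R u" "R l \<le> d"
    and "s \<le> u" "l \<le> t" "l \<le> 4 / 3"
  shows "gap (decimation_tree R) u l"
  unfolding gap_def
proof (rule ballI, rule ccontr)
  fix x assume x: "x \<in> decimation_tree R" "\<not> (x \<le> u \<or> l \<le> x)"
  then have "R u < R x" "R x < R l" using inc assms by auto
  moreover have "R x \<in> decimation_tree R" using x assms by (intro decimation_tree_step[of R, OF R0]) auto
  ultimately show False using gapD[OF g, of "R x"] assms(4,5) by auto
qed

lemma gap_decreasing:
  assumes R0: "R 0 = 0" and dec: "\<And>x y. s \<le> x \<Longrightarrow> x < y \<Longrightarrow> y \<le> t \<Longrightarrow> R y < R x"
    and g: "gap (decimation_tree R) c d" and "R u \<le> d" "c \<le> R l"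
    and "s \<le> u" "l \<le> t" "l \<le> 4 / 3"
  shows "gap (decimation_tree R) u l"
  unfolding gap_def
proof (rule ballI, rule ccontr)
  fix x assume x: "x \<in> decimation_tree R" "\<not> (x \<le> u \<or> l \<le> x)"
  then have "R l < R x" "R x < R u" using dec assms by auto
  moreover have "R x \<in> decimation_tree R" using x assms by (intro decimation_tree_step[of R, OF R0]) auto
  ultimately show False using gapD[OF g, of "R x"] assms(4,5) by auto
qed

text \<open>Points below 0 or above 4/3 are sent to the same side again, so their orbits never reach
  a seed.\<close>

lemma decimation_tree_bounds:
  assumes R0: "R 0 = 0" and t: "0 \<le> t" and s: "s \<le> 4 / 3"
    and inc1: "\<And>x y. x < y \<Longrightarrow> y \<le> t \<Longrightarrow> R x < R y"
    and inc2: "\<And>x y. s \<le> x \<Longrightarrow> x < y \<Longrightarrow> R x < R y"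
    and top: "4 / 3 \<le> R (4 / 3)" and x: "x \<in> decimation_tree R"
  shows "0 \<le> x \<and> x \<le> 4 / 3"
  using x
proof (induction rule: decimation_tree.induct)
  case (step x)
  have "R x < 0" if "x < 0" using inc1[of x 0] that t R0 by simp
  moreover have "R (4 / 3) < R x" if "4 / 3 < x" using inc2[of "4 / 3" x] that s by simp
  ultimately show ?case using step top by force
qed auto

lemma deriv_pos_less:
  fixes f f' :: "real \<Rightarrow> real"
  assumes "\<And>x. (f has_real_derivative f' x) (at x)" "\<And>x. a \<le> x \<Longrightarrow> x \<le> b \<Longrightarrow> 0 < f' x"
    and "a \<le> x" "x < y" "y \<le> b"
  shows "f x < f y"
  by (rule DERIV_pos_imp_increasing[OF \<open>x < y\<close>]) (use assms in force)

lemma deriv_neg_less: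
  fixes f f' :: "real \<Rightarrow> real"
  assumes "\<And>x. (f has_real_derivative f' x) (at x)" "\<And>x. a \<le> x \<Longrightarrow> x \<le> b \<Longrightarrow> f' x < 0"
    and "a \<le> x" "x < y" "y \<le> b"
  shows "f y < f x"
  by (rule DERIV_neg_imp_decreasing[OF \<open>x < y\<close>]) (use assms in force)

text \<open>
  The first two intervals of a sextuple bound a piece of the tree and its preimage under the lowest
  inverse branch, the third one the preimage of the second.  From there on the upper estimate is
  propagated with the function \<open>q x = x + d x\<^sup>2\<close>, which satisfies \<open>\<rho> q x \<le> q (R x)\<close> near \<open>0\<close> and
  so majorises the linearising coordinate \<open>lim \<rho>\<^sup>j x\<^sub>j\<close> of the backward orbit.
\<close>

definition branch_bounds ::
  "(real \<Rightarrow> real) \<Rightarrow> real \<Rightarrow> real \<Rightarrow> real \<times> real \<times> real \<times> real \<times> real \<times> real \<Rightarrow> bool" where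
  "branch_bounds R t s I \<longleftrightarrow> (case I of (l0, u0, l1, u1, l2, u2) \<Rightarrow>
     R l1 \<le> l0 \<and> u0 \<le> R u1 \<and> R l2 \<le> l1 \<and> u1 \<le> R u2 \<and>
     0 < l2 \<and> l1 \<le> t \<and> u1 \<le> t \<and> l2 \<le> t \<and> u2 \<le> s)"

definition scaled_bounds :: "real \<Rightarrow> real \<times> real \<times> real \<times> real \<times> real \<times> real \<Rightarrow> real \<times> real" where
  "scaled_bounds d I = (case I of (l0, u0, l1, u1, l2, u2) \<Rightarrow> (l2, u2 + d * u2\<^sup>2))"

text \<open>Iterating R takes a small point up to a piece. Read backwards, two inverse steps lead to
  [l2, u2]; every further one keeps the lower bound because R x is at most rho * x, and the upper
  bound because of \<open>q_step\<close>.\<close>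

lemma scaled_cover:
  fixes R :: "real \<Rightarrow> real" and L :: "(real \<times> real \<times> real \<times> real \<times> real \<times> real) list"
  assumes R0: "R 0 = 0" and \<rho>: "\<rho> > 0" and d: "d \<ge> 0" and c: "c \<ge> 0" and st: "s \<le> t" "0 < t" "t < 4 / 3"
    and mono: "\<And>x y. x < y \<Longrightarrow> y \<le> t \<Longrightarrow> R x < R y"
    and up: "\<And>x. 0 \<le> x \<Longrightarrow> x \<le> t \<Longrightarrow> R x \<le> \<rho> * x"
    and grow: "\<And>x. 0 \<le> x \<Longrightarrow> x \<le> t \<Longrightarrow> 2 * x \<le> R x"
    and low: "\<And>x. 0 \<le> x \<Longrightarrow> x \<le> t \<Longrightarrow> \<rho> * x - c * x\<^sup>2 \<le> R x"
    and small: "c * s \<le> \<rho>" "c + 2 * d * \<rho> * c * s \<le> d * (\<rho>\<^sup>2 - \<rho>)"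
    and bnd: "\<And>x. x \<in> decimation_tree R \<Longrightarrow> x \<le> 4 / 3"
    and cover: "\<And>x. x \<in> decimation_tree R \<Longrightarrow> 0 < x \<Longrightarrow>
      x \<le> t \<or> (\<exists>I\<in>set L. fst I \<le> x \<and> x \<le> fst (snd I))"
    and br: "\<And>I. I \<in> set L \<Longrightarrow> branch_bounds R t s I"
  shows "\<exists>e>0. \<forall>x\<in>decimation_tree R. 0 < x \<longrightarrow> x < e \<longrightarrow>
    (\<exists>j. \<exists>(A, B)\<in>set (map (scaled_bounds d) L). A \<le> \<rho> ^ j * x \<and> \<rho> ^ j * x \<le> B)"
proof -
  define q where "q x = x + d * x\<^sup>2" for x :: real
  have q_step: "\<rho> * q x \<le> q (R x)" if x: "0 \<le> x" "x \<le> s" for x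
  proof -
    \<comment> \<open>A lower bound for R x. The difference of q at this value and rho * q x
      contains the factor \<open>x\<^sup>2\<close>, and \<open>small(2)\<close> makes the other
      factor nonnegative.\<close>
    let ?r = "\<rho> * x - c * x\<^sup>2"
    have r: "0 \<le> ?r"
    proof -
      have "c * x \<le> \<rho>" using mult_left_mono[OF x(2) c] small(1) by simp
      then have "0 \<le> x * (\<rho> - c * x)" using x by simp
      then show ?thesis by (simp add: algebra_simps power2_eq_square)
    qed
    have rR: "?r \<le> R x" using low x st by simp
    have "0 \<le> x\<^sup>2 * (d * (\<rho>\<^sup>2 - \<rho>) - c - 2 * d * \<rho> * c * x + d * c\<^sup>2 * x\<^sup>2)"
    proof -
      have "2 * d * \<rho> * c * x \<le> 2 * d * \<rho> * c * s" using x d \<rho> c by (intro mult_left_mono) auto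
      moreover have "0 \<le> d * c\<^sup>2 * x\<^sup>2" using d by simp
      ultimately show ?thesis using small(2) by (intro mult_nonneg_nonneg) auto
    qed
    also have "\<dots> = ?r + d * ?r\<^sup>2 - \<rho> * q x"
      by (simp add: q_def algebra_simps power2_eq_square)
    finally have "\<rho> * q x \<le> ?r + d * ?r\<^sup>2" by simp
    also have "\<dots> \<le> q (R x)"
      unfolding q_def using rR r d by (intro add_mono mult_left_mono power_mono) auto
    finally show ?thesis .
  qed
  have q_mono: "q x \<le> q y" if "0 \<le> x" "x \<le> y" for x y
    unfolding q_def using that d by (intro add_mono mult_left_mono power_mono) auto
  have le_of: "x \<le> y" if "R x \<le> R y" "x \<le> t" for x y
    using that mono[of y x] by (meson not_le_imp_less not_less)
  \<comment> \<open>\<open>near\<close> covers the pieces and their first preimages;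
    \<open>far\<close> covers the second preimages and everything below them, in linearised
    form.\<close>
  define near where "near x \<longleftrightarrow> (\<exists>l0 u0 l1 u1 l2 u2. (l0, u0, l1, u1, l2, u2) \<in> set L \<and>
      (l0 \<le> x \<and> x \<le> u0 \<or> l1 \<le> x \<and> x \<le> u1))" for x
  define far where "far x \<longleftrightarrow> x \<le> s \<and> (\<exists>j l0 u0 l1 u1 l2 u2. (l0, u0, l1, u1, l2, u2) \<in> set L \<and>
      l2 \<le> \<rho> ^ j * x \<and> \<rho> ^ j * q x \<le> q u2)" for x
  \<comment> \<open>R at least doubles a point of the lowest band, so the hypothesis holds for R x
    with N lowered by one; for N = 0 the point would exceed 4/3.\<close>
  have main: "near x \<or> far x" if "x \<in> decimation_tree R" "0 < x" "4 / 3 < 2 ^ N * x" for N x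
    using that
  proof (induction N arbitrary: x)
    case 0
    then show ?case using bnd[of x] by simp
  next
    case (Suc N)
    from cover[OF Suc.prems(1,2)] show ?case
    proof
      assume "\<exists>I\<in>set L. fst I \<le> x \<and> x \<le> fst (snd I)"
      then obtain I where I: "I \<in> set L" "fst I \<le> x" "x \<le> fst (snd I)" by blast
      obtain l0 u0 l1 u1 l2 u2 where "I = (l0, u0, l1, u1, l2, u2)" by (rule prod_cases6)
      with I have "(l0, u0, l1, u1, l2, u2) \<in> set L \<and> l0 \<le> x \<and> x \<le> u0" by simp
      then have "near x" unfolding near_def by blast
      then show ?thesis ..
    next
      assume xt: "x \<le> t"
      have x43: "x \<noteq> 4 / 3" using xt st by simp
      have Rx: "R x \<in> decimation_tree R" using decimation_tree_step[of R, OF R0 Suc.prems(1) x43] .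
      have x2: "2 * x \<le> R x" using grow xt Suc.prems(2) by simp
      have "2 ^ N * (2 * x) \<le> 2 ^ N * R x" using x2 by (intro mult_left_mono) auto
      moreover have "2 ^ Suc N * x = 2 ^ N * (2 * x)" by simp
      ultimately have "4 / 3 < 2 ^ N * R x" using Suc.prems(3) by linarith
      then have "near (R x) \<or> far (R x)" using Suc.IH[OF Rx] x2 Suc.prems(2) by simp
      then show ?thesis
      proof
        assume "near (R x)"
        then obtain l0 u0 l1 u1 l2 u2 where I: "(l0, u0, l1, u1, l2, u2) \<in> set L"
          and or: "l0 \<le> R x \<and> R x \<le> u0 \<or> l1 \<le> R x \<and> R x \<le> u1"
          unfolding near_def by blast
        have b: "R l1 \<le> l0" "u0 \<le> R u1" "R l2 \<le> l1" "u1 \<le> R u2" "0 < l2" "l1 \<le> t" "u1 \<le> t"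
          "l2 \<le> t" "u2 \<le> s"
          using br[OF I] by (simp_all add: branch_bounds_def)
        from or show ?thesis
        proof
          assume "l0 \<le> R x \<and> R x \<le> u0"
          then have "l1 \<le> x" "x \<le> u1" using b xt by (auto intro: le_of)
          then have "near x" using I unfolding near_def by blast
          then show ?thesis ..
        next
          assume "l1 \<le> R x \<and> R x \<le> u1"
          then have *: "l2 \<le> x" "x \<le> u2" using b xt by (auto intro: le_of)
          have "q x \<le> q u2" using * Suc.prems(2) by (intro q_mono) auto
          with * have "l2 \<le> \<rho> ^ 0 * x" "\<rho> ^ 0 * q x \<le> q u2" by simp_all
          moreover have "x \<le> s" using * b(9) by simp
          ultimately have "far x" using I unfolding far_def by blast
          then show ?thesis ..
        qed
      next
        assume "far (R x)"
        then obtain j l0 u0 l1 u1 l2 u2 where Rs: "R x \<le> s" and I: "(l0, u0, l1, u1, l2, u2) \<in> set L"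
          and lo: "l2 \<le> \<rho> ^ j * R x" and hi: "\<rho> ^ j * q (R x) \<le> q u2"
          unfolding far_def by blast
        have xs: "x \<le> s" using x2 Rs Suc.prems(2) by simp
        have "\<rho> ^ j * R x \<le> \<rho> ^ j * (\<rho> * x)"
          using up[of x] xt Suc.prems(2) \<rho> by (intro mult_left_mono) auto
        then have lo': "l2 \<le> \<rho> ^ Suc j * x" using lo by (simp add: mult_ac)
        have "\<rho> ^ j * (\<rho> * q x) \<le> \<rho> ^ j * q (R x)"
          using q_step[of x] xs Suc.prems(2) \<rho> by (intro mult_left_mono) auto
        then have hi': "\<rho> ^ Suc j * q x \<le> q u2" using hi by (simp add: mult_ac)
        have "far x" using I xs lo' hi' unfolding far_def by blast
        then show ?thesis ..
      qed
    qed
  qed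
  \<comment> \<open>Below this bound a point misses the first two intervals of every piece, which
    leaves \<open>far\<close>.\<close>
  define e where "e = Min (insert t ((\<lambda>(l0, u0, l1, u1, l2, u2). min l0 l1) ` set L))"
  have pos: "0 < l0 \<and> 0 < l1" if "(l0, u0, l1, u1, l2, u2) \<in> set L" for l0 u0 l1 u1 l2 u2
  proof -
    have b: "R l1 \<le> l0" "R l2 \<le> l1" "0 < l2" "l1 \<le> t" "l2 \<le> t"
      using br[OF that] by (simp_all add: branch_bounds_def)
    have "0 < R l2" using mono[of 0 l2] b R0 by simp
    then have "0 < l1" using b by simp
    moreover from this have "0 < R l1" using mono[of 0 l1] b R0 by simp
    ultimately show ?thesis using b by simp
  qed
  have e0: "0 < e"
    unfolding e_def using pos st by (subst Min_gr_iff) auto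
  show ?thesis
  proof (intro exI[of _ e] conjI ballI impI)
    show "0 < e" by fact
    fix x assume x: "x \<in> decimation_tree R" "0 < x" "x < e"
    obtain N where "4 / 3 / x < 2 ^ N" using real_arch_pow[of 2 "4 / 3 / x"] by auto
    then have "4 / 3 < 2 ^ N * x" using x(2) by (simp add: field_simps)
    then have "near x \<or> far x" using main x by blast
    moreover have "\<not> near x"
    proof
      assume "near x"
      then obtain l0 u0 l1 u1 l2 u2 where I: "(l0, u0, l1, u1, l2, u2) \<in> set L"
        and or: "l0 \<le> x \<or> l1 \<le> x"
        unfolding near_def by blast
      have "e \<le> min l0 l1" unfolding e_def
        by (intro Min_le insertI2 image_eqI[OF _ I]) simp_all
      then show False using or x(3) by auto
    qed
    ultimately have "far x" by blast
    then obtain j l0 u0 l1 u1 l2 u2 where I: "(l0, u0, l1, u1, l2, u2) \<in> set L"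
      and lo: "l2 \<le> \<rho> ^ j * x" and hi: "\<rho> ^ j * q x \<le> q u2"
      unfolding far_def by blast
    have "\<rho> ^ j * x \<le> \<rho> ^ j * q x" using \<rho> d by (intro mult_left_mono) (auto simp: q_def)
    then have "\<rho> ^ j * x \<le> u2 + d * u2\<^sup>2" using hi by (simp add: q_def)
    moreover have "(l2, u2 + d * u2\<^sup>2) \<in> set (map (scaled_bounds d) L)"
      unfolding set_map by (intro image_eqI[OF _ I]) (simp add: scaled_bounds_def)
    ultimately show "\<exists>j. \<exists>(A, B)\<in>set (map (scaled_bounds d) L). A \<le> \<rho> ^ j * x \<and> \<rho> ^ j * x \<le> B"
      using lo by blast
  qed
qed

text \<open>Used to pass from dyadic endpoints to short decimals before all pairs are
  compared.\<close>

lemma scaled_cover_weaken: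
  fixes L S :: "(real \<times> real) list"
  assumes S: "list_all2 (\<lambda>P Q. fst Q \<le> fst P \<and> snd P \<le> snd Q) L S"
    and cover: "\<exists>e>0. \<forall>x\<in>T. 0 < x \<longrightarrow> x < e \<longrightarrow>
      (\<exists>j. \<exists>(A, B)\<in>set L. A \<le> \<rho> ^ j * x \<and> \<rho> ^ j * x \<le> B)"
  shows "\<exists>e>0. \<forall>x\<in>T. 0 < x \<longrightarrow> x < e \<longrightarrow>
      (\<exists>j. \<exists>(A, B)\<in>set S. A \<le> \<rho> ^ j * x \<and> \<rho> ^ j * x \<le> B)"
proof -
  have weaken: "\<exists>(A', B')\<in>set S. A' \<le> y \<and> y \<le> B'" if P: "(A, B) \<in> set L" "A \<le> y" "y \<le> B" for A B y
  proof -
    obtain i where i: "i < length L" "L ! i = (A, B)" using P(1) by (metis in_set_conv_nth)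
    then have "i < length S" "fst (S ! i) \<le> A" "B \<le> snd (S ! i)"
      using list_all2_lengthD[OF S] list_all2_nthD[OF S i(1)] by simp_all
    then show ?thesis using P by (intro bexI[of _ "S ! i"]) (auto simp: case_prod_beta)
  qed
  obtain e where e: "e > 0" "\<And>x. x \<in> T \<Longrightarrow> 0 < x \<Longrightarrow> x < e \<Longrightarrow>
      (\<exists>j. \<exists>(A, B)\<in>set L. A \<le> \<rho> ^ j * x \<and> \<rho> ^ j * x \<le> B)"
    using cover by blast
  show ?thesis
  proof (intro exI[of _ e] conjI ballI impI e(1))
    fix x assume x: "x \<in> T" "0 < x" "x < e"
    then obtain j A B where "(A, B) \<in> set L" "A \<le> \<rho> ^ j * x" "\<rho> ^ j * x \<le> B"
      using e(2) by blast
    from weaken[OF this] show "\<exists>j. \<exists>(A, B)\<in>set S. A \<le> \<rho> ^ j * x \<and> \<rho> ^ j * x \<le> B" ..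
  qed
qed

text \<open>Squaring removes the roots: every quotient of the two intervals is at most sqrt (rho /
  kappa) or every one is at least sqrt (rho * kappa). The bound \<open>B \<le> \<rho> * A'\<close>
  keeps the intervals within a factor rho.\<close>

definition avoids_sqrt :: "real \<Rightarrow> real \<Rightarrow> real \<times> real \<Rightarrow> real \<times> real \<Rightarrow> bool" where
  "avoids_sqrt \<rho> \<kappa> P Q \<longleftrightarrow> (case P of (A, B) \<Rightarrow> case Q of (A', B') \<Rightarrow>
     0 < A \<and> B \<le> \<rho> * A' \<and> (B\<^sup>2 * \<kappa> \<le> \<rho> * A'\<^sup>2 \<or> \<kappa> * \<rho> * B'\<^sup>2 \<le> A\<^sup>2))"

text \<open>x / y is \<alpha> / \<beta> times the power k - j of rho. As \<alpha> / \<beta> lies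
  between 1/rho and rho, powers other than 0 and 1 give a ratio of at most 1 or at least rho,
  outside the window since kappa is at most rho. For the power 1, r -> rho / r maps the window to
  itself, and the test of the pair in reversed order applies.\<close>

lemma scaled_ratio_gap:
  fixes \<rho> \<kappa> :: real
  assumes \<kappa>: "1 < \<kappa>" "\<kappa> \<le> \<rho>"
    and av: "\<And>P Q. P \<in> set L \<Longrightarrow> Q \<in> set L \<Longrightarrow> avoids_sqrt \<rho> \<kappa> P Q"
    and P: "(A, B) \<in> set L" "A \<le> \<rho> ^ j * x" "\<rho> ^ j * x \<le> B"
    and Q: "(A', B') \<in> set L" "A' \<le> \<rho> ^ k * y" "\<rho> ^ k * y \<le> B'"
    and pos: "0 < x" "0 < y"
  shows "x / y \<notin> {sqrt (\<rho> / \<kappa>)<..<sqrt (\<rho> * \<kappa>)}"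
proof
  assume r: "x / y \<in> {sqrt (\<rho> / \<kappa>)<..<sqrt (\<rho> * \<kappa>)}"
  define r where "r = x / y"
  have \<rho>: "\<rho> > 1" using \<kappa> by simp
  have r0: "r > 0" using pos by (simp add: r_def)
  have x: "x = r * y" using pos by (simp add: r_def)
  have r1: "\<rho> < \<kappa> * r\<^sup>2" and r2: "r\<^sup>2 < \<rho> * \<kappa>"
  proof -
    have "sqrt (\<rho> / \<kappa>) < r" "r < sqrt (\<rho> * \<kappa>)" using r by (auto simp: r_def)
    then have "(sqrt (\<rho> / \<kappa>))\<^sup>2 < r\<^sup>2" "r\<^sup>2 < (sqrt (\<rho> * \<kappa>))\<^sup>2"
      using r0 \<rho> \<kappa> by (intro power_strict_mono; simp)+
    then have "\<rho> / \<kappa> < r\<^sup>2" "r\<^sup>2 < \<rho> * \<kappa>" using \<rho> \<kappa> by simp_all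
    then show "\<rho> < \<kappa> * r\<^sup>2" "r\<^sup>2 < \<rho> * \<kappa>" using \<kappa> by (simp_all add: field_simps)
  qed
  define \<alpha> \<beta> where "\<alpha> = \<rho> ^ j * x" and "\<beta> = \<rho> ^ k * y"
  have \<alpha>: "0 < \<alpha>" and \<beta>: "0 < \<beta>" using pos \<rho> by (simp_all add: \<alpha>_def \<beta>_def)
  have a1: "0 < A" "B \<le> \<rho> * A'" "B\<^sup>2 * \<kappa> \<le> \<rho> * A'\<^sup>2 \<or> \<kappa> * \<rho> * B'\<^sup>2 \<le> A\<^sup>2"
    and a2: "0 < A'" "B' \<le> \<rho> * A" "B'\<^sup>2 * \<kappa> \<le> \<rho> * A\<^sup>2 \<or> \<kappa> * \<rho> * B\<^sup>2 \<le> A'\<^sup>2"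
    using av[OF P(1) Q(1)] av[OF Q(1) P(1)] by (simp_all add: avoids_sqrt_def)
  have ab: "A \<le> \<alpha>" "\<alpha> \<le> B" "A' \<le> \<beta>" "\<beta> \<le> B'" using P Q by (simp_all add: \<alpha>_def \<beta>_def)
  have sq: "A\<^sup>2 \<le> \<alpha>\<^sup>2" "\<alpha>\<^sup>2 \<le> B\<^sup>2" "A'\<^sup>2 \<le> \<beta>\<^sup>2" "\<beta>\<^sup>2 \<le> B'\<^sup>2"
    using ab a1(1) a2(1) by (intro power_mono; simp)+
  have b1: "\<alpha>\<^sup>2 * \<kappa> \<le> \<rho> * \<beta>\<^sup>2 \<or> \<kappa> * \<rho> * \<beta>\<^sup>2 \<le> \<alpha>\<^sup>2"
    using a1(3)
  proof
    assume h: "B\<^sup>2 * \<kappa> \<le> \<rho> * A'\<^sup>2"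
    have "\<alpha>\<^sup>2 * \<kappa> \<le> B\<^sup>2 * \<kappa>" "\<rho> * A'\<^sup>2 \<le> \<rho> * \<beta>\<^sup>2"
      using sq \<kappa> \<rho> by (intro mult_right_mono mult_left_mono; simp)+
    with h show ?thesis by linarith
  next
    assume h: "\<kappa> * \<rho> * B'\<^sup>2 \<le> A\<^sup>2"
    have "\<kappa> * \<rho> * \<beta>\<^sup>2 \<le> \<kappa> * \<rho> * B'\<^sup>2" using sq \<kappa> \<rho> by (intro mult_left_mono) simp_all
    with h sq show ?thesis by linarith
  qed
  have b2: "\<beta>\<^sup>2 * \<kappa> \<le> \<rho> * \<alpha>\<^sup>2 \<or> \<kappa> * \<rho> * \<alpha>\<^sup>2 \<le> \<beta>\<^sup>2"
    using a2(3)
  proof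
    assume h: "B'\<^sup>2 * \<kappa> \<le> \<rho> * A\<^sup>2"
    have "\<beta>\<^sup>2 * \<kappa> \<le> B'\<^sup>2 * \<kappa>" "\<rho> * A\<^sup>2 \<le> \<rho> * \<alpha>\<^sup>2"
      using sq \<kappa> \<rho> by (intro mult_right_mono mult_left_mono; simp)+
    with h show ?thesis by linarith
  next
    assume h: "\<kappa> * \<rho> * B\<^sup>2 \<le> A'\<^sup>2"
    have "\<kappa> * \<rho> * \<alpha>\<^sup>2 \<le> \<kappa> * \<rho> * B\<^sup>2" using sq \<kappa> \<rho> by (intro mult_left_mono) simp_all
    with h sq show ?thesis by linarith
  qed
  have c1: "\<alpha> \<le> \<rho> * \<beta>"
    using ab a1(2) mult_left_mono[OF ab(3), of \<rho>] \<rho> by linarith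
  have c2: "\<beta> \<le> \<rho> * \<alpha>"
    using ab a2(2) mult_left_mono[OF ab(1), of \<rho>] \<rho> by linarith
  consider "k = j" | "k = Suc j" | i where "k = j + 2 + i" | i where "j = k + 1 + i"
  proof -
    consider "k = j" | "k = Suc j" | "j + 2 \<le> k" | "k + 1 \<le> j" by linarith
    then show thesis
      using that le_Suc_ex[of "j + 2" k] le_Suc_ex[of "k + 1" j] by cases blast+
  qed
  then show False
  proof cases
    case 1
    then have "\<alpha> = r * \<beta>" by (simp add: \<alpha>_def \<beta>_def x)
    then have "\<alpha>\<^sup>2 = r\<^sup>2 * \<beta>\<^sup>2" by (simp add: power_mult_distrib)
    moreover have "\<rho> * \<beta>\<^sup>2 < \<kappa> * r\<^sup>2 * \<beta>\<^sup>2" "r\<^sup>2 * \<beta>\<^sup>2 < \<rho> * \<kappa> * \<beta>\<^sup>2"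
      using r1 r2 \<beta> by (intro mult_strict_right_mono; simp)+
    ultimately show False using b1 by (simp add: mult_ac)
  next
    case 2
    then have "\<rho> * \<alpha> = r * \<beta>" by (simp add: \<alpha>_def \<beta>_def x)
    then have "(\<rho> * \<alpha>)\<^sup>2 = (r * \<beta>)\<^sup>2" by simp
    then have e: "\<rho> * (\<rho> * \<alpha>\<^sup>2) = r\<^sup>2 * \<beta>\<^sup>2" by (simp add: power2_eq_square mult_ac)
    have m: "\<rho> * \<beta>\<^sup>2 < \<kappa> * r\<^sup>2 * \<beta>\<^sup>2" "r\<^sup>2 * \<beta>\<^sup>2 < \<rho> * \<kappa> * \<beta>\<^sup>2"
      using r1 r2 \<beta> by (intro mult_strict_right_mono; simp)+
    have "\<rho> * \<beta>\<^sup>2 < \<rho> * (\<kappa> * \<rho> * \<alpha>\<^sup>2)" "\<rho> * (\<rho> * \<alpha>\<^sup>2) < \<rho> * (\<beta>\<^sup>2 * \<kappa>)"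
      using m unfolding mult.assoc[of \<kappa>] e[symmetric] by (simp_all only: mult_ac)
    then show False using b2 \<rho> by simp
  next
    case 3
    then have "\<rho> ^ 2 * \<rho> ^ i * \<alpha> = r * \<beta>"
      by (simp add: \<alpha>_def \<beta>_def x power_add power2_eq_square mult_ac)
    moreover have "\<rho> * (1 * \<beta>) \<le> \<rho> * (\<rho> ^ i * (\<rho> * \<alpha>))"
      using c2 \<rho> \<beta> by (intro mult_left_mono mult_mono one_le_power) auto
    ultimately have "\<rho> * \<beta> \<le> r * \<beta>" by (simp add: power2_eq_square mult_ac)
    then have "\<rho> \<le> r" using \<beta> by simp
    then have "\<rho>\<^sup>2 \<le> r\<^sup>2" using \<rho> by (intro power_mono) auto
    moreover have "\<rho> * \<kappa> \<le> \<rho>\<^sup>2" using \<kappa> \<rho> by (simp add: power2_eq_square)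
    ultimately show False using r2 by linarith
  next
    case 4
    then have "\<alpha> = \<rho> * \<rho> ^ i * (r * \<beta>)" by (simp add: \<alpha>_def \<beta>_def x power_add mult_ac)
    moreover have "\<rho> * (1 * (r * \<beta>)) \<le> \<rho> * (\<rho> ^ i * (r * \<beta>))"
      using r0 \<rho> \<beta> by (intro mult_left_mono mult_right_mono one_le_power) auto
    ultimately have "\<rho> * (r * \<beta>) \<le> \<rho> * \<beta>" using c1 by (simp add: mult_ac)
    then have "r \<le> 1" using \<rho> \<beta> by simp
    then have "r\<^sup>2 \<le> 1" using r0 by (simp add: power_le_one)
    then have "\<kappa> * r\<^sup>2 \<le> \<kappa> * 1" using \<kappa> by (intro mult_left_mono) auto
    then show False using r1 \<kappa> by linarith
  qed
qed

section \<open>From the cover of the tree to ratios of eigenvalues\<close>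

definition small_ratio_gap :: "real \<Rightarrow> real set \<Rightarrow> bool" where
  "small_ratio_gap \<rho> T \<longleftrightarrow> (\<exists>a b e. 0 < a \<and> a < sqrt \<rho> \<and> sqrt \<rho> < b \<and> 0 < e \<and>
     (\<forall>x\<in>T. \<forall>y\<in>T. 0 < x \<longrightarrow> x < e \<longrightarrow> 0 < y \<longrightarrow> y < e \<longrightarrow> x / y \<notin> {a<..<b}))"

lemma small_ratio_gapI:
  fixes \<rho> \<kappa> :: real
  assumes \<kappa>: "1 < \<kappa>" "\<kappa> \<le> \<rho>"
    and av: "\<And>P Q. P \<in> set L \<Longrightarrow> Q \<in> set L \<Longrightarrow> avoids_sqrt \<rho> \<kappa> P Q"
    and cover: "\<exists>e>0. \<forall>x\<in>T. 0 < x \<longrightarrow> x < e \<longrightarrow>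
      (\<exists>j. \<exists>(A, B)\<in>set L. A \<le> \<rho> ^ j * x \<and> \<rho> ^ j * x \<le> B)"
  shows "small_ratio_gap \<rho> T"
proof -
  obtain e where e: "e > 0" "\<And>x. x \<in> T \<Longrightarrow> 0 < x \<Longrightarrow> x < e \<Longrightarrow>
      (\<exists>j. \<exists>(A, B)\<in>set L. A \<le> \<rho> ^ j * x \<and> \<rho> ^ j * x \<le> B)"
    using cover by blast
  have "\<rho> / \<kappa> < \<rho>" "\<rho> < \<rho> * \<kappa>" "0 < \<rho> / \<kappa>" using \<kappa> by (simp_all add: field_simps)
  moreover have "x / y \<notin> {sqrt (\<rho> / \<kappa>)<..<sqrt (\<rho> * \<kappa>)}"
    if xy: "x \<in> T" "y \<in> T" "0 < x" "x < e" "0 < y" "y < e" for x y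
  proof -
    obtain j A B where "(A, B) \<in> set L" "A \<le> \<rho> ^ j * x" "\<rho> ^ j * x \<le> B"
      using e(2)[OF xy(1,3,4)] by blast
    moreover obtain k A' B' where "(A', B') \<in> set L" "A' \<le> \<rho> ^ k * y" "\<rho> ^ k * y \<le> B'"
      using e(2)[OF xy(2,5,6)] by blast
    ultimately show ?thesis using scaled_ratio_gap[OF \<kappa> av] xy(3,5) by blast
  qed
  ultimately show ?thesis
    unfolding small_ratio_gap_def using e(1)
    by (intro exI[of _ "sqrt (\<rho> / \<kappa>)"] exI[of _ "sqrt (\<rho> * \<kappa>)"] exI[of _ e]) auto
qed

text \<open>Both eigenvalues are approximated by rho^k x and rho^k y with the same large k; then x
  and y are small and x / y falls into the same open window.\<close>

lemma neumann_ratio_gap: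
  assumes n: "n \<ge> 2" and gap: "small_ratio_gap (rho n) (decimation_tree (decimation_map n))"
    and nonneg: "\<And>x. x \<in> decimation_tree (decimation_map n) \<Longrightarrow> 0 \<le> x"
  shows "\<exists>a b :: real. a < sqrt (rho n) \<and> sqrt (rho n) < b \<and>
    (\<forall>l m. neumann_eigenvalue n l \<and> l \<noteq> 0 \<and> neumann_eigenvalue n m \<and> m \<noteq> 0
       \<longrightarrow> l / m \<notin> {a<..<b})"
proof -
  let ?T = "decimation_tree (decimation_map n)"
  obtain a b e0 where ab: "0 < a" "a < sqrt (rho n)" "sqrt (rho n) < b" "0 < e0"
    and T: "\<And>x y. x \<in> ?T \<Longrightarrow> y \<in> ?T \<Longrightarrow> 0 < x \<Longrightarrow> x < e0 \<Longrightarrow> 0 < y \<Longrightarrow> y < e0 \<Longrightarrow> x / y \<notin> {a<..<b}"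
    using gap unfolding small_ratio_gap_def by blast
  have "1 * 1 < (4 * real n - 3) * (2 * real n - 1)" using n by (intro mult_strict_mono) auto
  then have rho: "rho n > 1" by (simp add: rho_def)
  have approx: "\<exists>M. \<forall>m\<ge>M. \<exists>x\<in>?T. \<bar>rho n ^ m * x - l\<bar> < e"
    if "neumann_eigenvalue n l" "e > 0" for l e
    using neumann_eigenvalue_approx[OF n that] is_eig_in_tree[OF n] by blast
  have nonneg_ev: "0 \<le> l" if ev: "neumann_eigenvalue n l" for l
  proof (rule ccontr)
    assume "\<not> 0 \<le> l"
    then obtain m x where x: "x \<in> ?T" "\<bar>rho n ^ m * x - l\<bar> < - l" using approx[OF ev, of "- l"] by auto
    have "0 \<le> rho n ^ m * x" using nonneg[OF x(1)] rho by simp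
    then show False using x(2) by linarith
  qed
  have "l / m \<notin> {a<..<b}"
    if ev: "neumann_eigenvalue n l" "l \<noteq> 0" "neumann_eigenvalue n m" "m \<noteq> 0" for l m
  proof
    assume "l / m \<in> {a<..<b}"
    have lm: "0 < l" "0 < m" using nonneg_ev ev by force+
    have 1: "a * m < l" "l < b * m" using \<open>l / m \<in> {a<..<b}\<close> lm by (auto simp: field_simps)
    have b: "0 < b" using ab by simp
    \<comment> \<open>The halves keep the approximants positive; the quotients let
      \<open>a * m < l\<close> and \<open>l < b * m\<close> survive an error \<open>e\<close> in
      both numbers.\<close>
    define e where "e = min (min (l / 2) (m / 2)) (min ((l - a * m) / (1 + a)) ((b * m - l) / (1 + b)))"
    have e: "0 < e" using lm 1 ab b by (simp add: e_def)
    have "e \<le> (l - a * m) / (1 + a)" "e \<le> (b * m - l) / (1 + b)"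
      unfolding e_def min_le_iff_disj by simp_all
    then have e1: "a * (m + e) \<le> l - e" "l + e \<le> b * (m - e)"
      using ab b by (simp_all add: field_simps)
    have e2: "e \<le> l / 2" "e \<le> m / 2" unfolding e_def min_le_iff_disj by simp_all
    obtain M1 where M1: "\<And>k. k \<ge> M1 \<Longrightarrow> \<exists>x\<in>?T. \<bar>rho n ^ k * x - l\<bar> < e"
      using approx[OF ev(1) e] by blast
    obtain M2 where M2: "\<And>k. k \<ge> M2 \<Longrightarrow> \<exists>x\<in>?T. \<bar>rho n ^ k * x - m\<bar> < e"
      using approx[OF ev(3) e] by blast
    \<comment> \<open>From this level on both tree points are below \<open>e0\<close>.\<close>
    obtain M3 where M3: "(l + m + e) / e0 < rho n ^ M3" using real_arch_pow[OF rho] by blast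
    obtain k where k: "M1 \<le> k" "M2 \<le> k" "M3 \<le> k"
      using that[of "max M1 (max M2 M3)"] by simp
    obtain x where x: "x \<in> ?T" "\<bar>rho n ^ k * x - l\<bar> < e" using M1[OF k(1)] by blast
    obtain y where y: "y \<in> ?T" "\<bar>rho n ^ k * y - m\<bar> < e" using M2[OF k(2)] by blast
    have p: "0 < rho n ^ k" using rho by simp
    have "rho n ^ M3 \<le> rho n ^ k" using rho by (intro power_increasing k(3)) simp
    then have "(l + m + e) / e0 < rho n ^ k" using M3 by linarith
    then have big: "l + m + e < rho n ^ k * e0" using ab(4) by (simp add: field_simps)
    have X: "l - e < rho n ^ k * x" "rho n ^ k * x < l + e" using x(2) by linarith+
    have Y: "m - e < rho n ^ k * y" "rho n ^ k * y < m + e" using y(2) by linarith+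
    have "0 < rho n ^ k * x" "0 < rho n ^ k * y" using X(1) Y(1) e2 lm by linarith+
    then have x0: "0 < x" and y0: "0 < y" using p by (simp_all only: zero_less_mult_pos)
    have "rho n ^ k * x < rho n ^ k * e0" "rho n ^ k * y < rho n ^ k * e0"
      using X(2) Y(2) big lm e by linarith+
    then have "x < e0" "y < e0" using mult_less_cancel_left_pos[OF p] by blast+
    then have "x / y \<notin> {a<..<b}" using T[OF x(1) y(1)] x0 y0 by blast
    moreover have "a * (rho n ^ k * y) < rho n ^ k * x" "rho n ^ k * x < b * (rho n ^ k * y)"
    proof -
      have "a * (rho n ^ k * y) < a * (m + e)" using Y(2) ab(1) by simp
      then show "a * (rho n ^ k * y) < rho n ^ k * x" using X(1) e1(1) by linarith
      have "b * (m - e) < b * (rho n ^ k * y)" using Y(1) b by simp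
      then show "rho n ^ k * x < b * (rho n ^ k * y)" using X(2) e1(2) by linarith
    qed
    then have "rho n ^ k * (a * y) < rho n ^ k * x" "rho n ^ k * x < rho n ^ k * (b * y)"
      by (simp_all add: mult_ac)
    then have "a * y < x" "x < b * y" using p by simp_all
    then have "x / y \<in> {a<..<b}" using y0 by (simp add: field_simps)
    ultimately show False by contradiction
  qed
  then show ?thesis using ab by blast
qed

section \<open>The decimation tree for n = 2\<close>

text \<open>In factored form x (6x - 3) (6x - 5), that is \<lambda> g_2 h_2, with slope rho = 15 at
  0.\<close>

definition dec_poly2 :: "real \<Rightarrow> real" where
  "dec_poly2 x = 15 * x - 48 * x ^ 2 + 36 * x ^ 3"

lemma decimation_map_2: "decimation_map 2 = dec_poly2"
proof
  fix x
  have c: "chain x (2 - 1) a v = chain x (Suc 0) a v" for a v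
    by (simp add: numeral_eq_Suc)
  show "decimation_map 2 x = dec_poly2 x"
    unfolding decimation_map_def neck_def c dec_poly2_def
    by (simp add: Let_def field_simps) algebra
qed

lemma dec_poly2_0: "dec_poly2 0 = 0"
  by (simp add: dec_poly2_def)

section \<open>Monotone branches of the cubic and its values near the critical points\<close>

lemma dec_poly2_has_derivative: "(dec_poly2 has_real_derivative 15 - 96 * x + 108 * x ^ 2) (at x)"
  unfolding dec_poly2_def by (auto intro!: derivative_eq_intros)

text \<open>
  Positivity of a polynomial on an interval \<open>[a, b]\<close> is certified by an expansion in \<open>x - a\<close> and
  \<open>b - x\<close> (its Bernstein form) with nonnegative coefficients, after subtraction of a small constant.
\<close>

lemma dec_poly2_deriv_pos_1:
  fixes x :: real
  assumes "x \<le> 9 / 50"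
  shows "0 < 15 - 96 * x + 108 * x ^ 2"
proof -
  have y: "0 \<le> 9 - 50 * x" using assms by simp
  have "0 < 762 + 714 * (9 - 50 * x) + 27 * (9 - 50 * x) ^ 2"
    by (intro add_pos_nonneg mult_nonneg_nonneg zero_le_power y) simp_all
  also have "\<dots> = 625 * (15 - 96 * x + 108 * x ^ 2)"
    by algebra
  finally show ?thesis by simp
qed

lemma dec_poly2_deriv_pos_3:
  fixes x :: real
  assumes "4 / 5 \<le> x"
  shows "0 < 15 - 96 * x + 108 * x ^ 2"
proof -
  have y: "0 \<le> 5 * x - 4" using assms by simp
  have "0 < 183 + 384 * (5 * x - 4) + 108 * (5 * x - 4) ^ 2"
    by (intro add_pos_nonneg mult_nonneg_nonneg zero_le_power y) simp_all
  also have "\<dots> = 25 * (15 - 96 * x + 108 * x ^ 2)"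
    by algebra
  finally show ?thesis by simp
qed

lemma dec_poly2_mono_1: "x < y \<Longrightarrow> y \<le> 9 / 50 \<Longrightarrow> dec_poly2 x < dec_poly2 y"
  by (rule deriv_pos_less[where a = x and b = y, OF dec_poly2_has_derivative]) (auto intro: dec_poly2_deriv_pos_1)

lemma dec_poly2_mono_3: "4 / 5 \<le> x \<Longrightarrow> x < y \<Longrightarrow> dec_poly2 x < dec_poly2 y"
  by (rule deriv_pos_less[where a = x and b = y, OF dec_poly2_has_derivative]) (auto intro: dec_poly2_deriv_pos_3)

lemma dec_poly2_deriv_neg_2:
  fixes x :: real
  assumes "11 / 50 \<le> x" "x \<le> 3 / 5"
  shows "0 < - (15 - 96 * x + 108 * x ^ 2)"
proof -
  have y: "0 \<le> 50 * x - 11" "0 \<le> 30 - 50 * x" using assms by simp_all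
  have "0 \<le> 991 * (30 - 50 * x) ^ 2
      + 25010 * (50 * x - 11) * (30 - 50 * x)
      + 4525 * (50 * x - 11) ^ 2"
    by (intro add_nonneg_nonneg mult_nonneg_nonneg zero_le_power y) simp_all
  also have "\<dots> = 451250 * (- (15 - 96 * x + 108 * x ^ 2)) - 45125"
    by algebra
  finally show ?thesis by simp
qed

lemma dec_poly2_mono_2: "11 / 50 \<le> x \<Longrightarrow> x < y \<Longrightarrow> y \<le> 3 / 5 \<Longrightarrow> dec_poly2 y < dec_poly2 x"
  by (rule deriv_neg_less[OF dec_poly2_has_derivative dec_poly2_deriv_neg_2[unfolded neg_0_less_iff_less]])

text \<open>The critical points are (8 - sqrt 19)/18 and (8 + sqrt 19)/18, about 0.202 and 0.687.
  The intervals [9/50, 11/50] and [3/5, 4/5] enclose them and separate the monotone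
  branches.\<close>

lemma dec_poly2_above_1:
  fixes x :: real
  assumes "9 / 50 \<le> x" "x \<le> 11 / 50"
  shows "0 < 15 * x - 48 * x ^ 2 + 36 * x ^ 3 - 4 / 3"
proof -
  have y: "0 \<le> 50 * x - 9" "0 \<le> 11 - 50 * x" using assms by simp_all
  have "0 \<le> 2141 * (11 - 50 * x) ^ 3
      + 15567 * (50 * x - 9) * (11 - 50 * x) ^ 2
      + 16143 * (50 * x - 9) ^ 2 * (11 - 50 * x)
      + 3149 * (50 * x - 9) ^ 3"
    by (intro add_nonneg_nonneg mult_nonneg_nonneg zero_le_power y) simp_all
  also have "\<dots> = 1500000 * (15 * x - 48 * x ^ 2 + 36 * x ^ 3 - 4 / 3) - 15000"
    by algebra
  finally show ?thesis by simp
qed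

lemma dec_poly2_below_2:
  fixes x :: real
  assumes "3 / 5 \<le> x" "x \<le> 4 / 5"
  shows "0 < - (15 * x - 48 * x ^ 2 + 36 * x ^ 3)"
proof -
  have y: "0 \<le> 5 * x - 3" "0 \<le> 4 - 5 * x" using assms by simp_all
  have "0 \<le> 101 * (4 - 5 * x) ^ 3
      + 489 * (5 * x - 3) * (4 - 5 * x) ^ 2
      + 507 * (5 * x - 3) ^ 2 * (4 - 5 * x)
      + 47 * (5 * x - 3) ^ 3"
    by (intro add_nonneg_nonneg mult_nonneg_nonneg zero_le_power y) simp_all
  also have "\<dots> = 250 * (- (15 * x - 48 * x ^ 2 + 36 * x ^ 3)) - 25"
    by algebra
  finally show ?thesis by simp
qed

section \<open>Bands and gaps of the tree for n = 2\<close>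

lemma dec_poly2_tree_bounds: "x \<in> decimation_tree dec_poly2 \<Longrightarrow> 0 \<le> x \<and> x \<le> 4 / 3"
  by (rule decimation_tree_bounds[where R = dec_poly2 and t = "9 / 50" and s = "4 / 5",
        OF dec_poly2_0 _ _ dec_poly2_mono_1 dec_poly2_mono_3])
    (simp_all add: dec_poly2_def power_divide)

text \<open>The number 1000000 stands for infinity: pulling a gap back needs finite ends that the
  values of R on the flanks do not exceed.\<close>

lemma dec_poly2_gap_bottom: "gap (decimation_tree dec_poly2) (- 1000000) 0"
  and dec_poly2_gap_top: "gap (decimation_tree dec_poly2) (4 / 3) 1000000"
  using dec_poly2_tree_bounds unfolding gap_def by auto

lemma dec_poly2_gap_closed_1: "9 / 50 \<le> x \<Longrightarrow> x \<le> 11 / 50 \<Longrightarrow> x \<notin> decimation_tree dec_poly2"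
  using dec_poly2_above_1[of x] decimation_tree_step[of dec_poly2 x, OF dec_poly2_0] dec_poly2_tree_bounds[of "dec_poly2 x"]
  by (auto simp: dec_poly2_def)

lemma dec_poly2_gap_closed_2: "3 / 5 \<le> x \<Longrightarrow> x \<le> 4 / 5 \<Longrightarrow> x \<notin> decimation_tree dec_poly2"
  using dec_poly2_below_2[of x] decimation_tree_step[of dec_poly2 x, OF dec_poly2_0] dec_poly2_tree_bounds[of "dec_poly2 x"]
  by (auto simp: dec_poly2_def)

text \<open>The lowest band ends at 1/6, where R is 4/3; the left number is 1/6 rounded up to a
  multiple of 2^-24. The -1 only closes the half-line on which R increases.\<close>

lemma dec_poly2_gap_1_left: "gap (decimation_tree dec_poly2) (2796203 / 16777216) (9 / 50)"
  by (rule gap_increasing[of dec_poly2 "(- 1)" "9 / 50", OF dec_poly2_0 dec_poly2_mono_1 dec_poly2_gap_top])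
    (simp_all add: dec_poly2_def power_divide)

lemma dec_poly2_gap_1_right: "gap (decimation_tree dec_poly2) (11 / 50) (4022189 / 16777216)"
  by (rule gap_decreasing[of dec_poly2 "11 / 50" "3 / 5", OF dec_poly2_0 dec_poly2_mono_2 dec_poly2_gap_top])
    (simp_all add: dec_poly2_def power_divide)

lemma dec_poly2_gap_1: "gap (decimation_tree dec_poly2) (2796203 / 16777216) (4022189 / 16777216)"
  by (rule gap_join[OF dec_poly2_gap_1_left dec_poly2_gap_closed_1 dec_poly2_gap_1_right])

lemma dec_poly2_gap_2_left: "gap (decimation_tree dec_poly2) (8388609 / 16777216) (3 / 5)"
  by (rule gap_decreasing[of dec_poly2 "11 / 50" "3 / 5", OF dec_poly2_0 dec_poly2_mono_2 dec_poly2_gap_bottom])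
    (simp_all add: dec_poly2_def power_divide)

lemma dec_poly2_gap_2_right: "gap (decimation_tree dec_poly2) (4 / 5) (13981013 / 16777216)"
  by (rule gap_increasing[of dec_poly2 "4 / 5" "4 / 3", OF dec_poly2_0 dec_poly2_mono_3 dec_poly2_gap_bottom])
    (simp_all add: dec_poly2_def power_divide)

lemma dec_poly2_gap_2: "gap (decimation_tree dec_poly2) (8388609 / 16777216) (13981013 / 16777216)"
  by (rule gap_join[OF dec_poly2_gap_2_left dec_poly2_gap_closed_2 dec_poly2_gap_2_right])

lemma dec_poly2_gap_3: "gap (decimation_tree dec_poly2) (15551229 / 16777216) (4 / 3)"
  by (rule gap_increasing[of dec_poly2 "4 / 5" "4 / 3", OF dec_poly2_0 dec_poly2_mono_3 dec_poly2_gap_top])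
    (simp_all add: dec_poly2_def power_divide)

text \<open>
  The gap \<open>i\<close> lies above the band \<open>i\<close>, and the gap \<open>i_g\<close> is the preimage of the gap \<open>g\<close> under
  the \<open>i\<close>-th inverse branch.
\<close>

lemma dec_poly2_gap_2_3: "gap (decimation_tree dec_poly2) (2011095 / 8388608) (2914939 / 8388608)"
  by (rule gap_decreasing[of dec_poly2 "11 / 50" "3 / 5", OF dec_poly2_0 dec_poly2_mono_2 dec_poly2_gap_3])
    (simp_all add: dec_poly2_def power_divide)

text \<open>All endpoints are rounded outwards to dyadic rationals.\<close>

definition dec_poly2_pieces :: "(real \<times> real \<times> real \<times> real \<times> real \<times> real) list" where
  "dec_poly2_pieces = [
    (4022189 / 16777216, 2011095 / 8388608, 566511 / 33554432, 2266045 / 134217728, 9703501 / 8589934592, 38814023 / 34359738368),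
    (2914939 / 8388608, 8388609 / 16777216, 6751707 / 268435456, 10138477 / 268435456, 14481669 / 8589934592, 43611089 / 17179869184),
    (13981013 / 16777216, 15551229 / 16777216, 4744893 / 67108864, 11002919 / 134217728, 164469209 / 34359738368, 191172651 / 34359738368),
    (4 / 3, 4 / 3, 22369621 / 134217728, 44739243 / 268435456, 198136573 / 17179869184, 99068289 / 8589934592)]"

lemma dec_poly2_cover:
  assumes "x \<in> decimation_tree dec_poly2"
  shows "x \<le> 9 / 50 \<or> (\<exists>I\<in>set dec_poly2_pieces. fst I \<le> x \<and> x \<le> fst (snd I))"
proof -
  have "x \<le> 2796203 / 16777216 \<or> (4022189 / 16777216 \<le> x \<and> x \<le> 2011095 / 8388608) \<or>
    (2914939 / 8388608 \<le> x \<and> x \<le> 8388609 / 16777216) \<or>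
    (13981013 / 16777216 \<le> x \<and> x \<le> 15551229 / 16777216) \<or> (4 / 3 \<le> x \<and> x \<le> 4 / 3)"
    using conjunct2[OF dec_poly2_tree_bounds[OF assms]]
      dec_poly2_gap_1[THEN gapD, OF assms]
      dec_poly2_gap_2_3[THEN gapD, OF assms]
      dec_poly2_gap_2[THEN gapD, OF assms]
      dec_poly2_gap_3[THEN gapD, OF assms]
    by blast
  moreover have "x \<le> 2796203 / 16777216 \<Longrightarrow> x \<le> 9 / 50" by simp
  ultimately show ?thesis
    unfolding dec_poly2_pieces_def list.set bex_simps fst_conv snd_conv by blast
qed

section \<open>Estimates near 0 and comparison of the pieces for n = 2\<close>

lemma dec_poly2_up_aux:
  fixes x :: real
  assumes "0 \<le> x" "x \<le> 9 / 50"
  shows "0 < 48 - 36 * x"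
proof -
  have y: "0 \<le> 50 * x" "0 \<le> 9 - 50 * x" using assms by simp_all
  have "0 \<le> 1175 * (9 - 50 * x)
      + 1013 * (50 * x)"
    by (intro add_nonneg_nonneg mult_nonneg_nonneg zero_le_power y) simp_all
  also have "\<dots> = 225 * (48 - 36 * x) - 225"
    by algebra
  finally show ?thesis by simp
qed

lemma dec_poly2_grow_aux:
  fixes x :: real
  assumes "0 \<le> x" "x \<le> 9 / 50"
  shows "0 < 13 - 48 * x + 36 * x ^ 2"
proof -
  have y: "0 \<le> 50 * x" "0 \<le> 9 - 50 * x" using assms by simp_all
  have "0 \<le> 2500 * (9 - 50 * x) ^ 2
      + 3200 * (50 * x) * (9 - 50 * x)
      + 943 * (50 * x) ^ 2"
    by (intro add_nonneg_nonneg mult_nonneg_nonneg zero_le_power y) simp_all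
  also have "\<dots> = 16875 * (13 - 48 * x + 36 * x ^ 2) - 16875"
    by algebra
  finally show ?thesis by simp
qed

lemma dec_poly2_estimates:
  assumes x: "0 \<le> x" "x \<le> 9 / 50"
  shows "dec_poly2 x \<le> 15 * x" "2 * x \<le> dec_poly2 x" "15 * x - 48 * x\<^sup>2 \<le> dec_poly2 x"
proof -
  have "15 * x - dec_poly2 x = x\<^sup>2 * (48 - 36 * x)"
    unfolding dec_poly2_def by algebra
  then show "dec_poly2 x \<le> 15 * x"
    using mult_nonneg_nonneg[OF zero_le_power2[of x] less_imp_le[OF dec_poly2_up_aux[OF x]]] by linarith
  have "dec_poly2 x - 2 * x = x * (13 - 48 * x + 36 * x ^ 2)"
    unfolding dec_poly2_def by algebra
  then show "2 * x \<le> dec_poly2 x"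
    using mult_nonneg_nonneg[OF x(1) less_imp_le[OF dec_poly2_grow_aux[OF x]]] by linarith
  have low: "0 \<le> (36 :: real)"
    by simp
  have "dec_poly2 x - (15 * x - 48 * x\<^sup>2) = x ^ 3 * (36)"
    unfolding dec_poly2_def by algebra
  then show "15 * x - 48 * x\<^sup>2 \<le> dec_poly2 x"
    using mult_nonneg_nonneg[OF zero_le_power[OF x(1), of 3] low] by linarith
qed

text \<open>Puts values at rational points over one denominator, so that the checks of the pieces
  become integer comparisons.\<close>

lemma dec_poly2_fraction:
  fixes a b :: real
  assumes "b \<noteq> 0"
  shows "dec_poly2 (a / b) = (15 * a * b ^ 2 - 48 * a ^ 2 * b + 36 * a ^ 3) / b ^ 3"
  using assms by (simp add: dec_poly2_def field_simps eval_nat_numeral)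

text \<open>The bound 9/50 lies between the end of the lowest band and the first critical point;
  577/50000 lies just above the largest \<open>u2\<close>, which comes from the piece 4/3.\<close>

lemma dec_poly2_branch_bounds: "list_all (branch_bounds dec_poly2 (9 / 50) (577 / 50000)) dec_poly2_pieces"
  unfolding dec_poly2_pieces_def
  by (simp add: branch_bounds_def dec_poly2_fraction)

text \<open>Divided by sqrt 15, the fourth interval falls between the second and the third, and the
  third between the first and the second; this is what the gaps 2 and 2_3 are for.\<close>

definition dec_poly2_bounds :: "(real \<times> real) list" where
  "dec_poly2_bounds = [
    (112 / 100000, 113 / 100000),
    (168 / 100000, 255 / 100000),
    (478 / 100000, 558 / 100000),
    (1153 / 100000, 1157 / 100000)]"

text \<open>The value 1/4 exceeds 48 / (15^2 - 15) = 8/35 by enough for the smallness condition of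
  \<open>scaled_cover\<close>.\<close>

lemma dec_poly2_bounds: "list_all2 (\<lambda>P Q. fst Q \<le> fst P \<and> snd P \<le> snd Q)
    (map (scaled_bounds (1 / 4)) dec_poly2_pieces) dec_poly2_bounds"
  unfolding dec_poly2_pieces_def dec_poly2_bounds_def
  by (simp add: scaled_bounds_def power_divide)

lemma dec_poly2_avoids:
  "P \<in> set dec_poly2_bounds \<Longrightarrow> Q \<in> set dec_poly2_bounds \<Longrightarrow> avoids_sqrt 15 (21 / 20) P Q"
proof -
  have "list_all (\<lambda>P. list_all (avoids_sqrt 15 (21 / 20) P) dec_poly2_bounds) dec_poly2_bounds"
    unfolding dec_poly2_bounds_def
    by (simp add: avoids_sqrt_def power_divide)
  then show "P \<in> set dec_poly2_bounds \<Longrightarrow> Q \<in> set dec_poly2_bounds \<Longrightarrow> avoids_sqrt 15 (21 / 20) P Q"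
    unfolding list_all_iff by blast
qed

lemma dec_poly2_ratio_gap: "small_ratio_gap 15 (decimation_tree dec_poly2)"
proof (rule small_ratio_gapI[OF _ _ dec_poly2_avoids scaled_cover_weaken[OF dec_poly2_bounds]])
  show "\<exists>e>0. \<forall>x\<in>decimation_tree dec_poly2. 0 < x \<longrightarrow> x < e \<longrightarrow>
    (\<exists>j. \<exists>(A, B)\<in>set (map (scaled_bounds (1 / 4)) dec_poly2_pieces). A \<le> 15 ^ j * x \<and> 15 ^ j * x \<le> B)"
    by (rule scaled_cover[where R = dec_poly2 and t = "9 / 50" and s = "577 / 50000" and c = 48 and \<rho> = 15,
          OF dec_poly2_0 _ _ _ _ _ _ dec_poly2_mono_1 dec_poly2_estimates])
      (use dec_poly2_tree_bounds dec_poly2_cover dec_poly2_branch_bounds[unfolded list_all_iff] in \<open>simp_all add: power2_eq_square\<close>)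
qed simp_all

section \<open>The decimation tree for n = 3\<close>

text \<open>In factored form x (36x^2 - 30x + 5) (36x^2 - 42x + 9), that is \<lambda> g_3
  h_3.\<close>

definition dec_poly3 :: "real \<Rightarrow> real" where
  "dec_poly3 x = 45 * x - 480 * x ^ 2 + 1764 * x ^ 3 - 2592 * x ^ 4 + 1296 * x ^ 5"

lemma decimation_map_3: "decimation_map 3 = dec_poly3"
proof
  fix x
  have c: "chain x (3 - 1) a v = chain x (Suc (Suc 0)) a v" for a v
    by (simp add: numeral_eq_Suc)
  show "decimation_map 3 x = dec_poly3 x"
    unfolding decimation_map_def neck_def c dec_poly3_def
    by (simp add: Let_def field_simps) algebra
qed

lemma dec_poly3_0: "dec_poly3 0 = 0"
  by (simp add: dec_poly3_def)

section \<open>Monotone branches of the quintic and its values near critical points\<close>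

lemma dec_poly3_has_derivative: "(dec_poly3 has_real_derivative 45 - 960 * x + 5292 * x ^ 2 - 10368 * x ^ 3 + 6480 * x ^ 4) (at x)"
  unfolding dec_poly3_def by (auto intro!: derivative_eq_intros)

lemma dec_poly3_deriv_pos_1:
  fixes x :: real
  assumes "x \<le> 13 / 200"
  shows "0 < 45 - 960 * x + 5292 * x ^ 2 - 10368 * x ^ 3 + 6480 * x ^ 4"
proof -
  have y: "0 \<le> 13 - 200 * x" using assms by simp
  have "0 < 44541201 + 39633612 * (13 - 200 * x) + 1717254 * (13 - 200 * x) ^ 2 + 21708 * (13 - 200 * x) ^ 3 + 81 * (13 - 200 * x) ^ 4"
    by (intro add_pos_nonneg mult_nonneg_nonneg zero_le_power y) simp_all
  also have "\<dots> = 20000000 * (45 - 960 * x + 5292 * x ^ 2 - 10368 * x ^ 3 + 6480 * x ^ 4)"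
    by algebra
  finally show ?thesis by simp
qed

lemma dec_poly3_deriv_pos_5:
  fixes x :: real
  assumes "17 / 20 \<le> x"
  shows "0 < 45 - 960 * x + 5292 * x ^ 2 - 10368 * x ^ 3 + 6480 * x ^ 4"
proof -
  have y: "0 \<le> 20 * x - 17" using assms by simp
  have "0 < 135645 + 148188 * (20 * x - 17) + 34722 * (20 * x - 17) ^ 2 + 2916 * (20 * x - 17) ^ 3 + 81 * (20 * x - 17) ^ 4"
    by (intro add_pos_nonneg mult_nonneg_nonneg zero_le_power y) simp_all
  also have "\<dots> = 2000 * (45 - 960 * x + 5292 * x ^ 2 - 10368 * x ^ 3 + 6480 * x ^ 4)"
    by algebra
  finally show ?thesis by simp
qed

lemma dec_poly3_mono_1: "x < y \<Longrightarrow> y \<le> 13 / 200 \<Longrightarrow> dec_poly3 x < dec_poly3 y"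
  by (rule deriv_pos_less[where a = x and b = y, OF dec_poly3_has_derivative]) (auto intro: dec_poly3_deriv_pos_1)

lemma dec_poly3_mono_5: "17 / 20 \<le> x \<Longrightarrow> x < y \<Longrightarrow> dec_poly3 x < dec_poly3 y"
  by (rule deriv_pos_less[where a = x and b = y, OF dec_poly3_has_derivative]) (auto intro: dec_poly3_deriv_pos_5)

lemma dec_poly3_deriv_neg_2:
  fixes x :: real
  assumes "3 / 40 \<le> x" "x \<le> 1 / 4"
  shows "0 < - (45 - 960 * x + 5292 * x ^ 2 - 10368 * x ^ 3 + 6480 * x ^ 4)"
proof -
  have y: "0 \<le> 40 * x - 3" "0 \<le> 10 - 40 * x" using assms by simp_all
  have "0 \<le> 41647 * (10 - 40 * x) ^ 4
      + 2015848 * (40 * x - 3) * (10 - 40 * x) ^ 3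
      + 2683320 * (40 * x - 3) ^ 2 * (10 - 40 * x) ^ 2
      + 930400 * (40 * x - 3) ^ 3 * (10 - 40 * x)
      + 26800 * (40 * x - 3) ^ 4"
    by (intro add_nonneg_nonneg mult_nonneg_nonneg zero_le_power y) simp_all
  also have "\<dots> = 76832000 * (- (45 - 960 * x + 5292 * x ^ 2 - 10368 * x ^ 3 + 6480 * x ^ 4)) - 7683200"
    by algebra
  finally show ?thesis by simp
qed

lemma dec_poly3_mono_2: "3 / 40 \<le> x \<Longrightarrow> x < y \<Longrightarrow> y \<le> 1 / 4 \<Longrightarrow> dec_poly3 y < dec_poly3 x"
  by (rule deriv_neg_less[OF dec_poly3_has_derivative dec_poly3_deriv_neg_2[unfolded neg_0_less_iff_less]])

lemma dec_poly3_deriv_pos_3: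
  fixes x :: real
  assumes "27 / 100 \<le> x" "x \<le> 9 / 20"
  shows "0 < 45 - 960 * x + 5292 * x ^ 2 - 10368 * x ^ 3 + 6480 * x ^ 4"
proof -
  have y: "0 \<le> 100 * x - 27" "0 \<le> 45 - 100 * x" using assms by simp_all
  have "0 \<le> 2313541 * (45 - 100 * x) ^ 4
      + 40840060 * (100 * x - 27) * (45 - 100 * x) ^ 3
      + 97633950 * (100 * x - 27) ^ 2 * (45 - 100 * x) ^ 2
      + 57437500 * (100 * x - 27) ^ 3 * (45 - 100 * x)
      + 6833125 * (100 * x - 27) ^ 4"
    by (intro add_nonneg_nonneg mult_nonneg_nonneg zero_le_power y) simp_all
  also have "\<dots> = 131220000000 * (45 - 960 * x + 5292 * x ^ 2 - 10368 * x ^ 3 + 6480 * x ^ 4) - 13122000000"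
    by algebra
  finally show ?thesis by simp
qed

lemma dec_poly3_mono_3: "27 / 100 \<le> x \<Longrightarrow> x < y \<Longrightarrow> y \<le> 9 / 20 \<Longrightarrow> dec_poly3 x < dec_poly3 y"
  by (rule deriv_pos_less[OF dec_poly3_has_derivative dec_poly3_deriv_pos_3])

lemma dec_poly3_deriv_neg_4:
  fixes x :: real
  assumes "1 / 2 \<le> x" "x \<le> 7 / 10"
  shows "0 < - (45 - 960 * x + 5292 * x ^ 2 - 10368 * x ^ 3 + 6480 * x ^ 4)"
proof -
  have y: "0 \<le> 10 * x - 5" "0 \<le> 7 - 10 * x" using assms by simp_all
  have "0 \<le> 125 * (7 - 10 * x) ^ 4
      + 3050 * (10 * x - 5) * (7 - 10 * x) ^ 3
      + 9750 * (10 * x - 5) ^ 2 * (7 - 10 * x) ^ 2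
      + 9554 * (10 * x - 5) ^ 3 * (7 - 10 * x)
      + 2081 * (10 * x - 5) ^ 4"
    by (intro add_nonneg_nonneg mult_nonneg_nonneg zero_le_power y) simp_all
  also have "\<dots> = 1000 * (- (45 - 960 * x + 5292 * x ^ 2 - 10368 * x ^ 3 + 6480 * x ^ 4)) - 1000"
    by algebra
  finally show ?thesis by simp
qed

lemma dec_poly3_mono_4: "1 / 2 \<le> x \<Longrightarrow> x < y \<Longrightarrow> y \<le> 7 / 10 \<Longrightarrow> dec_poly3 y < dec_poly3 x"
  by (rule deriv_neg_less[OF dec_poly3_has_derivative dec_poly3_deriv_neg_4[unfolded neg_0_less_iff_less]])

lemma dec_poly3_above_1:
  fixes x :: real
  assumes "13 / 200 \<le> x" "x \<le> 3 / 40"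
  shows "0 < 45 * x - 480 * x ^ 2 + 1764 * x ^ 3 - 2592 * x ^ 4 + 1296 * x ^ 5 - 4 / 3"
proof -
  have y: "0 \<le> 200 * x - 13" "0 \<le> 15 - 200 * x" using assms by simp_all
  have "0 \<le> 140404999 * (15 - 200 * x) ^ 5
      + 2038261025 * (200 * x - 13) * (15 - 200 * x) ^ 4
      + 5559985750 * (200 * x - 13) ^ 2 * (15 - 200 * x) ^ 3
      + 5923131250 * (200 * x - 13) ^ 3 * (15 - 200 * x) ^ 2
      + 2616021875 * (200 * x - 13) ^ 4 * (15 - 200 * x)
      + 355028125 * (200 * x - 13) ^ 5"
    by (intro add_nonneg_nonneg mult_nonneg_nonneg zero_le_power y) simp_all
  also have "\<dots> = 1920000000000 * (45 * x - 480 * x ^ 2 + 1764 * x ^ 3 - 2592 * x ^ 4 + 1296 * x ^ 5 - 4 / 3) - 1920000000"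
    by algebra
  finally show ?thesis by simp
qed

lemma dec_poly3_above_3:
  fixes x :: real
  assumes "9 / 20 \<le> x" "x \<le> 1 / 2"
  shows "0 < 45 * x - 480 * x ^ 2 + 1764 * x ^ 3 - 2592 * x ^ 4 + 1296 * x ^ 5 - 4 / 3"
proof -
  have y: "0 \<le> 20 * x - 9" "0 \<le> 10 - 20 * x" using assms by simp_all
  have "0 \<le> 46687 * (10 - 20 * x) ^ 5
      + 400430 * (20 * x - 9) * (10 - 20 * x) ^ 4
      + 1034500 * (20 * x - 9) ^ 2 * (10 - 20 * x) ^ 3
      + 1147000 * (20 * x - 9) ^ 3 * (10 - 20 * x) ^ 2
      + 560000 * (20 * x - 9) ^ 4 * (10 - 20 * x)
      + 94000 * (20 * x - 9) ^ 5"
    by (intro add_nonneg_nonneg mult_nonneg_nonneg zero_le_power y) simp_all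
  also have "\<dots> = 600000 * (45 * x - 480 * x ^ 2 + 1764 * x ^ 3 - 2592 * x ^ 4 + 1296 * x ^ 5 - 4 / 3) - 6000"
    by algebra
  finally show ?thesis by simp
qed

lemma dec_poly3_below_4:
  fixes x :: real
  assumes "7 / 10 \<le> x" "x \<le> 17 / 20"
  shows "0 < - (45 * x - 480 * x ^ 2 + 1764 * x ^ 3 - 2592 * x ^ 4 + 1296 * x ^ 5)"
proof -
  have y: "0 \<le> 20 * x - 14" "0 \<le> 17 - 20 * x" using assms by simp_all
  have "0 \<le> 433696 * (17 - 20 * x) ^ 5
      + 3197360 * (20 * x - 14) * (17 - 20 * x) ^ 4
      + 8231080 * (20 * x - 14) ^ 2 * (17 - 20 * x) ^ 3
      + 9267700 * (20 * x - 14) ^ 3 * (17 - 20 * x) ^ 2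
      + 4266290 * (20 * x - 14) ^ 4 * (17 - 20 * x)
      + 446323 * (20 * x - 14) ^ 5"
    by (intro add_nonneg_nonneg mult_nonneg_nonneg zero_le_power y) simp_all
  also have "\<dots> = 48600000 * (- (45 * x - 480 * x ^ 2 + 1764 * x ^ 3 - 2592 * x ^ 4 + 1296 * x ^ 5)) - 48600000"
    by algebra
  finally show ?thesis by simp
qed

section \<open>Bands and gaps of the tree for n = 3\<close>

lemma dec_poly3_tree_bounds: "x \<in> decimation_tree dec_poly3 \<Longrightarrow> 0 \<le> x \<and> x \<le> 4 / 3"
  by (rule decimation_tree_bounds[where R = dec_poly3 and t = "13 / 200" and s = "17 / 20",
        OF dec_poly3_0 _ _ dec_poly3_mono_1 dec_poly3_mono_5])
    (simp_all add: dec_poly3_def power_divide)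

lemma dec_poly3_gap_bottom: "gap (decimation_tree dec_poly3) (- 1000000) 0"
  and dec_poly3_gap_top: "gap (decimation_tree dec_poly3) (4 / 3) 1000000"
  using dec_poly3_tree_bounds unfolding gap_def by auto

lemma dec_poly3_gap_closed_1: "13 / 200 \<le> x \<Longrightarrow> x \<le> 3 / 40 \<Longrightarrow> x \<notin> decimation_tree dec_poly3"
  using dec_poly3_above_1[of x] decimation_tree_step[of dec_poly3 x, OF dec_poly3_0] dec_poly3_tree_bounds[of "dec_poly3 x"]
  by (auto simp: dec_poly3_def)

lemma dec_poly3_gap_closed_3: "9 / 20 \<le> x \<Longrightarrow> x \<le> 1 / 2 \<Longrightarrow> x \<notin> decimation_tree dec_poly3"
  using dec_poly3_above_3[of x] decimation_tree_step[of dec_poly3 x, OF dec_poly3_0] dec_poly3_tree_bounds[of "dec_poly3 x"]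
  by (auto simp: dec_poly3_def)

lemma dec_poly3_gap_closed_4: "7 / 10 \<le> x \<Longrightarrow> x \<le> 17 / 20 \<Longrightarrow> x \<notin> decimation_tree dec_poly3"
  using dec_poly3_below_4[of x] decimation_tree_step[of dec_poly3 x, OF dec_poly3_0] dec_poly3_tree_bounds[of "dec_poly3 x"]
  by (auto simp: dec_poly3_def)

lemma dec_poly3_gap_1_left: "gap (decimation_tree dec_poly3) (1068055 / 16777216) (13 / 200)"
  by (rule gap_increasing[of dec_poly3 "(- 1)" "13 / 200", OF dec_poly3_0 dec_poly3_mono_1 dec_poly3_gap_top])
    (simp_all add: dec_poly3_def power_divide)

lemma dec_poly3_gap_1_right: "gap (decimation_tree dec_poly3) (3 / 40) (164655 / 2097152)"
  by (rule gap_decreasing[of dec_poly3 "3 / 40" "1 / 4", OF dec_poly3_0 dec_poly3_mono_2 dec_poly3_gap_top])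
    (simp_all add: dec_poly3_def power_divide)

lemma dec_poly3_gap_1: "gap (decimation_tree dec_poly3) (1068055 / 16777216) (164655 / 2097152)"
  by (rule gap_join[OF dec_poly3_gap_1_left dec_poly3_gap_closed_1 dec_poly3_gap_1_right])

lemma dec_poly3_gap_3_left: "gap (decimation_tree dec_poly3) (3660277 / 8388608) (9 / 20)"
  by (rule gap_increasing[of dec_poly3 "27 / 100" "9 / 20", OF dec_poly3_0 dec_poly3_mono_3 dec_poly3_gap_top])
    (simp_all add: dec_poly3_def power_divide)

lemma dec_poly3_gap_3_right: "gap (decimation_tree dec_poly3) (1 / 2) (8856829 / 16777216)"
  by (rule gap_decreasing[of dec_poly3 "1 / 2" "7 / 10", OF dec_poly3_0 dec_poly3_mono_4 dec_poly3_gap_top])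
    (simp_all add: dec_poly3_def power_divide)

lemma dec_poly3_gap_3: "gap (decimation_tree dec_poly3) (3660277 / 8388608) (8856829 / 16777216)"
  by (rule gap_join[OF dec_poly3_gap_3_left dec_poly3_gap_closed_3 dec_poly3_gap_3_right])

lemma dec_poly3_gap_4_left: "gap (decimation_tree dec_poly3) (10116757 / 16777216) (7 / 10)"
  by (rule gap_decreasing[of dec_poly3 "1 / 2" "7 / 10", OF dec_poly3_0 dec_poly3_mono_4 dec_poly3_gap_bottom])
    (simp_all add: dec_poly3_def power_divide)

lemma dec_poly3_gap_4_right: "gap (decimation_tree dec_poly3) (17 / 20) (14827635 / 16777216)"
  by (rule gap_increasing[of dec_poly3 "17 / 20" "4 / 3", OF dec_poly3_0 dec_poly3_mono_5 dec_poly3_gap_bottom])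
    (simp_all add: dec_poly3_def power_divide)

lemma dec_poly3_gap_4: "gap (decimation_tree dec_poly3) (10116757 / 16777216) (14827635 / 16777216)"
  by (rule gap_join[OF dec_poly3_gap_4_left dec_poly3_gap_closed_4 dec_poly3_gap_4_right])

lemma dec_poly3_gap_5: "gap (decimation_tree dec_poly3) (7495877 / 8388608) (4 / 3)"
  by (rule gap_increasing[of dec_poly3 "17 / 20" "4 / 3", OF dec_poly3_0 dec_poly3_mono_5 dec_poly3_gap_top])
    (simp_all add: dec_poly3_def power_divide)

lemma dec_poly3_gap_2_5: "gap (decimation_tree dec_poly3) (1317241 / 16777216) (2222041 / 16777216)"
  by (rule gap_decreasing[of dec_poly3 "3 / 40" "1 / 4", OF dec_poly3_0 dec_poly3_mono_2 dec_poly3_gap_5])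
    (simp_all add: dec_poly3_def power_divide)

lemma dec_poly3_gap_3_5: "gap (decimation_tree dec_poly3) (3258839 / 8388608) (7320553 / 16777216)"
  by (rule gap_increasing[of dec_poly3 "27 / 100" "9 / 20", OF dec_poly3_0 dec_poly3_mono_3 dec_poly3_gap_5])
    (simp_all add: dec_poly3_def power_divide)

lemma dec_poly3_gap_2_3: "gap (decimation_tree dec_poly3) (2753919 / 16777216) (2895005 / 16777216)"
  by (rule gap_decreasing[of dec_poly3 "3 / 40" "1 / 4", OF dec_poly3_0 dec_poly3_mono_2 dec_poly3_gap_3])
    (simp_all add: dec_poly3_def power_divide)

text \<open>Together with the gap 2_3 it isolates the preimage under branch 2 of the top point of
  band 3. This point must be a piece of its own: the two parts of band 5, divided by sqrt 45, fall
  on either side of it.\<close>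

lemma dec_poly3_gap_2_3_5: "gap (decimation_tree dec_poly3) (2895007 / 16777216) (371497 / 2097152)"
  by (rule gap_decreasing[of dec_poly3 "3 / 40" "1 / 4", OF dec_poly3_0 dec_poly3_mono_2 dec_poly3_gap_3_5])
    (simp_all add: dec_poly3_def power_divide)

text \<open>Without this cut of band 5, its quotients by the isolated third piece would include sqrt
  45.\<close>

lemma dec_poly3_gap_5_5: "gap (decimation_tree dec_poly3) (14940267 / 16777216) (14991753 / 16777216)"
  by (rule gap_increasing[of dec_poly3 "17 / 20" "4 / 3", OF dec_poly3_0 dec_poly3_mono_5 dec_poly3_gap_5])
    (simp_all add: dec_poly3_def power_divide)

text \<open>The fourth interval runs from band 2 into band 3; the fifth, the eighth and the last
  enclose the top of band 3, the top of band 5 and the point 4/3.\<close>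

definition dec_poly3_pieces :: "(real \<times> real \<times> real \<times> real \<times> real \<times> real) list" where
  "dec_poly3_pieces = [
    (164655 / 2097152, 1317241 / 16777216, 477347 / 268435456, 119337 / 67108864, 1358359 / 34359738368, 1358363 / 34359738368),
    (2222041 / 16777216, 2753919 / 16777216, 408119 / 134217728, 509967 / 134217728, 2323419 / 34359738368, 2903763 / 34359738368),
    (2895005 / 16777216, 2895007 / 16777216, 1074545 / 268435456, 1074547 / 268435456, 764847 / 8589934592, 1529697 / 17179869184),
    (371497 / 2097152, 3258839 / 8388608, 276111 / 67108864, 2570927 / 268435456, 1572299 / 17179869184, 1832381 / 8589934592),
    (7320553 / 16777216, 3660277 / 8388608, 2930679 / 268435456, 2930681 / 268435456, 8357819 / 34359738368, 4178913 / 17179869184),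
    (8856829 / 16777216, 10116757 / 16777216, 1826747 / 134217728, 267801 / 16777216, 10425867 / 34359738368, 12234327 / 34359738368),
    (14827635 / 16777216, 14940267 / 16777216, 1769131 / 67108864, 7154601 / 268435456, 20255877 / 34359738368, 20480799 / 34359738368),
    (14991753 / 16777216, 7495877 / 8388608, 3595261 / 134217728, 1797631 / 67108864, 643259 / 1073741824, 20584295 / 34359738368),
    (4 / 3, 4 / 3, 8544435 / 134217728, 17088871 / 268435456, 12340185 / 8589934592, 6170093 / 4294967296)]"

lemma dec_poly3_cover:
  assumes "x \<in> decimation_tree dec_poly3"
  shows "x \<le> 13 / 200 \<or> (\<exists>I\<in>set dec_poly3_pieces. fst I \<le> x \<and> x \<le> fst (snd I))"
proof -
  have "x \<le> 1068055 / 16777216 \<or> (164655 / 2097152 \<le> x \<and> x \<le> 1317241 / 16777216) \<or>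
    (2222041 / 16777216 \<le> x \<and> x \<le> 2753919 / 16777216) \<or>
    (2895005 / 16777216 \<le> x \<and> x \<le> 2895007 / 16777216) \<or>
    (371497 / 2097152 \<le> x \<and> x \<le> 3258839 / 8388608) \<or>
    (7320553 / 16777216 \<le> x \<and> x \<le> 3660277 / 8388608) \<or>
    (8856829 / 16777216 \<le> x \<and> x \<le> 10116757 / 16777216) \<or>
    (14827635 / 16777216 \<le> x \<and> x \<le> 14940267 / 16777216) \<or>
    (14991753 / 16777216 \<le> x \<and> x \<le> 7495877 / 8388608) \<or> (4 / 3 \<le> x \<and> x \<le> 4 / 3)"
    using conjunct2[OF dec_poly3_tree_bounds[OF assms]]
      dec_poly3_gap_1[THEN gapD, OF assms]
      dec_poly3_gap_2_5[THEN gapD, OF assms]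
      dec_poly3_gap_2_3[THEN gapD, OF assms]
      dec_poly3_gap_2_3_5[THEN gapD, OF assms]
      dec_poly3_gap_3_5[THEN gapD, OF assms]
      dec_poly3_gap_3[THEN gapD, OF assms]
      dec_poly3_gap_4[THEN gapD, OF assms]
      dec_poly3_gap_5_5[THEN gapD, OF assms]
      dec_poly3_gap_5[THEN gapD, OF assms]
    by blast
  moreover have "x \<le> 1068055 / 16777216 \<Longrightarrow> x \<le> 13 / 200" by simp
  ultimately show ?thesis
    unfolding dec_poly3_pieces_def list.set bex_simps fst_conv snd_conv by blast
qed

section \<open>Estimates near 0 and comparison of the pieces for n = 3\<close>

lemma dec_poly3_up_aux:
  fixes x :: real
  assumes "0 \<le> x" "x \<le> 13 / 200"
  shows "0 < 480 - 1764 * x + 2592 * x ^ 2 - 1296 * x ^ 3"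
proof -
  have y: "0 \<le> 200 * x" "0 \<le> 13 - 200 * x" using assms by simp_all
  have "0 \<le> 239500000 * (13 - 200 * x) ^ 3
      + 661170000 * (200 * x) * (13 - 200 * x) ^ 2
      + 609315600 * (200 * x) ^ 2 * (13 - 200 * x)
      + 187467643 * (200 * x) ^ 3"
    by (intro add_nonneg_nonneg mult_nonneg_nonneg zero_le_power y) simp_all
  also have "\<dots> = 1098500000 * (480 - 1764 * x + 2592 * x ^ 2 - 1296 * x ^ 3) - 1098500000"
    by algebra
  finally show ?thesis by simp
qed

lemma dec_poly3_grow_aux:
  fixes x :: real
  assumes "0 \<le> x" "x \<le> 13 / 200"
  shows "0 < 43 - 480 * x + 1764 * x ^ 2 - 2592 * x ^ 3 + 1296 * x ^ 4"
proof -
  have y: "0 \<le> 200 * x" "0 \<le> 13 - 200 * x" using assms by simp_all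
  have "0 \<le> 4200000000 * (13 - 200 * x) ^ 4
      + 13680000000 * (200 * x) * (13 - 200 * x) ^ 3
      + 16585290000 * (200 * x) ^ 2 * (13 - 200 * x) ^ 2
      + 8859397200 * (200 * x) ^ 3 * (13 - 200 * x)
      + 1756420641 * (200 * x) ^ 4"
    by (intro add_nonneg_nonneg mult_nonneg_nonneg zero_le_power y) simp_all
  also have "\<dots> = 2856100000000 * (43 - 480 * x + 1764 * x ^ 2 - 2592 * x ^ 3 + 1296 * x ^ 4) - 2856100000000"
    by algebra
  finally show ?thesis by simp
qed

lemma dec_poly3_low_aux:
  fixes x :: real
  assumes "0 \<le> x" "x \<le> 13 / 200"
  shows "0 < 1764 - 2592 * x + 1296 * x ^ 2"
proof -
  have y: "0 \<le> 200 * x" "0 \<le> 13 - 200 * x" using assms by simp_all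
  have "0 \<le> 4407500 * (13 - 200 * x) ^ 2
      + 8393800 * (200 * x) * (13 - 200 * x)
      + 3999989 * (200 * x) ^ 2"
    by (intro add_nonneg_nonneg mult_nonneg_nonneg zero_le_power y) simp_all
  also have "\<dots> = 422500 * (1764 - 2592 * x + 1296 * x ^ 2) - 422500"
    by algebra
  finally show ?thesis by simp
qed

lemma dec_poly3_estimates:
  assumes x: "0 \<le> x" "x \<le> 13 / 200"
  shows "dec_poly3 x \<le> 45 * x" "2 * x \<le> dec_poly3 x" "45 * x - 480 * x\<^sup>2 \<le> dec_poly3 x"
proof -
  have "45 * x - dec_poly3 x = x\<^sup>2 * (480 - 1764 * x + 2592 * x ^ 2 - 1296 * x ^ 3)"
    unfolding dec_poly3_def by algebra
  then show "dec_poly3 x \<le> 45 * x"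
    using mult_nonneg_nonneg[OF zero_le_power2[of x] less_imp_le[OF dec_poly3_up_aux[OF x]]] by linarith
  have "dec_poly3 x - 2 * x = x * (43 - 480 * x + 1764 * x ^ 2 - 2592 * x ^ 3 + 1296 * x ^ 4)"
    unfolding dec_poly3_def by algebra
  then show "2 * x \<le> dec_poly3 x"
    using mult_nonneg_nonneg[OF x(1) less_imp_le[OF dec_poly3_grow_aux[OF x]]] by linarith
  have low: "0 \<le> (1764 - 2592 * x + 1296 * x ^ 2 :: real)"
    using dec_poly3_low_aux[OF x] by simp
  have "dec_poly3 x - (45 * x - 480 * x\<^sup>2) = x ^ 3 * (1764 - 2592 * x + 1296 * x ^ 2)"
    unfolding dec_poly3_def by algebra
  then show "45 * x - 480 * x\<^sup>2 \<le> dec_poly3 x"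
    using mult_nonneg_nonneg[OF zero_le_power[OF x(1), of 3] low] by linarith
qed

lemma dec_poly3_fraction:
  fixes a b :: real
  assumes "b \<noteq> 0"
  shows "dec_poly3 (a / b) = (45 * a * b ^ 4 - 480 * a ^ 2 * b ^ 3 + 1764 * a ^ 3 * b ^ 2 - 2592 * a ^ 4 * b + 1296 * a ^ 5) / b ^ 5"
  using assms by (simp add: dec_poly3_def field_simps eval_nat_numeral)

lemma dec_poly3_branch_bounds: "list_all (branch_bounds dec_poly3 (13 / 200) (9 / 6250)) dec_poly3_pieces"
  unfolding dec_poly3_pieces_def
  by (simp add: branch_bounds_def dec_poly3_fraction)

text \<open>Divided by sqrt 45, the intervals six, seven, eight and nine fall below the intervals
  two, three, four and five respectively, each into the gap just below.\<close>

definition dec_poly3_bounds :: "(real \<times> real) list" where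
  "dec_poly3_bounds = [
    (395 / 10000000, 396 / 10000000),
    (676 / 10000000, 846 / 10000000),
    (890 / 10000000, 891 / 10000000),
    (915 / 10000000, 2134 / 10000000),
    (2432 / 10000000, 2433 / 10000000),
    (3034 / 10000000, 3561 / 10000000),
    (5895 / 10000000, 5962 / 10000000),
    (5990 / 10000000, 5992 / 10000000),
    (14365 / 10000000, 14372 / 10000000)]"

text \<open>The value 13/50 is 480 / (45^2 - 45) = 8/33 rounded up.\<close>

lemma dec_poly3_bounds: "list_all2 (\<lambda>P Q. fst Q \<le> fst P \<and> snd P \<le> snd Q)
    (map (scaled_bounds (13 / 50)) dec_poly3_pieces) dec_poly3_bounds"
  unfolding dec_poly3_pieces_def dec_poly3_bounds_def
  by (simp add: scaled_bounds_def power_divide)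

text \<open>The tightest pair is the seventh interval against the third: 5962/890 is about 6.699,
  while sqrt 45 is about 6.708.\<close>

lemma dec_poly3_avoids:
  "P \<in> set dec_poly3_bounds \<Longrightarrow> Q \<in> set dec_poly3_bounds \<Longrightarrow> avoids_sqrt 45 (1001 / 1000) P Q"
proof -
  have "list_all (\<lambda>P. list_all (avoids_sqrt 45 (1001 / 1000) P) dec_poly3_bounds) dec_poly3_bounds"
    unfolding dec_poly3_bounds_def
    by (simp add: avoids_sqrt_def power_divide)
  then show "P \<in> set dec_poly3_bounds \<Longrightarrow> Q \<in> set dec_poly3_bounds \<Longrightarrow> avoids_sqrt 45 (1001 / 1000) P Q"
    unfolding list_all_iff by blast
qed

lemma dec_poly3_ratio_gap: "small_ratio_gap 45 (decimation_tree dec_poly3)"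
proof (rule small_ratio_gapI[OF _ _ dec_poly3_avoids scaled_cover_weaken[OF dec_poly3_bounds]])
  show "\<exists>e>0. \<forall>x\<in>decimation_tree dec_poly3. 0 < x \<longrightarrow> x < e \<longrightarrow>
    (\<exists>j. \<exists>(A, B)\<in>set (map (scaled_bounds (13 / 50)) dec_poly3_pieces). A \<le> 45 ^ j * x \<and> 45 ^ j * x \<le> B)"
    by (rule scaled_cover[where R = dec_poly3 and t = "13 / 200" and s = "9 / 6250" and c = 480 and \<rho> = 45,
          OF dec_poly3_0 _ _ _ _ _ _ dec_poly3_mono_1 dec_poly3_estimates])
      (use dec_poly3_tree_bounds dec_poly3_cover dec_poly3_branch_bounds[unfolded list_all_iff] in \<open>simp_all add: power2_eq_square\<close>)
qed simp_all

section \<open>The decimation tree for n = 4\<close>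

text \<open>In factored form x (216x^3 - 252x^2 + 84x - 7) (216x^3 - 324x^2 + 132x - 13), that is
  \<lambda> g_4 h_4.\<close>

definition dec_poly4 :: "real \<Rightarrow> real" where
  "dec_poly4 x = 91 * x - 2016 * x ^ 2 + 16632 * x ^ 3 - 64800 * x ^ 4 + 128304 * x ^ 5 - 124416 * x ^ 6 + 46656 * x ^ 7"

lemma decimation_map_4: "decimation_map 4 = dec_poly4"
proof
  fix x
  have c: "chain x (4 - 1) a v = chain x (Suc (Suc (Suc 0))) a v" for a v
    by (simp add: numeral_eq_Suc)
  show "decimation_map 4 x = dec_poly4 x"
    unfolding decimation_map_def neck_def c dec_poly4_def
    by (simp add: Let_def field_simps) algebra
qed

lemma dec_poly4_0: "dec_poly4 0 = 0"
  by (simp add: dec_poly4_def)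

section \<open>Monotone branches of the polynomial of degree 7 and its values near critical
  points\<close>

lemma dec_poly4_has_derivative: "(dec_poly4 has_real_derivative 91 - 4032 * x + 49896 * x ^ 2 - 259200 * x ^ 3 + 641520 * x ^ 4 - 746496 * x ^ 5 + 326592 * x ^ 6) (at x)"
  unfolding dec_poly4_def by (auto intro!: derivative_eq_intros)

lemma dec_poly4_deriv_pos_1:
  fixes x :: real
  assumes "x \<le> 7 / 200"
  shows "0 < 91 - 4032 * x + 49896 * x ^ 2 - 259200 * x ^ 3 + 641520 * x ^ 4 - 746496 * x ^ 5 + 326592 * x ^ 6"
proof -
  have y: "0 \<le> 7 - 200 * x" using assms by simp
  have "0 < 813473943247 + 6936587267274 * (7 - 200 * x) + 677061580545 * (7 - 200 * x) ^ 2 + 22281465420 * (7 - 200 * x) ^ 3 + 323052705 * (7 - 200 * x) ^ 4 + 2118474 * (7 - 200 * x) ^ 5 + 5103 * (7 - 200 * x) ^ 6"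
    by (intro add_pos_nonneg mult_nonneg_nonneg zero_le_power y) simp_all
  also have "\<dots> = 1000000000000 * (91 - 4032 * x + 49896 * x ^ 2 - 259200 * x ^ 3 + 641520 * x ^ 4 - 746496 * x ^ 5 + 326592 * x ^ 6)"
    by algebra
  finally show ?thesis by simp
qed

lemma dec_poly4_deriv_pos_7:
  fixes x :: real
  assumes "17 / 20 \<le> x"
  shows "0 < 91 - 4032 * x + 49896 * x ^ 2 - 259200 * x ^ 3 + 641520 * x ^ 4 - 746496 * x ^ 5 + 326592 * x ^ 6"
proof -
  have y: "0 \<le> 20 * x - 17" using assms by simp
  have "0 < 359683147 + 797741226 * (20 * x - 17) + 356881545 * (20 * x - 17) ^ 2 + 67487580 * (20 * x - 17) ^ 3 + 6302205 * (20 * x - 17) ^ 4 + 287226 * (20 * x - 17) ^ 5 + 5103 * (20 * x - 17) ^ 6"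
    by (intro add_pos_nonneg mult_nonneg_nonneg zero_le_power y) simp_all
  also have "\<dots> = 1000000 * (91 - 4032 * x + 49896 * x ^ 2 - 259200 * x ^ 3 + 641520 * x ^ 4 - 746496 * x ^ 5 + 326592 * x ^ 6)"
    by algebra
  finally show ?thesis by simp
qed

lemma dec_poly4_mono_1: "x < y \<Longrightarrow> y \<le> 7 / 200 \<Longrightarrow> dec_poly4 x < dec_poly4 y"
  by (rule deriv_pos_less[where a = x and b = y, OF dec_poly4_has_derivative]) (auto intro: dec_poly4_deriv_pos_1)

lemma dec_poly4_mono_7: "17 / 20 \<le> x \<Longrightarrow> x < y \<Longrightarrow> dec_poly4 x < dec_poly4 y"
  by (rule deriv_pos_less[where a = x and b = y, OF dec_poly4_has_derivative]) (auto intro: dec_poly4_deriv_pos_7)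

lemma dec_poly4_deriv_neg_2:
  fixes x :: real
  assumes "37 / 1000 \<le> x" "x \<le> 13 / 100"
  shows "0 < - (91 - 4032 * x + 49896 * x ^ 2 - 259200 * x ^ 3 + 641520 * x ^ 4 - 746496 * x ^ 5 + 326592 * x ^ 6)"
proof -
  have y: "0 \<le> 1000 * x - 37" "0 \<le> 130 - 1000 * x" using assms by simp_all
  have "0 \<le> 27410138688832873 * (130 - 1000 * x) ^ 6
      + 2026073997228742620 * (1000 * x - 37) * (130 - 1000 * x) ^ 5
      + 6202142064063559500 * (1000 * x - 37) ^ 2 * (130 - 1000 * x) ^ 4
      + 7284682847057540000 * (1000 * x - 37) ^ 3 * (130 - 1000 * x) ^ 3
      + 3894534225280950000 * (1000 * x - 37) ^ 4 * (130 - 1000 * x) ^ 2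
      + 850942886026200000 * (1000 * x - 37) ^ 5 * (130 - 1000 * x)
      + 34311711373000000 * (1000 * x - 37) ^ 6"
    by (intro add_nonneg_nonneg mult_nonneg_nonneg zero_le_power y) simp_all
  also have "\<dots> = 10109221616390625000000000000 * (- (91 - 4032 * x + 49896 * x ^ 2 - 259200 * x ^ 3 + 641520 * x ^ 4 - 746496 * x ^ 5 + 326592 * x ^ 6)) - 1010922161639062500000000000"
    by algebra
  finally show ?thesis by simp
qed

lemma dec_poly4_mono_2: "37 / 1000 \<le> x \<Longrightarrow> x < y \<Longrightarrow> y \<le> 13 / 100 \<Longrightarrow> dec_poly4 y < dec_poly4 x"
  by (rule deriv_neg_less[OF dec_poly4_has_derivative dec_poly4_deriv_neg_2[unfolded neg_0_less_iff_less]])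

lemma dec_poly4_deriv_pos_3:
  fixes x :: real
  assumes "7 / 50 \<le> x" "x \<le> 27 / 100"
  shows "0 < 91 - 4032 * x + 49896 * x ^ 2 - 259200 * x ^ 3 + 641520 * x ^ 4 - 746496 * x ^ 5 + 326592 * x ^ 6"
proof -
  have y: "0 \<le> 100 * x - 14" "0 \<le> 27 - 100 * x" using assms by simp_all
  have "0 \<le> 29591608608 * (27 - 100 * x) ^ 6
      + 1011912833664 * (100 * x - 14) * (27 - 100 * x) ^ 5
      + 4053990944880 * (100 * x - 14) ^ 2 * (27 - 100 * x) ^ 4
      + 5715854997120 * (100 * x - 14) ^ 3 * (27 - 100 * x) ^ 3
      + 3458303781120 * (100 * x - 14) ^ 4 * (27 - 100 * x) ^ 2
      + 829071165564 * (100 * x - 14) ^ 5 * (27 - 100 * x)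
      + 39583868067 * (100 * x - 14) ^ 6"
    by (intro add_nonneg_nonneg mult_nonneg_nonneg zero_le_power y) simp_all
  also have "\<dots> = 75418890625000000 * (91 - 4032 * x + 49896 * x ^ 2 - 259200 * x ^ 3 + 641520 * x ^ 4 - 746496 * x ^ 5 + 326592 * x ^ 6) - 7541889062500000"
    by algebra
  finally show ?thesis by simp
qed

lemma dec_poly4_mono_3: "7 / 50 \<le> x \<Longrightarrow> x < y \<Longrightarrow> y \<le> 27 / 100 \<Longrightarrow> dec_poly4 x < dec_poly4 y"
  by (rule deriv_pos_less[OF dec_poly4_has_derivative dec_poly4_deriv_pos_3])

lemma dec_poly4_deriv_neg_4:
  fixes x :: real
  assumes "29 / 100 \<le> x" "x \<le> 21 / 50"
  shows "0 < - (91 - 4032 * x + 49896 * x ^ 2 - 259200 * x ^ 3 + 641520 * x ^ 4 - 746496 * x ^ 5 + 326592 * x ^ 6)"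
proof -
  have y: "0 \<le> 100 * x - 29" "0 \<le> 42 - 100 * x" using assms by simp_all
  have "0 \<le> 34229049037 * (42 - 100 * x) ^ 6
      + 782676759156 * (100 * x - 29) * (42 - 100 * x) ^ 5
      + 3218027478720 * (100 * x - 29) ^ 2 * (42 - 100 * x) ^ 4
      + 5164706958080 * (100 * x - 29) ^ 3 * (42 - 100 * x) ^ 3
      + 3628273760880 * (100 * x - 29) ^ 4 * (42 - 100 * x) ^ 2
      + 1029923992896 * (100 * x - 29) ^ 5 * (42 - 100 * x)
      + 72146215168 * (100 * x - 29) ^ 6"
    by (intro add_nonneg_nonneg mult_nonneg_nonneg zero_le_power y) simp_all
  also have "\<dots> = 75418890625000000 * (- (91 - 4032 * x + 49896 * x ^ 2 - 259200 * x ^ 3 + 641520 * x ^ 4 - 746496 * x ^ 5 + 326592 * x ^ 6)) - 75418890625000000"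
    by algebra
  finally show ?thesis by simp
qed

lemma dec_poly4_mono_4: "29 / 100 \<le> x \<Longrightarrow> x < y \<Longrightarrow> y \<le> 21 / 50 \<Longrightarrow> dec_poly4 y < dec_poly4 x"
  by (rule deriv_neg_less[OF dec_poly4_has_derivative dec_poly4_deriv_neg_4[unfolded neg_0_less_iff_less]])

lemma dec_poly4_deriv_pos_5:
  fixes x :: real
  assumes "9 / 20 \<le> x" "x \<le> 11 / 20"
  shows "0 < 91 - 4032 * x + 49896 * x ^ 2 - 259200 * x ^ 3 + 641520 * x ^ 4 - 746496 * x ^ 5 + 326592 * x ^ 6"
proof -
  have y: "0 \<le> 20 * x - 9" "0 \<le> 11 - 20 * x" using assms by simp_all
  have "0 \<le> 3262203 * (11 - 20 * x) ^ 6
      + 54440982 * (20 * x - 9) * (11 - 20 * x) ^ 5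
      + 223902045 * (20 * x - 9) ^ 2 * (11 - 20 * x) ^ 4
      + 395537940 * (20 * x - 9) ^ 3 * (11 - 20 * x) ^ 3
      + 334071045 * (20 * x - 9) ^ 4 * (11 - 20 * x) ^ 2
      + 125857782 * (20 * x - 9) ^ 5 * (11 - 20 * x)
      + 14928003 * (20 * x - 9) ^ 6"
    by (intro add_nonneg_nonneg mult_nonneg_nonneg zero_le_power y) simp_all
  also have "\<dots> = 64000000 * (91 - 4032 * x + 49896 * x ^ 2 - 259200 * x ^ 3 + 641520 * x ^ 4 - 746496 * x ^ 5 + 326592 * x ^ 6) - 64000000"
    by algebra
  finally show ?thesis by simp
qed

lemma dec_poly4_mono_5: "9 / 20 \<le> x \<Longrightarrow> x < y \<Longrightarrow> y \<le> 11 / 20 \<Longrightarrow> dec_poly4 x < dec_poly4 y"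
  by (rule deriv_pos_less[OF dec_poly4_has_derivative dec_poly4_deriv_pos_5])

lemma dec_poly4_deriv_neg_6:
  fixes x :: real
  assumes "3 / 5 \<le> x" "x \<le> 7 / 10"
  shows "0 < - (91 - 4032 * x + 49896 * x ^ 2 - 259200 * x ^ 3 + 641520 * x ^ 4 - 746496 * x ^ 5 + 326592 * x ^ 6)"
proof -
  have y: "0 \<le> 10 * x - 6" "0 \<le> 7 - 10 * x" using assms by simp_all
  have "0 \<le> 326572 * (7 - 10 * x) ^ 6
      + 3794064 * (10 * x - 6) * (7 - 10 * x) ^ 5
      + 15402570 * (10 * x - 6) ^ 2 * (7 - 10 * x) ^ 4
      + 30139520 * (10 * x - 6) ^ 3 * (7 - 10 * x) ^ 3
      + 30786405 * (10 * x - 6) ^ 4 * (7 - 10 * x) ^ 2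
      + 15686574 * (10 * x - 6) ^ 5 * (7 - 10 * x)
      + 3099508 * (10 * x - 6) ^ 6"
    by (intro add_nonneg_nonneg mult_nonneg_nonneg zero_le_power y) simp_all
  also have "\<dots> = 15625 * (- (91 - 4032 * x + 49896 * x ^ 2 - 259200 * x ^ 3 + 641520 * x ^ 4 - 746496 * x ^ 5 + 326592 * x ^ 6)) - 15625"
    by algebra
  finally show ?thesis by simp
qed

lemma dec_poly4_mono_6: "3 / 5 \<le> x \<Longrightarrow> x < y \<Longrightarrow> y \<le> 7 / 10 \<Longrightarrow> dec_poly4 y < dec_poly4 x"
  by (rule deriv_neg_less[OF dec_poly4_has_derivative dec_poly4_deriv_neg_6[unfolded neg_0_less_iff_less]])

lemma dec_poly4_above_1:
  fixes x :: real
  assumes "7 / 200 \<le> x" "x \<le> 37 / 1000"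
  shows "0 < 91 * x - 2016 * x ^ 2 + 16632 * x ^ 3 - 64800 * x ^ 4 + 128304 * x ^ 5 - 124416 * x ^ 6 + 46656 * x ^ 7 - 4 / 3"
proof -
  have y: "0 \<le> 1000 * x - 35" "0 \<le> 37 - 1000 * x" using assms by simp_all
  have "0 \<le> 161073069136015625 * (37 - 1000 * x) ^ 7
      + 1203774666131515625 * (1000 * x - 35) * (37 - 1000 * x) ^ 6
      + 3710052533671378125 * (1000 * x - 35) ^ 2 * (37 - 1000 * x) ^ 5
      + 6134585404047428125 * (1000 * x - 35) ^ 3 * (37 - 1000 * x) ^ 4
      + 5875718760147566875 * (1000 * x - 35) ^ 4 * (37 - 1000 * x) ^ 3
      + 3246083807820805275 * (1000 * x - 35) ^ 5 * (37 - 1000 * x) ^ 2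
      + 948226795529760335 * (1000 * x - 35) ^ 6 * (37 - 1000 * x)
      + 110627280485251871 * (1000 * x - 35) ^ 7"
    by (intro add_nonneg_nonneg mult_nonneg_nonneg zero_le_power y) simp_all
  also have "\<dots> = 6000000000000000000000 * (91 * x - 2016 * x ^ 2 + 16632 * x ^ 3 - 64800 * x ^ 4 + 128304 * x ^ 5 - 124416 * x ^ 6 + 46656 * x ^ 7 - 4 / 3) - 6000000000000000000"
    by algebra
  finally show ?thesis by simp
qed

lemma dec_poly4_above_3:
  fixes x :: real
  assumes "27 / 100 \<le> x" "x \<le> 29 / 100"
  shows "0 < 91 * x - 2016 * x ^ 2 + 16632 * x ^ 3 - 64800 * x ^ 4 + 128304 * x ^ 5 - 124416 * x ^ 6 + 46656 * x ^ 7 - 4 / 3"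
proof -
  have y: "0 \<le> 100 * x - 27" "0 \<le> 29 - 100 * x" using assms by simp_all
  have "0 \<le> 166152517661 * (29 - 100 * x) ^ 7
      + 1409945832029 * (100 * x - 27) * (29 - 100 * x) ^ 6
      + 4697440756449 * (100 * x - 27) ^ 2 * (29 - 100 * x) ^ 5
      + 8148938134705 * (100 * x - 27) ^ 3 * (29 - 100 * x) ^ 4
      + 8008300788535 * (100 * x - 27) ^ 4 * (29 - 100 * x) ^ 3
      + 4445669148567 * (100 * x - 27) ^ 5 * (29 - 100 * x) ^ 2
      + 1271581185803 * (100 * x - 27) ^ 6 * (29 - 100 * x)
      + 138922413083 * (100 * x - 27) ^ 7"
    by (intro add_nonneg_nonneg mult_nonneg_nonneg zero_le_power y) simp_all
  also have "\<dots> = 600000000000000 * (91 * x - 2016 * x ^ 2 + 16632 * x ^ 3 - 64800 * x ^ 4 + 128304 * x ^ 5 - 124416 * x ^ 6 + 46656 * x ^ 7 - 4 / 3) - 6000000000000"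
    by algebra
  finally show ?thesis by simp
qed

lemma dec_poly4_above_5:
  fixes x :: real
  assumes "11 / 20 \<le> x" "x \<le> 3 / 5"
  shows "0 < 91 * x - 2016 * x ^ 2 + 16632 * x ^ 3 - 64800 * x ^ 4 + 128304 * x ^ 5 - 124416 * x ^ 6 + 46656 * x ^ 7 - 4 / 3"
proof -
  have y: "0 \<le> 20 * x - 11" "0 \<le> 12 - 20 * x" using assms by simp_all
  have "0 \<le> 8598637 * (12 - 20 * x) ^ 7
      + 107974468 * (20 * x - 11) * (12 - 20 * x) ^ 6
      + 440058108 * (20 * x - 11) ^ 2 * (12 - 20 * x) ^ 5
      + 863801360 * (20 * x - 11) ^ 3 * (12 - 20 * x) ^ 4
      + 911354720 * (20 * x - 11) ^ 4 * (12 - 20 * x) ^ 3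
      + 513056064 * (20 * x - 11) ^ 5 * (12 - 20 * x) ^ 2
      + 134670976 * (20 * x - 11) ^ 6 * (12 - 20 * x)
      + 9852736 * (20 * x - 11) ^ 7"
    by (intro add_nonneg_nonneg mult_nonneg_nonneg zero_le_power y) simp_all
  also have "\<dots> = 60000000 * (91 * x - 2016 * x ^ 2 + 16632 * x ^ 3 - 64800 * x ^ 4 + 128304 * x ^ 5 - 124416 * x ^ 6 + 46656 * x ^ 7 - 4 / 3) - 600000"
    by algebra
  finally show ?thesis by simp
qed

lemma dec_poly4_below_6:
  fixes x :: real
  assumes "7 / 10 \<le> x" "x \<le> 17 / 20"
  shows "0 < - (91 * x - 2016 * x ^ 2 + 16632 * x ^ 3 - 64800 * x ^ 4 + 128304 * x ^ 5 - 124416 * x ^ 6 + 46656 * x ^ 7)"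
proof -
  have y: "0 \<le> 20 * x - 14" "0 \<le> 17 - 20 * x" using assms by simp_all
  have "0 \<le> 157729664 * (17 - 20 * x) ^ 7
      + 1702213184 * (20 * x - 14) * (17 - 20 * x) ^ 6
      + 7320064416 * (20 * x - 14) ^ 2 * (17 - 20 * x) ^ 5
      + 16421508880 * (20 * x - 14) ^ 3 * (17 - 20 * x) ^ 4
      + 20706261040 * (20 * x - 14) ^ 4 * (17 - 20 * x) ^ 3
      + 14439118992 * (20 * x - 14) ^ 5 * (17 - 20 * x) ^ 2
      + 4930602062 * (20 * x - 14) ^ 6 * (17 - 20 * x)
      + 550221803 * (20 * x - 14) ^ 7"
    by (intro add_nonneg_nonneg mult_nonneg_nonneg zero_le_power y) simp_all
  also have "\<dots> = 43740000000 * (- (91 * x - 2016 * x ^ 2 + 16632 * x ^ 3 - 64800 * x ^ 4 + 128304 * x ^ 5 - 124416 * x ^ 6 + 46656 * x ^ 7)) - 43740000000"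
    by algebra
  finally show ?thesis by simp
qed

section \<open>Bands and gaps of the tree for n = 4\<close>

lemma dec_poly4_tree_bounds: "x \<in> decimation_tree dec_poly4 \<Longrightarrow> 0 \<le> x \<and> x \<le> 4 / 3"
  by (rule decimation_tree_bounds[where R = dec_poly4 and t = "7 / 200" and s = "17 / 20",
        OF dec_poly4_0 _ _ dec_poly4_mono_1 dec_poly4_mono_7])
    (simp_all add: dec_poly4_def power_divide)

lemma dec_poly4_gap_bottom: "gap (decimation_tree dec_poly4) (- 1000000) 0"
  and dec_poly4_gap_top: "gap (decimation_tree dec_poly4) (4 / 3) 1000000"
  using dec_poly4_tree_bounds unfolding gap_def by auto

lemma dec_poly4_gap_closed_1: "7 / 200 \<le> x \<Longrightarrow> x \<le> 37 / 1000 \<Longrightarrow> x \<notin> decimation_tree dec_poly4"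
  using dec_poly4_above_1[of x] decimation_tree_step[of dec_poly4 x, OF dec_poly4_0] dec_poly4_tree_bounds[of "dec_poly4 x"]
  by (auto simp: dec_poly4_def)

lemma dec_poly4_gap_closed_3: "27 / 100 \<le> x \<Longrightarrow> x \<le> 29 / 100 \<Longrightarrow> x \<notin> decimation_tree dec_poly4"
  using dec_poly4_above_3[of x] decimation_tree_step[of dec_poly4 x, OF dec_poly4_0] dec_poly4_tree_bounds[of "dec_poly4 x"]
  by (auto simp: dec_poly4_def)

lemma dec_poly4_gap_closed_5: "11 / 20 \<le> x \<Longrightarrow> x \<le> 3 / 5 \<Longrightarrow> x \<notin> decimation_tree dec_poly4"
  using dec_poly4_above_5[of x] decimation_tree_step[of dec_poly4 x, OF dec_poly4_0] dec_poly4_tree_bounds[of "dec_poly4 x"]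
  by (auto simp: dec_poly4_def)

lemma dec_poly4_gap_closed_6: "7 / 10 \<le> x \<Longrightarrow> x \<le> 17 / 20 \<Longrightarrow> x \<notin> decimation_tree dec_poly4"
  using dec_poly4_below_6[of x] decimation_tree_step[of dec_poly4 x, OF dec_poly4_0] dec_poly4_tree_bounds[of "dec_poly4 x"]
  by (auto simp: dec_poly4_def)

lemma dec_poly4_gap_1_left: "gap (decimation_tree dec_poly4) (553823 / 16777216) (7 / 200)"
  by (rule gap_increasing[of dec_poly4 "(- 1)" "7 / 200", OF dec_poly4_0 dec_poly4_mono_1 dec_poly4_gap_top])
    (simp_all add: dec_poly4_def power_divide)

lemma dec_poly4_gap_1_right: "gap (decimation_tree dec_poly4) (37 / 1000) (642013 / 16777216)"
  by (rule gap_decreasing[of dec_poly4 "37 / 1000" "13 / 100", OF dec_poly4_0 dec_poly4_mono_2 dec_poly4_gap_top])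
    (simp_all add: dec_poly4_def power_divide)

lemma dec_poly4_gap_1: "gap (decimation_tree dec_poly4) (553823 / 16777216) (642013 / 16777216)"
  by (rule gap_join[OF dec_poly4_gap_1_left dec_poly4_gap_closed_1 dec_poly4_gap_1_right])

lemma dec_poly4_gap_3_left: "gap (decimation_tree dec_poly4) (4347979 / 16777216) (27 / 100)"
  by (rule gap_increasing[of dec_poly4 "7 / 50" "27 / 100", OF dec_poly4_0 dec_poly4_mono_3 dec_poly4_gap_top])
    (simp_all add: dec_poly4_def power_divide)

lemma dec_poly4_gap_3_right: "gap (decimation_tree dec_poly4) (29 / 100) (5015217 / 16777216)"
  by (rule gap_decreasing[of dec_poly4 "29 / 100" "21 / 50", OF dec_poly4_0 dec_poly4_mono_4 dec_poly4_gap_top])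
    (simp_all add: dec_poly4_def power_divide)

lemma dec_poly4_gap_3: "gap (decimation_tree dec_poly4) (4347979 / 16777216) (5015217 / 16777216)"
  by (rule gap_join[OF dec_poly4_gap_3_left dec_poly4_gap_closed_3 dec_poly4_gap_3_right])

lemma dec_poly4_gap_5_left: "gap (decimation_tree dec_poly4) (4539607 / 8388608) (11 / 20)"
  by (rule gap_increasing[of dec_poly4 "9 / 20" "11 / 20", OF dec_poly4_0 dec_poly4_mono_5 dec_poly4_gap_top])
    (simp_all add: dec_poly4_def power_divide)

lemma dec_poly4_gap_5_right: "gap (decimation_tree dec_poly4) (3 / 5) (1272361 / 2097152)"
  by (rule gap_decreasing[of dec_poly4 "3 / 5" "7 / 10", OF dec_poly4_0 dec_poly4_mono_6 dec_poly4_gap_top])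
    (simp_all add: dec_poly4_def power_divide)

lemma dec_poly4_gap_5: "gap (decimation_tree dec_poly4) (4539607 / 8388608) (1272361 / 2097152)"
  by (rule gap_join[OF dec_poly4_gap_5_left dec_poly4_gap_closed_5 dec_poly4_gap_5_right])

lemma dec_poly4_gap_6_left: "gap (decimation_tree dec_poly4) (10630989 / 16777216) (7 / 10)"
  by (rule gap_decreasing[of dec_poly4 "3 / 5" "7 / 10", OF dec_poly4_0 dec_poly4_mono_6 dec_poly4_gap_bottom])
    (simp_all add: dec_poly4_def power_divide)

lemma dec_poly4_gap_6_right: "gap (decimation_tree dec_poly4) (17 / 20) (3725981 / 4194304)"
  by (rule gap_increasing[of dec_poly4 "17 / 20" "4 / 3", OF dec_poly4_0 dec_poly4_mono_7 dec_poly4_gap_bottom])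
    (simp_all add: dec_poly4_def power_divide)

lemma dec_poly4_gap_6: "gap (decimation_tree dec_poly4) (10630989 / 16777216) (3725981 / 4194304)"
  by (rule gap_join[OF dec_poly4_gap_6_left dec_poly4_gap_closed_6 dec_poly4_gap_6_right])

lemma dec_poly4_gap_7: "gap (decimation_tree dec_poly4) (7461055 / 8388608) (4 / 3)"
  by (rule gap_increasing[of dec_poly4 "17 / 20" "4 / 3", OF dec_poly4_0 dec_poly4_mono_7 dec_poly4_gap_top])
    (simp_all add: dec_poly4_def power_divide)

lemma dec_poly4_gap_2_7: "gap (decimation_tree dec_poly4) (321007 / 8388608) (1137119 / 16777216)"
  by (rule gap_decreasing[of dec_poly4 "37 / 1000" "13 / 100", OF dec_poly4_0 dec_poly4_mono_2 dec_poly4_gap_7])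
    (simp_all add: dec_poly4_def power_divide)

lemma dec_poly4_gap_2_6: "gap (decimation_tree dec_poly4) (1137975 / 16777216) (167185 / 2097152)"
  by (rule gap_decreasing[of dec_poly4 "37 / 1000" "13 / 100", OF dec_poly4_0 dec_poly4_mono_2 dec_poly4_gap_6])
    (simp_all add: dec_poly4_def power_divide)

text \<open>A cut of the lowest band, made in order to be pulled back along branch 2.\<close>

lemma dec_poly4_gap_1_6: "gap (decimation_tree dec_poly4) (70737 / 8388608) (111109 / 8388608)"
  by (rule gap_increasing[of dec_poly4 "(- 1)" "7 / 200", OF dec_poly4_0 dec_poly4_mono_1 dec_poly4_gap_6])
    (simp_all add: dec_poly4_def power_divide)

text \<open>The critical cut. In units of 10^-9 of the linearised coordinate it is the gap from
  15303 to 15418, and band 7 divided by sqrt 91, about 15307 to 15336, has to fit into it.\<close>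

lemma dec_poly4_gap_2_1_6: "gap (decimation_tree dec_poly4) (2060441 / 16777216) (129725 / 1048576)"
  by (rule gap_decreasing[of dec_poly4 "37 / 1000" "13 / 100", OF dec_poly4_0 dec_poly4_mono_2 dec_poly4_gap_1_6])
    (simp_all add: dec_poly4_def power_divide)

lemma dec_poly4_gap_4_7: "gap (decimation_tree dec_poly4) (2507609 / 8388608) (89523 / 262144)"
  by (rule gap_decreasing[of dec_poly4 "29 / 100" "21 / 50", OF dec_poly4_0 dec_poly4_mono_4 dec_poly4_gap_7])
    (simp_all add: dec_poly4_def power_divide)

text \<open>The fourth interval again runs from band 2 into band 3. The first, the fifth and the
  last enclose the preimages of 4/3 at the lower ends of bands 2 and 4, and 4/3 itself.\<close>

definition dec_poly4_pieces :: "(real \<times> real \<times> real \<times> real \<times> real \<times> real) list" where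
  "dec_poly4_pieces = [
    (642013 / 16777216, 321007 / 8388608, 113949 / 268435456, 56975 / 134217728, 20037 / 4294967296, 80149 / 17179869184),
    (1137119 / 16777216, 1137975 / 16777216, 203323 / 268435456, 25435 / 33554432, 286045 / 34359738368, 286267 / 34359738368),
    (167185 / 2097152, 2060441 / 16777216, 239875 / 268435456, 93417 / 67108864, 42185 / 4294967296, 262889 / 17179869184),
    (129725 / 1048576, 4347979 / 16777216, 376505 / 268435456, 204595 / 67108864, 264885 / 17179869184, 71999 / 2147483648),
    (5015217 / 16777216, 2507609 / 8388608, 477433 / 134217728, 954867 / 268435456, 84017 / 2147483648, 1344275 / 34359738368),
    (89523 / 262144, 4539607 / 8388608, 34523 / 8388608, 233541 / 33554432, 1555473 / 34359738368, 658111 / 8589934592),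
    (1272361 / 2097152, 10630989 / 16777216, 2145219 / 268435456, 2263583 / 268435456, 755835 / 8589934592, 797625 / 8589934592),
    (3725981 / 4194304, 7461055 / 8388608, 1777749 / 134217728, 3561861 / 268435456, 5017351 / 34359738368, 5026361 / 34359738368),
    (4 / 3, 4 / 3, 8861155 / 268435456, 2215289 / 67108864, 6282769 / 17179869184, 12565541 / 34359738368)]"

lemma dec_poly4_cover:
  assumes "x \<in> decimation_tree dec_poly4"
  shows "x \<le> 7 / 200 \<or> (\<exists>I\<in>set dec_poly4_pieces. fst I \<le> x \<and> x \<le> fst (snd I))"
proof -
  have "x \<le> 553823 / 16777216 \<or> (642013 / 16777216 \<le> x \<and> x \<le> 321007 / 8388608) \<or>
    (1137119 / 16777216 \<le> x \<and> x \<le> 1137975 / 16777216) \<or>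
    (167185 / 2097152 \<le> x \<and> x \<le> 2060441 / 16777216) \<or>
    (129725 / 1048576 \<le> x \<and> x \<le> 4347979 / 16777216) \<or>
    (5015217 / 16777216 \<le> x \<and> x \<le> 2507609 / 8388608) \<or>
    (89523 / 262144 \<le> x \<and> x \<le> 4539607 / 8388608) \<or>
    (1272361 / 2097152 \<le> x \<and> x \<le> 10630989 / 16777216) \<or>
    (3725981 / 4194304 \<le> x \<and> x \<le> 7461055 / 8388608) \<or> (4 / 3 \<le> x \<and> x \<le> 4 / 3)"
    using conjunct2[OF dec_poly4_tree_bounds[OF assms]]
      dec_poly4_gap_1[THEN gapD, OF assms]
      dec_poly4_gap_2_7[THEN gapD, OF assms]
      dec_poly4_gap_2_6[THEN gapD, OF assms]
      dec_poly4_gap_2_1_6[THEN gapD, OF assms]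
      dec_poly4_gap_3[THEN gapD, OF assms]
      dec_poly4_gap_4_7[THEN gapD, OF assms]
      dec_poly4_gap_5[THEN gapD, OF assms]
      dec_poly4_gap_6[THEN gapD, OF assms]
      dec_poly4_gap_7[THEN gapD, OF assms]
    by blast
  moreover have "x \<le> 553823 / 16777216 \<Longrightarrow> x \<le> 7 / 200" by simp
  ultimately show ?thesis
    unfolding dec_poly4_pieces_def list.set bex_simps fst_conv snd_conv by blast
qed

section \<open>Estimates near 0 and comparison of the pieces for n = 4\<close>

lemma dec_poly4_up_aux:
  fixes x :: real
  assumes "0 \<le> x" "x \<le> 7 / 200"
  shows "0 < 2016 - 16632 * x + 64800 * x ^ 2 - 128304 * x ^ 3 + 124416 * x ^ 4 - 46656 * x ^ 5"
proof -
  have y: "0 \<le> 200 * x" "0 \<le> 7 - 200 * x" using assms by simp_all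
  have "0 \<le> 10075000000000 * (7 - 200 * x) ^ 5
      + 47464400000000 * (200 * x) * (7 - 200 * x) ^ 4
      + 89504500000000 * (200 * x) ^ 2 * (7 - 200 * x) ^ 3
      + 84449594830000 * (200 * x) ^ 3 * (7 - 200 * x) ^ 2
      + 39869223168800 * (200 * x) ^ 4 * (7 - 200 * x)
      + 7534716086497 * (200 * x) ^ 5"
    by (intro add_nonneg_nonneg mult_nonneg_nonneg zero_le_power y) simp_all
  also have "\<dots> = 84035000000000 * (2016 - 16632 * x + 64800 * x ^ 2 - 128304 * x ^ 3 + 124416 * x ^ 4 - 46656 * x ^ 5) - 84035000000000"
    by algebra
  finally show ?thesis by simp
qed

lemma dec_poly4_grow_aux:
  fixes x :: real
  assumes "0 \<le> x" "x \<le> 7 / 200"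
  shows "0 < 89 - 2016 * x + 16632 * x ^ 2 - 64800 * x ^ 3 + 128304 * x ^ 4 - 124416 * x ^ 5 + 46656 * x ^ 6"
proof -
  have y: "0 \<le> 200 * x" "0 \<le> 7 - 200 * x" using assms by simp_all
  have "0 \<le> 88000000000000 * (7 - 200 * x) ^ 6
      + 457440000000000 * (200 * x) * (7 - 200 * x) ^ 5
      + 987574200000000 * (200 * x) ^ 2 * (7 - 200 * x) ^ 4
      + 1133118500000000 * (200 * x) ^ 3 * (7 - 200 * x) ^ 3
      + 728502836190000 * (200 * x) ^ 4 * (7 - 200 * x) ^ 2
      + 248740437818400 * (200 * x) ^ 5 * (7 - 200 * x)
      + 35221987394521 * (200 * x) ^ 6"
    by (intro add_nonneg_nonneg mult_nonneg_nonneg zero_le_power y) simp_all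
  also have "\<dots> = 117649000000000000 * (89 - 2016 * x + 16632 * x ^ 2 - 64800 * x ^ 3 + 128304 * x ^ 4 - 124416 * x ^ 5 + 46656 * x ^ 6) - 117649000000000000"
    by algebra
  finally show ?thesis by simp
qed

lemma dec_poly4_low_aux:
  fixes x :: real
  assumes "0 \<le> x" "x \<le> 7 / 200"
  shows "0 < 16632 - 64800 * x + 128304 * x ^ 2 - 124416 * x ^ 3 + 46656 * x ^ 4"
proof -
  have y: "0 \<le> 200 * x" "0 \<le> 7 - 200 * x" using assms by simp_all
  have "0 \<le> 415775000000 * (7 - 200 * x) ^ 4
      + 1606400000000 * (200 * x) * (7 - 200 * x) ^ 3
      + 2328479310000 * (200 * x) ^ 2 * (7 - 200 * x) ^ 2
      + 1500725261600 * (200 * x) ^ 3 * (7 - 200 * x)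
      + 362872701929 * (200 * x) ^ 4"
    by (intro add_nonneg_nonneg mult_nonneg_nonneg zero_le_power y) simp_all
  also have "\<dots> = 60025000000 * (16632 - 64800 * x + 128304 * x ^ 2 - 124416 * x ^ 3 + 46656 * x ^ 4) - 60025000000"
    by algebra
  finally show ?thesis by simp
qed

lemma dec_poly4_estimates:
  assumes x: "0 \<le> x" "x \<le> 7 / 200"
  shows "dec_poly4 x \<le> 91 * x" "2 * x \<le> dec_poly4 x" "91 * x - 2016 * x\<^sup>2 \<le> dec_poly4 x"
proof -
  have "91 * x - dec_poly4 x = x\<^sup>2 * (2016 - 16632 * x + 64800 * x ^ 2 - 128304 * x ^ 3 + 124416 * x ^ 4 - 46656 * x ^ 5)"
    unfolding dec_poly4_def by algebra
  then show "dec_poly4 x \<le> 91 * x"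
    using mult_nonneg_nonneg[OF zero_le_power2[of x] less_imp_le[OF dec_poly4_up_aux[OF x]]] by linarith
  have "dec_poly4 x - 2 * x = x * (89 - 2016 * x + 16632 * x ^ 2 - 64800 * x ^ 3 + 128304 * x ^ 4 - 124416 * x ^ 5 + 46656 * x ^ 6)"
    unfolding dec_poly4_def by algebra
  then show "2 * x \<le> dec_poly4 x"
    using mult_nonneg_nonneg[OF x(1) less_imp_le[OF dec_poly4_grow_aux[OF x]]] by linarith
  have low: "0 \<le> (16632 - 64800 * x + 128304 * x ^ 2 - 124416 * x ^ 3 + 46656 * x ^ 4 :: real)"
    using dec_poly4_low_aux[OF x] by simp
  have "dec_poly4 x - (91 * x - 2016 * x\<^sup>2) = x ^ 3 * (16632 - 64800 * x + 128304 * x ^ 2 - 124416 * x ^ 3 + 46656 * x ^ 4)"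
    unfolding dec_poly4_def by algebra
  then show "91 * x - 2016 * x\<^sup>2 \<le> dec_poly4 x"
    using mult_nonneg_nonneg[OF zero_le_power[OF x(1), of 3] low] by linarith
qed

lemma dec_poly4_fraction:
  fixes a b :: real
  assumes "b \<noteq> 0"
  shows "dec_poly4 (a / b) = (91 * a * b ^ 6 - 2016 * a ^ 2 * b ^ 5 + 16632 * a ^ 3 * b ^ 4 - 64800 * a ^ 4 * b ^ 3 + 128304 * a ^ 5 * b ^ 2 - 124416 * a ^ 6 * b + 46656 * a ^ 7) / b ^ 7"
  using assms by (simp add: dec_poly4_def field_simps eval_nat_numeral)

lemma dec_poly4_branch_bounds: "list_all (branch_bounds dec_poly4 (7 / 200) (37 / 100000)) dec_poly4_pieces"
  unfolding dec_poly4_pieces_def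
  by (simp add: branch_bounds_def dec_poly4_fraction)

text \<open>Divided by sqrt 91, the intervals six to nine fall into the gaps 2_7, 2_6, 2_1_6 and 3
  respectively, in linearised coordinates.\<close>

definition dec_poly4_bounds :: "(real \<times> real) list" where
  "dec_poly4_bounds = [
    (4665 / 1000000000, 4666 / 1000000000),
    (8325 / 1000000000, 8332 / 1000000000),
    (9821 / 1000000000, 15303 / 1000000000),
    (15418 / 1000000000, 33528 / 1000000000),
    (39123 / 1000000000, 39124 / 1000000000),
    (45270 / 1000000000, 76616 / 1000000000),
    (87990 / 1000000000, 92859 / 1000000000),
    (146024 / 1000000000, 146292 / 1000000000),
    (365705 / 1000000000, 365741 / 1000000000)]"

text \<open>The value 13/50 is 2016 / (91^2 - 91) = 16/65 rounded up.\<close>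

lemma dec_poly4_bounds: "list_all2 (\<lambda>P Q. fst Q \<le> fst P \<and> snd P \<le> snd Q)
    (map (scaled_bounds (13 / 50)) dec_poly4_pieces) dec_poly4_bounds"
  unfolding dec_poly4_pieces_def dec_poly4_bounds_def
  by (simp add: scaled_bounds_def power_divide)

text \<open>The factor 5001/5000 is dictated by the eighth interval against the third: 146024/15303
  is about 9.542, while sqrt 91 is about 9.539.\<close>

lemma dec_poly4_avoids:
  "P \<in> set dec_poly4_bounds \<Longrightarrow> Q \<in> set dec_poly4_bounds \<Longrightarrow> avoids_sqrt 91 (5001 / 5000) P Q"
proof -
  have "list_all (\<lambda>P. list_all (avoids_sqrt 91 (5001 / 5000) P) dec_poly4_bounds) dec_poly4_bounds"
    unfolding dec_poly4_bounds_def
    by (simp add: avoids_sqrt_def power_divide)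
  then show "P \<in> set dec_poly4_bounds \<Longrightarrow> Q \<in> set dec_poly4_bounds \<Longrightarrow> avoids_sqrt 91 (5001 / 5000) P Q"
    unfolding list_all_iff by blast
qed

lemma dec_poly4_ratio_gap: "small_ratio_gap 91 (decimation_tree dec_poly4)"
proof (rule small_ratio_gapI[OF _ _ dec_poly4_avoids scaled_cover_weaken[OF dec_poly4_bounds]])
  show "\<exists>e>0. \<forall>x\<in>decimation_tree dec_poly4. 0 < x \<longrightarrow> x < e \<longrightarrow>
    (\<exists>j. \<exists>(A, B)\<in>set (map (scaled_bounds (13 / 50)) dec_poly4_pieces). A \<le> 91 ^ j * x \<and> 91 ^ j * x \<le> B)"
    by (rule scaled_cover[where R = dec_poly4 and t = "7 / 200" and s = "37 / 100000" and c = 2016 and \<rho> = 91,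
          OF dec_poly4_0 _ _ _ _ _ _ dec_poly4_mono_1 dec_poly4_estimates])
      (use dec_poly4_tree_bounds dec_poly4_cover dec_poly4_branch_bounds[unfolded list_all_iff] in \<open>simp_all add: power2_eq_square\<close>)
qed simp_all

section \<open>The ratio gap\<close>

theorem mainTheorem5:
  fixes n :: nat
  assumes "n \<in> {2, 3, 4}"
  shows "\<exists>a b :: real. a < sqrt (rho n) \<and> sqrt (rho n) < b \<and>
    (\<forall>l m. neumann_eigenvalue n l \<and> l \<noteq> 0 \<and> neumann_eigenvalue n m \<and> m \<noteq> 0
       \<longrightarrow> l / m \<notin> {a<..<b})"
proof -
  consider "n = 2" | "n = 3" | "n = 4" using assms by auto
  then show ?thesis
  proof cases
    case 1
    have "small_ratio_gap (rho 2) (decimation_tree (decimation_map 2))"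
      using dec_poly2_ratio_gap by (simp add: rho_def decimation_map_2)
    then show ?thesis
      unfolding 1 using dec_poly2_tree_bounds
      by (intro neumann_ratio_gap) (auto simp: decimation_map_2)
  next
    case 2
    have "small_ratio_gap (rho 3) (decimation_tree (decimation_map 3))"
      using dec_poly3_ratio_gap by (simp add: rho_def decimation_map_3)
    then show ?thesis
      unfolding 2 using dec_poly3_tree_bounds
      by (intro neumann_ratio_gap) (auto simp: decimation_map_3)
  next
    case 3
    have "small_ratio_gap (rho 4) (decimation_tree (decimation_map 4))"
      using dec_poly4_ratio_gap by (simp add: rho_def decimation_map_4)
    then show ?thesis
      unfolding 3 using dec_poly4_tree_bounds
      by (intro neumann_ratio_gap) (auto simp: decimation_map_4)
  qed
qed

end
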